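(* Let $\gamma \colon [0,2\pi) \to S^{2}$ be the curve $\gamma(\theta) = \tfrac{1}{\sqrt{2}}(\cos\theta,\sin\theta,1)$, and for $\theta \in [0,2\pi)$ let $\rho_{\theta} \colon \mathbb{R}^{3} \to \mathbb{R}$ be the map $\rho_{\theta}(z) = \gamma(\theta)\cdot z$. If $K \subset \mathbb{R}^{3}$ is an analytic set, then $$\dim_{\mathrm{H}} \rho_{\theta}(K) = \min\{\dim_{\mathrm{H}} K, 1\}$$ for Lebesgue almost every $\theta \in [0,2\pi)$.
   Context: $S^{2}$ is the unit sphere in $\mathbb{R}^{3}$, $\cdot$ is the Euclidean inner product, and $\dim_{\mathrm{H}}$ denotes Hausdorff dimension. "Analytic" means analytic (Suslin) set in the sense of descriptive set theory. *)

theory Defs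
  imports "HOL-Analysis.Analysis"
begin

text \<open>
  The summand \<open>diam(U)\<^sup>s\<close> of the Hausdorff measure, with the conventions \<open>0\<^sup>0 = 1\<close> for nonempty \<open>U\<close>
  (the library has \<open>0 powr 0 = 0\<close>) and value 0 for empty \<open>U\<close>, so that \<open>s = 0\<close> gives counting measure.
\<close>

definition diam_powr :: "real \<Rightarrow> 'a::metric_space set \<Rightarrow> ennreal" where
  "diam_powr s U =
     (if U = {} then 0 else if s = 0 then 1 else ennreal (diameter U powr s))"

text \<open>
  Boundedness is required explicitly because \<^const>\<open>diameter\<close> is real-valued and
  carries no information on unbounded sets. Finite covers are included, as the \<open>U i\<close> may be empty.
\<close>

definition hausdorff_content :: "real \<Rightarrow> real \<Rightarrow> 'a::metric_space set \<Rightarrow> ennreal" where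
  "hausdorff_content \<delta> s E =
     Inf {(\<Sum>i. diam_powr s (U i)) | U :: nat \<Rightarrow> 'a set.
            E \<subseteq> (\<Union>i. U i) \<and> (\<forall>i. bounded (U i) \<and> diameter (U i) \<le> \<delta>)}"

definition hausdorff_measure :: "real \<Rightarrow> 'a::metric_space set \<Rightarrow> ennreal" where
  "hausdorff_measure s E = (SUP \<delta>\<in>{0<..}. hausdorff_content \<delta> s E)"

text \<open>In particular the empty set has dimension 0.\<close>

definition hausdorff_dim :: "'a::metric_space set \<Rightarrow> ennreal" where
  "hausdorff_dim E = Inf {ennreal s | s. 0 \<le> s \<and> hausdorff_measure s E = 0}"

text \<open>
  Analytic (Suslin) sets: the empty set and the continuous images of the Baire space, which is
  the type \<^typ>\<open>nat \<Rightarrow> nat\<close> with the product of the discrete topologies.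
\<close>

definition analytic_set :: "'a::topological_space set \<Rightarrow> bool" where
  "analytic_set A \<longleftrightarrow>
     A = {} \<or> (\<exists>f :: (nat \<Rightarrow> nat) \<Rightarrow> 'a. continuous_on UNIV f \<and> A = range f)"

definition cone_curve :: "real \<Rightarrow> real^3" where
  "cone_curve \<theta> = (1 / sqrt 2) *\<^sub>R vector [cos \<theta>, sin \<theta>, 1]"

lemma cone_curve_in_sphere: "cone_curve \<theta> \<in> sphere 0 1"
proof -
  have "cone_curve \<theta> \<bullet> cone_curve \<theta> = ((cos \<theta>)\<^sup>2 + (sin \<theta>)\<^sup>2 + 1) / 2"
    by (simp add: cone_curve_def inner_vec_def sum_3 power2_eq_square field_simps)
  then show ?thesis
    by (simp add: norm_eq_sqrt_inner)
qed

definition proj_line :: "real \<Rightarrow> real^3 \<Rightarrow> real" where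
  "proj_line \<theta> z = cone_curve \<theta> \<bullet> z"

end

theory Submission
  imports Defs
begin

text \<open>
  The substitution \<open>u = tan ((\<theta> - \<alpha>) / 2)\<close> turns \<open>\<surd>2 (1 + u\<^sup>2) \<rho>\<^sub>\<theta>(z)\<close> into the quadratic polynomial
  \<open>a + b u + c u\<^sup>2\<close>, where \<open>(a, b, c)\<close> depends linearly and bijectively on \<open>z\<close>. The point is then a bound for the
  number of near-incidences between points \<open>u\<close> and pairs of parabolas drawn from a Frostman measure. Pairs crossing
  transversally at \<open>u\<close> leave the strip around each other quickly and are counted one by one. Pairs nearly tangent
  at \<open>u\<close> form the edges of a bipartite graph between two small clusters of parabolas. In a nondegenerate
  4-cycle of this graph, a sign count for the two quadratic differences shows that if the two tangencies on each
  parabola of one cluster are \<open>h\<close>-close, then those on each parabola of the other cluster are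
  \<open>\<eta>h\<close>-close with \<open>\<eta>\<close> small. Cauchy-Schwarz, applied to the two sides
  alternately, iterates this gain until only degenerate cycles are left, so the graph has few edges. By induction on
  scales, for most \<open>u\<close> the projected measure of most intervals of length \<open>\<delta>\<close> is then at most
  \<open>\<delta>\<^sup>\<sigma>\<close> up to a small power of \<open>\<delta>\<close>.

  The Frostman measure is replaced by consistent masses of dyadic cubes; an analytic set contains a
  compact set of positive dyadic content by the usual capacitability argument, so that no measure has to be constructed.
\<close>

section \<open>Tangent parabolas and 4-cycles\<close>

text \<open>The obstacle is that one parameter is too few for transversality in three-space. For
  each \<open>u\<close> there is a direction of differences along which value and slope both vanish
  at \<open>u\<close>; such a pair at distance \<open>r\<close> stays in the strip of width \<rho>
  for a time of order \<open>sqrt (\<rho> / r)\<close> instead of \<open>\<rho> / r\<close>, and a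
  plain average over \<open>u\<close> would stop at exponent 1/2. What survives at a tangency is
  curvature: the leading coefficients of the pair then differ by at least
  \<open>\<kappa> * r / 6\<close>. The gain of the 4-cycle argument is a quotient of curvatures:
  parabolas in a cell of side \<open>\<kappa> ^ 3 * r\<close> have nearly equal leading coefficients
  compared with the gap between the two clusters, so the tangencies contract by a factor at most
  \<kappa>. Transversal pairs are paid for by \<sigma> < 1: refining a strip by a factor
  \<open>y\<close> costs \<open>y powr \<sigma>\<close> in the level but gains \<open>y\<close> in
  time. In the end \<kappa> is the fixed power \<open>1 / I\<close> of the final width. The number
  of scales is therefore bounded by \<open>I\<close>, all losses are bounded powers of \<kappa>, and
  a large \<open>I\<close> makes them arbitrarily small powers of the width.\<close>

lemma quadratic_no_three_sign_changes:
  fixes a b c :: real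
  defines "f \<equiv> \<lambda>u. a + b * u + c * u\<^sup>2"
  assumes "s1 < s2" "s2 < s3" "s3 < s4"
    and "f s1 < 0" "f s2 > 0" "f s3 < 0" "f s4 > 0"
  shows False
proof -
  \<comment> \<open>The third divided difference of a quadratic vanishes; this is that identity with
    denominators cleared. The assumed signs make its left side positive and its right side
    negative.\<close>
  have "f s4 * ((s2 - s1) * (s3 - s1) * (s3 - s2)) + f s2 * ((s3 - s1) * (s4 - s1) * (s4 - s3))
     = f s3 * ((s2 - s1) * (s4 - s1) * (s4 - s2)) + f s1 * ((s3 - s2) * (s4 - s2) * (s4 - s3))"
    unfolding f_def by algebra
  moreover have "f s4 * ((s2 - s1) * (s3 - s1) * (s3 - s2)) > 0" "f s2 * ((s3 - s1) * (s4 - s1) * (s4 - s3)) > 0"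
    using assms by auto
  moreover have "f s3 * ((s2 - s1) * (s4 - s1) * (s4 - s2)) < 0" "f s1 * ((s3 - s2) * (s4 - s2) * (s4 - s3)) < 0"
    using assms by (auto simp: mult_neg_pos)
  ultimately show False by linarith
qed

text \<open>The second divided difference of \<open>f\<close> is \<open>c\<close>, so
  \<open>f s1\<close> is the right-hand side plus multiples of \<open>f s2\<close> and
  \<open>f s3\<close>. The first assumption places \<open>s2\<close> strictly between
  \<open>s1\<close> and \<open>s3\<close> in either orientation, and then both multiples contribute
  nonpositively.\<close>

lemma quadratic_three_point_bound:
  fixes a b c :: real
  defines "f \<equiv> \<lambda>u. a + b * u + c * u\<^sup>2"
  assumes "0 < (s2 - s1) * (s3 - s2)" "f s2 \<le> 0" "0 \<le> f s3"
  shows "f s1 \<le> c * ((s2 - s1) * (s3 - s1))"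
proof -
  have ne: "s1 \<noteq> s2" "s2 \<noteq> s3" using assms(2) by auto
  have eq: "f s1 * (s3 - s2) - f s2 * (s3 - s1) + f s3 * (s2 - s1)
     = c * ((s2 - s1) * (s3 - s1)) * (s3 - s2)"
    unfolding f_def by algebra
  show ?thesis
  proof (cases "s1 < s2")
    case True
    then have l: "s2 < s3" using assms(2) by (simp add: zero_less_mult_iff)
    have "f s2 * (s3 - s1) \<le> 0" "0 \<le> f s3 * (s2 - s1)"
      using True l assms by (auto simp: mult_nonpos_nonneg)
    then have "f s1 * (s3 - s2) \<le> c * ((s2 - s1) * (s3 - s1)) * (s3 - s2)"
      using eq by linarith
    then show ?thesis using l by simp
  next
    case False
    then have "s2 < s1" using ne by simp
    moreover from this have l: "s3 < s2" using assms(2) by (simp add: zero_less_mult_iff)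
    ultimately have "0 \<le> f s2 * (s3 - s1)" "f s3 * (s2 - s1) \<le> 0"
      using assms by (auto simp: mult_nonneg_nonpos mult_nonpos_nonpos)
    then have "c * ((s2 - s1) * (s3 - s1)) * (s3 - s2) \<le> f s1 * (s3 - s2)"
      using eq by linarith
    then show ?thesis using l by (simp add: mult_le_cancel_right)
  qed
qed

definition quad :: "('i \<Rightarrow> real) \<Rightarrow> ('i \<Rightarrow> real) \<Rightarrow> ('i \<Rightarrow> real) \<Rightarrow> 'i \<Rightarrow> real \<Rightarrow> real" where
  "quad a b c i u = a i + b i * u + c i * u\<^sup>2"

text \<open>
  \<open>f\<close> touches \<open>g\<close> from below at \<open>u\<close> up to an error \<open>\<rho>\<close>, and outside the \<open>w\<close>-neighbourhood of \<open>u\<close>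
  the gap is that of two exactly tangent parabolas.
\<close>

definition touch :: "real \<Rightarrow> real \<Rightarrow> real \<Rightarrow> (real \<Rightarrow> real) \<Rightarrow> (real \<Rightarrow> real) \<Rightarrow> real \<Rightarrow> bool" where
  "touch \<rho> t w f g u \<longleftrightarrow> \<bar>g u - f u\<bar> \<le> \<rho> \<and> (\<forall>v. w \<le> \<bar>v - u\<bar> \<longrightarrow> t / 2 * (v - u)\<^sup>2 \<le> g v - f v)"

lemma touch_uminus: "touch \<rho> t w (\<lambda>v. - g v) (\<lambda>v. - f v) u \<longleftrightarrow> touch \<rho> t w f g u"
  by (auto simp: touch_def abs_minus_commute)

text \<open>At \<open>u1\<close> the function \<open>f1\<close> is within \<rho> of
  \<open>g\<close>, while \<open>f2\<close> already has the full quadratic gap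
  \<open>t / 2 * (u1 - u2)\<^sup>2\<close> below \<open>g\<close>. The condition on \<open>w\<close>
  makes \<rho> at most half of this gap.\<close>

lemma touch_gap_below:
  assumes "touch \<rho> t w f1 g u1" "touch \<rho> t w f2 g u2" "w \<le> \<bar>u1 - u2\<bar>" "4 * \<rho> \<le> t * w\<^sup>2" "0 < t" "0 < w"
  shows "t / 4 * (u1 - u2)\<^sup>2 \<le> f1 u1 - f2 u1"
proof -
  have "t / 2 * (u1 - u2)\<^sup>2 \<le> g u1 - f2 u1" using assms by (simp add: touch_def)
  moreover have "g u1 - f1 u1 \<le> \<rho>" using assms by (simp add: touch_def abs_le_iff)
  moreover have "w\<^sup>2 \<le> (u1 - u2)\<^sup>2"
    using assms by (metis abs_le_square_iff abs_of_pos)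
  then have "t * w\<^sup>2 \<le> t * (u1 - u2)\<^sup>2" using assms by simp
  ultimately show ?thesis using assms(4) by linarith
qed

lemma touch_gap_above:
  assumes "touch \<rho> t w f g1 u1" "touch \<rho> t w f g2 u2" "w \<le> \<bar>u1 - u2\<bar>" "4 * \<rho> \<le> t * w\<^sup>2" "0 < t" "0 < w"
  shows "t / 4 * (u1 - u2)\<^sup>2 \<le> g2 u1 - g1 u1"
  using touch_gap_below[of \<rho> t w "\<lambda>v. - g1 v" "\<lambda>v. - f v" u1 "\<lambda>v. - g2 v" u2] assms
  by (simp add: touch_uminus)

text \<open>Touching fixes the signs of two quadratics: \<open>F x1 - F x2\<close> is positive at
  \<open>u1\<close>, \<open>v1\<close> and negative at \<open>u2\<close>, \<open>v2\<close>;
  \<open>G y - G y'\<close> is negative at \<open>u1\<close>, \<open>u2\<close> and positive at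
  \<open>v1\<close>, \<open>v2\<close>. Neither can change sign three times, which leaves only the
  order \<open>u1 < u2 < v2 < v1\<close>. Then \<open>F x1 - F x2\<close> at \<open>u1\<close> is at
  least \<open>t / 4 * (u1 - u2)\<^sup>2\<close> and at most
  \<open>k * ((u2 - u1) * (v1 - u1))\<close>, and one factor cancels; the same works at
  \<open>v1\<close>.\<close>

lemma cycle_spacing_ordered:
  fixes a b c :: "'i \<Rightarrow> real" and a' b' c' :: "'j \<Rightarrow> real"
  defines "F \<equiv> quad a b c" and "G \<equiv> quad a' b' c'"
  assumes T: "touch \<rho> t w (F x1) (G y) u1" "touch \<rho> t w (F x2) (G y) u2"
    "touch \<rho> t w (F x1) (G y') v1" "touch \<rho> t w (F x2) (G y') v2"
    and w: "w \<le> \<bar>u1 - u2\<bar>" "w \<le> \<bar>v1 - v2\<bar>" "w \<le> \<bar>u1 - v1\<bar>" "w \<le> \<bar>u2 - v2\<bar>"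
    and pos: "0 < t" "0 < w" "4 * \<rho> \<le> t * w\<^sup>2"
    and c: "\<bar>c x1 - c x2\<bar> \<le> k"
    and lt: "u1 < v1" "u2 < v2" "u1 < u2" and h: "\<bar>u1 - v1\<bar> \<le> h"
  shows "\<bar>u1 - u2\<bar> \<le> 4 * k / t * h \<and> \<bar>v1 - v2\<bar> \<le> 4 * k / t * h"
proof -
  define D where "D v = (a x1 - a x2) + (b x1 - b x2) * v + (c x1 - c x2) * v\<^sup>2" for v
  define E where "E v = (a' y - a' y') + (b' y - b' y') * v + (c' y - c' y') * v\<^sup>2" for v
  have D: "D v = F x1 v - F x2 v" and E: "E v = G y v - G y' v" for v
    by (auto simp: D_def E_def F_def G_def quad_def algebra_simps)
  have ne: "u1 \<noteq> u2" "v1 \<noteq> v2" "u1 \<noteq> v1" "u2 \<noteq> v2" using w pos by auto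
  have sq: "0 < t / 4 * (p - q)\<^sup>2" if "p \<noteq> q" for p q :: real using that pos by simp
  have Du1: "t / 4 * (u1 - u2)\<^sup>2 \<le> D u1"
    using touch_gap_below[OF T(1,2) w(1) pos(3,1,2)] by (simp add: D)
  have Dv1: "t / 4 * (v1 - v2)\<^sup>2 \<le> D v1"
    using touch_gap_below[OF T(3,4) w(2) pos(3,1,2)] by (simp add: D)
  have "t / 4 * (u2 - u1)\<^sup>2 \<le> - D u2"
    using touch_gap_below[OF T(2,1) _ pos(3,1,2)] w(1) by (simp add: D abs_minus_commute)
  then have Du2: "D u2 < 0" using sq[of u2 u1] ne by linarith
  have "t / 4 * (v2 - v1)\<^sup>2 \<le> - D v2"
    using touch_gap_below[OF T(4,3) _ pos(3,1,2)] w(2) by (simp add: D abs_minus_commute)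
  then have Dv2: "D v2 < 0" using sq[of v2 v1] ne by linarith
  have "t / 4 * (u1 - v1)\<^sup>2 \<le> - E u1"
    using touch_gap_above[OF T(1,3) w(3) pos(3,1,2)] by (simp add: E)
  then have Eu1: "E u1 < 0" using sq[of u1 v1] ne by linarith
  have "t / 4 * (u2 - v2)\<^sup>2 \<le> - E u2"
    using touch_gap_above[OF T(2,4) w(4) pos(3,1,2)] by (simp add: E)
  then have Eu2: "E u2 < 0" using sq[of u2 v2] ne by linarith
  have "t / 4 * (v1 - u1)\<^sup>2 \<le> E v1"
    using touch_gap_above[OF T(3,1) _ pos(3,1,2)] w(3) by (simp add: E abs_minus_commute)
  then have Ev1: "E v1 > 0" using sq[of v1 u1] ne by linarith
  have "t / 4 * (v2 - u2)\<^sup>2 \<le> E v2"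
    using touch_gap_above[OF T(4,2) _ pos(3,1,2)] w(4) by (simp add: E abs_minus_commute)
  then have Ev2: "E v2 > 0" using sq[of v2 u2] ne by linarith
  have u2v1: "u2 < v1"
  proof (rule ccontr)
    assume "\<not> u2 < v1"
    moreover have "u2 \<noteq> v1" using Eu2 Ev1 by auto
    ultimately show False
      using quadratic_no_three_sign_changes[of u1 v1 u2 v2 "a' y - a' y'" "b' y - b' y'" "c' y - c' y'"]
        lt Eu1 Eu2 Ev1 Ev2 by (simp add: E_def)
  qed
  have v2v1: "v2 < v1"
  proof (rule ccontr)
    assume "\<not> v2 < v1"
    then have "v1 < v2" using ne by auto
    then show False
      using quadratic_no_three_sign_changes[of u1 u2 v1 v2 "- (a x1 - a x2)" "- (b x1 - b x2)" "- (c x1 - c x2)"]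
        lt u2v1 Du1 Du2 Dv1 Dv2 sq[of u1 u2] sq[of v1 v2] ne by (simp add: D_def algebra_simps)
  qed
  have Dpos: "0 < D u1" "0 < D v1" using Du1 Dv1 sq[of u1 u2] sq[of v1 v2] ne by linarith+
  have c0: "c x1 - c x2 \<le> k" using c by simp
  have "D u1 \<le> (c x1 - c x2) * ((u2 - u1) * (v1 - u1))"
    unfolding D_def
    by (rule quadratic_three_point_bound) (use lt u2v1 Du2 Dpos in \<open>auto simp: D_def\<close>)
  also have "\<dots> \<le> k * ((u2 - u1) * (v1 - u1))"
    using c0 lt by (intro mult_right_mono) auto
  finally have "t / 4 * (u1 - u2)\<^sup>2 \<le> k * ((u2 - u1) * (v1 - u1))" using Du1 by linarith
  moreover have "t / 4 * (u1 - u2)\<^sup>2 = t / 4 * (u2 - u1) * (u2 - u1)"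
    "k * ((u2 - u1) * (v1 - u1)) = k * (v1 - u1) * (u2 - u1)"
    by (simp_all add: power2_eq_square field_simps)
  ultimately have "t / 4 * (u2 - u1) * (u2 - u1) \<le> k * (v1 - u1) * (u2 - u1)"
    by (simp only:)
  then have 1: "t / 4 * (u2 - u1) \<le> k * (v1 - u1)"
    by (rule mult_right_le_imp_le) (use lt in auto)
  have "D v1 \<le> (c x1 - c x2) * ((v2 - v1) * (u1 - v1))"
    unfolding D_def
    by (rule quadratic_three_point_bound) (use lt v2v1 Dv2 Dpos in \<open>auto simp: D_def mult_neg_neg\<close>)
  also have "\<dots> \<le> k * ((v2 - v1) * (u1 - v1))"
    using c0 lt v2v1 by (intro mult_right_mono) (auto simp: mult_nonpos_nonpos)
  finally have "t / 4 * (v1 - v2)\<^sup>2 \<le> k * ((v2 - v1) * (u1 - v1))" using Dv1 by linarith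
  moreover have "t / 4 * (v1 - v2)\<^sup>2 = t / 4 * (v1 - v2) * (v1 - v2)"
    "k * ((v2 - v1) * (u1 - v1)) = k * (v1 - u1) * (v1 - v2)"
    by (simp_all add: power2_eq_square field_simps)
  ultimately have "t / 4 * (v1 - v2) * (v1 - v2) \<le> k * (v1 - u1) * (v1 - v2)"
    by (simp only:)
  then have 2: "t / 4 * (v1 - v2) \<le> k * (v1 - u1)"
    by (rule mult_right_le_imp_le) (use v2v1 in auto)
  have "0 \<le> k" using c by linarith
  then have 3: "k * (v1 - u1) \<le> k * h" using h lt by (intro mult_left_mono) auto
  show ?thesis using 1 2 3 pos lt v2v1 by (simp add: field_simps)
qed

text \<open>Exchanging \<open>x1\<close> with \<open>x2\<close> or \<open>y\<close> with
  \<open>y'\<close> reduces this to the ordered case. The hypothesis \<open>same\<close> rules out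
  cycles whose two orders disagree, which the sign count does not treat; strictness in its second
  alternative comes back from the separation by \<open>w\<close>.\<close>

lemma cycle_spacing:
  fixes a b c :: "'i \<Rightarrow> real" and a' b' c' :: "'j \<Rightarrow> real"
  defines "F \<equiv> quad a b c" and "G \<equiv> quad a' b' c'"
  assumes T: "touch \<rho> t w (F x1) (G y) u1" "touch \<rho> t w (F x2) (G y) u2"
    "touch \<rho> t w (F x1) (G y') v1" "touch \<rho> t w (F x2) (G y') v2"
    and w: "w \<le> \<bar>u1 - u2\<bar>" "w \<le> \<bar>v1 - v2\<bar>" "w \<le> \<bar>u1 - v1\<bar>" "w \<le> \<bar>u2 - v2\<bar>"
    and pos: "0 < t" "0 < w" "4 * \<rho> \<le> t * w\<^sup>2"
    and c: "\<bar>c x1 - c x2\<bar> \<le> k"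
    and same: "u1 < v1 \<and> u2 < v2 \<or> v1 \<le> u1 \<and> v2 \<le> u2"
    and h: "\<bar>u1 - v1\<bar> \<le> h" "\<bar>u2 - v2\<bar> \<le> h"
  shows "\<bar>u1 - u2\<bar> \<le> 4 * k / t * h \<and> \<bar>v1 - v2\<bar> \<le> 4 * k / t * h"
proof -
  have *: "\<bar>u1 - u2\<bar> \<le> 4 * k / t * h \<and> \<bar>v1 - v2\<bar> \<le> 4 * k / t * h"
    if T: "touch \<rho> t w (F x1) (G y) u1" "touch \<rho> t w (F x2) (G y) u2"
    "touch \<rho> t w (F x1) (G y') v1" "touch \<rho> t w (F x2) (G y') v2"
    and w: "w \<le> \<bar>u1 - u2\<bar>" "w \<le> \<bar>v1 - v2\<bar>" "w \<le> \<bar>u1 - v1\<bar>" "w \<le> \<bar>u2 - v2\<bar>"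
    and c: "\<bar>c x1 - c x2\<bar> \<le> k" and lt: "u1 < v1" "u2 < v2"
    and h: "\<bar>u1 - v1\<bar> \<le> h" "\<bar>u2 - v2\<bar> \<le> h" for y y' u1 v1 u2 v2
  proof (cases "u1 < u2")
    case True
    show ?thesis
      by (rule cycle_spacing_ordered[OF T[unfolded F_def G_def] w pos c lt True h(1)])
  next
    case False
    then have "u2 < u1" using w(1) pos by auto
    then have "\<bar>u2 - u1\<bar> \<le> 4 * k / t * h \<and> \<bar>v2 - v1\<bar> \<le> 4 * k / t * h"
      by (intro cycle_spacing_ordered[OF T(2,1,4,3)[unfolded F_def G_def] _ _ w(4,3) pos _ lt(2,1) _ h(2)])
        (use w c in \<open>auto simp: abs_minus_commute\<close>)
    then show ?thesis by (simp add: abs_minus_commute)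
  qed
  from same show ?thesis
  proof
    assume "u1 < v1 \<and> u2 < v2"
    then show ?thesis using *[OF T w c _ _ h] by blast
  next
    assume "v1 \<le> u1 \<and> v2 \<le> u2"
    then have "v1 < u1" "v2 < u2" using w(3,4) pos by auto
    then show ?thesis
      using *[OF T(3,4,1,2) w(2,1) _ _ c] w(3,4) h by (simp add: abs_minus_commute)
  qed
qed

text \<open>
  The sum runs over the weighted 4-cycles \<open>x1 - y - x2 - y' - x1\<close> of the incidence graph, where \<open>u1\<close>, \<open>u2\<close>
  label the edges of \<open>x1\<close>, \<open>x2\<close> to \<open>y\<close>, and \<open>v1\<close>, \<open>v2\<close> those to \<open>y'\<close>.
\<close>

definition cycle_sum :: "'i set \<Rightarrow> 'j set \<Rightarrow> real set \<Rightarrow> ('i \<Rightarrow> real) \<Rightarrow> ('j \<Rightarrow> real) \<Rightarrow>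
    ('i \<Rightarrow> 'j \<Rightarrow> real \<Rightarrow> real) \<Rightarrow> (real \<Rightarrow> real \<Rightarrow> real \<Rightarrow> real \<Rightarrow> bool) \<Rightarrow> real" where
  "cycle_sum X Y U p q g P =
    (\<Sum>(x1, x2, y, y', u1, u2, v1, v2) \<in> X \<times> X \<times> Y \<times> Y \<times> U \<times> U \<times> U \<times> U.
      if P u1 u2 v1 v2
      then p x1 * p x2 * q y * q y' * (g x1 y u1 * g x2 y u2 * g x1 y' v1 * g x2 y' v2) else 0)"

text \<open>Reading a cycle from the other side of the graph exchanges the labels \<open>u2\<close>
  and \<open>v1\<close>.\<close>

lemma cycle_sum_dual:
  "cycle_sum X Y U p q g (\<lambda>u1 u2 v1 v2. P u1 v1 u2 v2) = cycle_sum Y X U q p (\<lambda>y x. g x y) P"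
  unfolding cycle_sum_def
  by (rule sum.reindex_bij_witness[where
        i = "\<lambda>(y, y', x1, x2, u1, v1, u2, v2). (x1, x2, y, y', u1, u2, v1, v2)" and
        j = "\<lambda>(x1, x2, y, y', u1, u2, v1, v2). (y, y', x1, x2, u1, v1, u2, v2)"]) auto

lemma cycle_sum_swap:
  "cycle_sum X Y U p q g (\<lambda>u1 u2 v1 v2. P u2 u1 v2 v1) = cycle_sum X Y U p q g P"
  unfolding cycle_sum_def
  by (rule sum.reindex_bij_witness[where
        i = "\<lambda>(x1, x2, y, y', u1, u2, v1, v2). (x2, x1, y, y', u2, u1, v2, v1)" and
        j = "\<lambda>(x1, x2, y, y', u1, u2, v1, v2). (x2, x1, y, y', u2, u1, v2, v1)"]) auto

section \<open>Counting edges by 4-cycles in weighted bipartite graphs\<close>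

lemma weighted_Cauchy_Schwarz:
  fixes f w :: "'a \<Rightarrow> real"
  assumes "\<And>i. i \<in> A \<Longrightarrow> 0 \<le> w i"
  shows "(\<Sum>i\<in>A. w i * f i)\<^sup>2 \<le> (\<Sum>i\<in>A. w i) * (\<Sum>i\<in>A. w i * (f i)\<^sup>2)"
proof -
  have "(\<Sum>i\<in>A. sqrt (w i) * (sqrt (w i) * f i))\<^sup>2
      \<le> (\<Sum>i\<in>A. (sqrt (w i))\<^sup>2) * (\<Sum>i\<in>A. (sqrt (w i) * f i)\<^sup>2)"
    by (rule Cauchy_Schwarz_ineq_sum)
  moreover have "(\<Sum>i\<in>A. sqrt (w i) * (sqrt (w i) * f i)) = (\<Sum>i\<in>A. w i * f i)"
    using assms by (intro sum.cong) (auto simp flip: mult.assoc)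
  moreover have "(\<Sum>i\<in>A. (sqrt (w i))\<^sup>2) = (\<Sum>i\<in>A. w i)"
    using assms by (intro sum.cong) auto
  moreover have "(\<Sum>i\<in>A. (sqrt (w i) * f i)\<^sup>2) = (\<Sum>i\<in>A. w i * (f i)\<^sup>2)"
    using assms by (intro sum.cong) (auto simp: power_mult_distrib)
  ultimately show ?thesis by simp
qed

text \<open>The third argument of \<open>g\<close> labels parallel edges: a pair of vertices may be
  joined once for each parameter in \<open>U\<close>.\<close>

locale weighted_graph =
  fixes X :: "'i set" and Y :: "'j set" and U :: "real set"
    and p :: "'i \<Rightarrow> real" and q :: "'j \<Rightarrow> real" and g :: "'i \<Rightarrow> 'j \<Rightarrow> real \<Rightarrow> real"
  assumes fin: "finite X" "finite Y" "finite U"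
    and p_nonneg: "\<And>x. x \<in> X \<Longrightarrow> 0 \<le> p x" and q_nonneg: "\<And>y. y \<in> Y \<Longrightarrow> 0 \<le> q y"
    and g_nonneg: "\<And>x y u. x \<in> X \<Longrightarrow> y \<in> Y \<Longrightarrow> u \<in> U \<Longrightarrow> 0 \<le> g x y u"
begin

lemma dual: "weighted_graph Y X U q p (\<lambda>y x. g x y)"
  by unfold_locales (use fin p_nonneg q_nonneg g_nonneg in auto)

abbreviation "cyc \<equiv> cycle_sum X Y U p q g"

definition edge_sum :: real where
  "edge_sum = (\<Sum>x\<in>X. \<Sum>y\<in>Y. \<Sum>u\<in>U. p x * q y * g x y u)"

lemma edge_sum_dual: "edge_sum = weighted_graph.edge_sum Y X U q p (\<lambda>y x. g x y)"
  unfolding edge_sum_def weighted_graph.edge_sum_def[OF dual]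
  by (subst sum.swap) (simp add: mult_ac)

lemma edge_sum_nonneg: "0 \<le> edge_sum"
  unfolding edge_sum_def by (intro sum_nonneg mult_nonneg_nonneg p_nonneg q_nonneg g_nonneg)

lemma cycle_weight_nonneg:
  assumes "x1 \<in> X" "x2 \<in> X" "y \<in> Y" "y' \<in> Y" "u1 \<in> U" "u2 \<in> U" "v1 \<in> U" "v2 \<in> U"
  shows "0 \<le> p x1 * p x2 * q y * q y' * (g x1 y u1 * g x2 y u2 * g x1 y' v1 * g x2 y' v2)"
  using assms by (simp add: p_nonneg q_nonneg g_nonneg)

lemma cycle_sum_le_add:
  assumes "\<And>x1 x2 y y' u1 u2 v1 v2. \<lbrakk>P u1 u2 v1 v2; x1 \<in> X; x2 \<in> X; y \<in> Y; y' \<in> Y;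
      u1 \<in> U; u2 \<in> U; v1 \<in> U; v2 \<in> U;
      g x1 y u1 \<noteq> 0; g x2 y u2 \<noteq> 0; g x1 y' v1 \<noteq> 0; g x2 y' v2 \<noteq> 0\<rbrakk>
      \<Longrightarrow> Q u1 u2 v1 v2 \<or> R u1 u2 v1 v2"
  shows "cyc P \<le> cyc Q + cyc R"
proof -
  have "cyc P \<le> (\<Sum>(x1, x2, y, y', u1, u2, v1, v2) \<in> X \<times> X \<times> Y \<times> Y \<times> U \<times> U \<times> U \<times> U.
      (if Q u1 u2 v1 v2
      then p x1 * p x2 * q y * q y' * (g x1 y u1 * g x2 y u2 * g x1 y' v1 * g x2 y' v2) else 0) +
      (if R u1 u2 v1 v2
      then p x1 * p x2 * q y * q y' * (g x1 y u1 * g x2 y u2 * g x1 y' v1 * g x2 y' v2) else 0))"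
    unfolding cycle_sum_def
  proof (intro sum_mono, clarify, goal_cases)
    case (1 x1 x2 y y' u1 u2 v1 v2)
    have nn: "0 \<le> p x1 * p x2 * q y * q y' * (g x1 y u1 * g x2 y u2 * g x1 y' v1 * g x2 y' v2)"
      by (rule cycle_weight_nonneg) (use 1 in auto)
    have "\<lbrakk>P u1 u2 v1 v2; g x1 y u1 \<noteq> 0; g x2 y u2 \<noteq> 0; g x1 y' v1 \<noteq> 0; g x2 y' v2 \<noteq> 0\<rbrakk>
      \<Longrightarrow> Q u1 u2 v1 v2 \<or> R u1 u2 v1 v2"
      using assms 1 by blast
    then show ?case using nn by auto
  qed
  also have "\<dots> = cyc Q + cyc R"
    unfolding cycle_sum_def by (simp add: sum.distrib case_prod_unfold)
  finally show ?thesis .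
qed

lemma cycle_sum_mono:
  assumes "\<And>u1 u2 v1 v2. \<lbrakk>P u1 u2 v1 v2; u1 \<in> U; u2 \<in> U; v1 \<in> U; v2 \<in> U\<rbrakk> \<Longrightarrow> Q u1 u2 v1 v2"
  shows "cyc P \<le> cyc Q"
  using cycle_sum_le_add[of P Q "\<lambda>_ _ _ _. False"] assms by (simp add: cycle_sum_def case_prod_unfold)

definition codeg :: "(real \<Rightarrow> real \<Rightarrow> bool) \<Rightarrow> 'j \<Rightarrow> 'j \<Rightarrow> real" where
  "codeg T y y' = (\<Sum>(x, u, v) \<in> X \<times> U \<times> U. if T u v then p x * (g x y u * g x y' v) else 0)"

text \<open>For fixed \<open>y\<close>, \<open>y'\<close> a condition that treats the labels at
  \<open>x1\<close> and at \<open>x2\<close> separately factorises, so the cycle sum is a sum of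
  squares.\<close>

lemma cycle_sum_codeg:
  "cyc (\<lambda>u1 u2 v1 v2. T u1 v1 \<and> T u2 v2) = (\<Sum>(y, y')\<in>Y \<times> Y. q y * q y' * (codeg T y y')\<^sup>2)"
proof -
  have "(\<Sum>(y, y')\<in>Y \<times> Y. q y * q y' * (codeg T y y')\<^sup>2) =
     (\<Sum>r\<in>Y \<times> Y. \<Sum>s\<in>X \<times> U \<times> U. \<Sum>s'\<in>X \<times> U \<times> U. case r of (y, y') \<Rightarrow> case s of (x1, u1, v1) \<Rightarrow>
        case s' of (x2, u2, v2) \<Rightarrow> q y * q y' * ((if T u1 v1 then p x1 * (g x1 y u1 * g x1 y' v1) else 0) *
          (if T u2 v2 then p x2 * (g x2 y u2 * g x2 y' v2) else 0)))"
    unfolding codeg_def power2_eq_square sum_product case_prod_unfold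
    by (simp only: sum_distrib_left)
  also have "\<dots> = (\<Sum>(r, s, s')\<in>(Y \<times> Y) \<times> (X \<times> U \<times> U) \<times> (X \<times> U \<times> U). case r of (y, y') \<Rightarrow> case s of (x1, u1, v1) \<Rightarrow>
        case s' of (x2, u2, v2) \<Rightarrow> q y * q y' * ((if T u1 v1 then p x1 * (g x1 y u1 * g x1 y' v1) else 0) *
          (if T u2 v2 then p x2 * (g x2 y u2 * g x2 y' v2) else 0)))"
    by (simp add: sum.cartesian_product)
  also have "\<dots> = cyc (\<lambda>u1 u2 v1 v2. T u1 v1 \<and> T u2 v2)"
    unfolding cycle_sum_def
    by (rule sum.reindex_bij_witness[where
        i = "\<lambda>(x1, x2, y, y', u1, u2, v1, v2). ((y, y'), (x1, u1, v1), (x2, u2, v2))" and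
        j = "\<lambda>((y, y'), (x1, u1, v1), (x2, u2, v2)). (x1, x2, y, y', u1, u2, v1, v2)"]) auto
  finally show ?thesis by simp
qed

text \<open>Codegrees add over disjoint alternatives, and
  \<open>(r + s)\<^sup>2 \<le> 2 * r\<^sup>2 + 2 * s\<^sup>2\<close> removes the mixed terms.
  Applied to the two orders of a pair of labels, this disposes of the cycles whose orders disagree
  at the cost of a factor 2.\<close>

lemma cycle_sum_split:
  assumes T: "\<And>u v. T u v \<longleftrightarrow> T1 u v \<or> T2 u v"
    and disj: "\<And>u v. T1 u v \<Longrightarrow> \<not> T2 u v"
  shows "cyc (\<lambda>u1 u2 v1 v2. T u1 v1 \<and> T u2 v2)
    \<le> 2 * cyc (\<lambda>u1 u2 v1 v2. T1 u1 v1 \<and> T1 u2 v2) + 2 * cyc (\<lambda>u1 u2 v1 v2. T2 u1 v1 \<and> T2 u2 v2)"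
proof -
  have codeg: "codeg T y y' = codeg T1 y y' + codeg T2 y y'" for y y'
    unfolding codeg_def sum.distrib[symmetric]
    by (intro sum.cong) (use disj in \<open>auto simp: T\<close>)
  have "(codeg T y y')\<^sup>2 \<le> 2 * (codeg T1 y y')\<^sup>2 + 2 * (codeg T2 y y')\<^sup>2" for y y'
  proof -
    have "0 \<le> (codeg T1 y y' - codeg T2 y y')\<^sup>2" by simp
    then show ?thesis by (simp add: codeg power2_eq_square algebra_simps)
  qed
  then have "(\<Sum>(y, y')\<in>Y \<times> Y. q y * q y' * (codeg T y y')\<^sup>2) \<le>
    (\<Sum>(y, y')\<in>Y \<times> Y. q y * q y' * (2 * (codeg T1 y y')\<^sup>2 + 2 * (codeg T2 y y')\<^sup>2))"
    by (intro sum_mono) (auto intro!: mult_left_mono simp: q_nonneg)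
  also have "\<dots> = 2 * (\<Sum>(y, y')\<in>Y \<times> Y. q y * q y' * (codeg T1 y y')\<^sup>2) +
      2 * (\<Sum>(y, y')\<in>Y \<times> Y. q y * q y' * (codeg T2 y y')\<^sup>2)"
    by (simp add: sum_distrib_left case_prod_unfold algebra_simps sum.distrib)
  finally show ?thesis by (simp add: cycle_sum_codeg)
qed

text \<open>Cauchy-Schwarz over \<open>x\<close> turns edges into paths of length two with middle
  vertex \<open>x\<close>; a second application over the pairs of end points \<open>y\<close>,
  \<open>y'\<close> closes two such paths to a 4-cycle.\<close>

lemma edge_sum_power4_le:
  "edge_sum ^ 4 \<le> (\<Sum>x\<in>X. p x)\<^sup>2 * (\<Sum>y\<in>Y. q y)\<^sup>2 * cyc (\<lambda>_ _ _ _. True)"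
proof -
  define d where "d x = (\<Sum>(y, u)\<in>Y \<times> U. q y * g x y u)" for x
  define B where "B = (\<Sum>(y, y')\<in>Y \<times> Y. q y * q y' * codeg (\<lambda>_ _. True) y y')"
  have e: "edge_sum = (\<Sum>x\<in>X. p x * d x)"
    unfolding edge_sum_def d_def by (simp add: sum_distrib_left sum.cartesian_product mult.assoc case_prod_unfold)
  have "edge_sum\<^sup>2 \<le> (\<Sum>x\<in>X. p x) * (\<Sum>x\<in>X. p x * (d x)\<^sup>2)"
    unfolding e by (rule weighted_Cauchy_Schwarz) (rule p_nonneg)
  also have "(\<Sum>x\<in>X. p x * (d x)\<^sup>2) = B"
  proof -
    have "(\<Sum>x\<in>X. p x * (d x)\<^sup>2) = (\<Sum>(x, s, s')\<in>X \<times> (Y \<times> U) \<times> (Y \<times> U).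
        p x * ((case s of (y, u) \<Rightarrow> q y * g x y u) * (case s' of (y', u') \<Rightarrow> q y' * g x y' u')))"
      unfolding d_def power2_eq_square sum_product
      by (simp only: sum_distrib_left sum.cartesian_product) (auto intro!: sum.cong)
    also have "\<dots> = (\<Sum>(r, s)\<in>(Y \<times> Y) \<times> (X \<times> U \<times> U). case r of (y, y') \<Rightarrow> case s of (x, u, v) \<Rightarrow>
       q y * q y' * (p x * (g x y u * g x y' v)))"
      by (rule sum.reindex_bij_witness[where
        i = "\<lambda>((y, y'), (x, u, v)). (x, (y, u), (y', v))" and
        j = "\<lambda>(x, (y, u), (y', v)). ((y, y'), (x, u, v))"]) auto
    also have "\<dots> = B"
      unfolding B_def codeg_def
      by (simp add: sum_distrib_left case_prod_unfold sum.cartesian_product)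
    finally show ?thesis .
  qed
  finally have 1: "edge_sum\<^sup>2 \<le> (\<Sum>x\<in>X. p x) * B" .
  have "B\<^sup>2 \<le> (\<Sum>(y, y')\<in>Y \<times> Y. q y * q y') * (\<Sum>(y, y')\<in>Y \<times> Y. q y * q y' * (codeg (\<lambda>_ _. True) y y')\<^sup>2)"
    unfolding B_def case_prod_unfold
    by (rule weighted_Cauchy_Schwarz) (auto simp: q_nonneg)
  also have "(\<Sum>(y, y')\<in>Y \<times> Y. q y * q y') = (\<Sum>y\<in>Y. q y)\<^sup>2"
    by (simp add: power2_eq_square sum_product sum.cartesian_product)
  also have "(\<Sum>(y, y')\<in>Y \<times> Y. q y * q y' * (codeg (\<lambda>_ _. True) y y')\<^sup>2) = cyc (\<lambda>_ _ _ _. True)"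
    using cycle_sum_codeg[of "\<lambda>_ _. True"] by simp
  finally have 2: "B\<^sup>2 \<le> (\<Sum>y\<in>Y. q y)\<^sup>2 * cyc (\<lambda>_ _ _ _. True)" .
  have "edge_sum ^ 4 = (edge_sum\<^sup>2)\<^sup>2" by simp
  also have "\<dots> \<le> ((\<Sum>x\<in>X. p x) * B)\<^sup>2" using 1 by (intro power_mono) auto
  also have "\<dots> = (\<Sum>x\<in>X. p x)\<^sup>2 * B\<^sup>2" by (simp add: power_mult_distrib)
  also have "\<dots> \<le> (\<Sum>x\<in>X. p x)\<^sup>2 * ((\<Sum>y\<in>Y. q y)\<^sup>2 * cyc (\<lambda>_ _ _ _. True))"
    using 2 by (intro mult_left_mono) auto
  finally show ?thesis by (simp add: mult.assoc)
qed

text \<open>The edge from \<open>x1\<close> to \<open>y\<close> with label \<open>u1\<close> is free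
  and contributes \<open>edge_sum\<close>. The other choices are bounded one after another:
  \<open>v1\<close> near \<open>u1\<close> by \<open>n\<close>, \<open>y'\<close> by
  \<open>m1\<close>, \<open>u2\<close> by \<open>card U\<close>, \<open>x2\<close> by
  \<open>m2\<close>, and \<open>v2\<close> by \<open>n\<close>.\<close>

lemma cycle_sum_degenerate:
  assumes row: "\<And>x u. x \<in> X \<Longrightarrow> u \<in> U \<Longrightarrow> (\<Sum>y\<in>Y. q y * g x y u) \<le> m1"
    and col: "\<And>y u. y \<in> Y \<Longrightarrow> u \<in> U \<Longrightarrow> (\<Sum>x\<in>X. p x * g x y u) \<le> m2"
    and mult: "\<And>x y. x \<in> X \<Longrightarrow> y \<in> Y \<Longrightarrow> (\<Sum>u\<in>U. g x y u) \<le> n"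
    and near: "\<And>u. u \<in> U \<Longrightarrow> real (card {v \<in> U. \<bar>u - v\<bar> < w}) \<le> n"
    and nn: "0 \<le> m1" "0 \<le> m2" "0 \<le> n"
  shows "cyc (\<lambda>u1 u2 v1 v2. \<bar>u1 - v1\<bar> < w) \<le> edge_sum * (n\<^sup>2 * real (card U) * m1 * m2)"
proof -
  have "cyc (\<lambda>u1 u2 v1 v2. \<bar>u1 - v1\<bar> < w) =
    (\<Sum>(x1, y, u1, v1, y', u2, x2, v2)\<in>X \<times> Y \<times> U \<times> U \<times> Y \<times> U \<times> X \<times> U.
      p x1 * q y * g x1 y u1 * (of_bool (\<bar>u1 - v1\<bar> < w) *
        (q y' * g x1 y' v1 * (p x2 * g x2 y u2 * g x2 y' v2))))"
    unfolding cycle_sum_def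
    by (rule sum.reindex_bij_witness[where
        j = "\<lambda>(x1, x2, y, y', u1, u2, v1, v2). (x1, y, u1, v1, y', u2, x2, v2)" and
        i = "\<lambda>(x1, y, u1, v1, y', u2, x2, v2). (x1, x2, y, y', u1, u2, v1, v2)"]) auto
  also have "\<dots> = (\<Sum>x1\<in>X. \<Sum>y\<in>Y. \<Sum>u1\<in>U. p x1 * q y * g x1 y u1 * (\<Sum>v1\<in>U. of_bool (\<bar>u1 - v1\<bar> < w) *
      (\<Sum>y'\<in>Y. q y' * g x1 y' v1 * (\<Sum>u2\<in>U. \<Sum>x2\<in>X. p x2 * g x2 y u2 * (\<Sum>v2\<in>U. g x2 y' v2)))))"
    by (simp only: sum_distrib_left sum.cartesian_product) (auto intro!: sum.cong)
  also have "\<dots> \<le> (\<Sum>x1\<in>X. \<Sum>y\<in>Y. \<Sum>u1\<in>U. p x1 * q y * g x1 y u1 * (n\<^sup>2 * real (card U) * m1 * m2))"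
  proof (intro sum_mono mult_left_mono)
    fix x1 y u1 assume x: "x1 \<in> X" "y \<in> Y" "u1 \<in> U"
    have in1: "(\<Sum>u2\<in>U. \<Sum>x2\<in>X. p x2 * g x2 y u2 * (\<Sum>v2\<in>U. g x2 y' v2)) \<le> real (card U) * (m2 * n)"
      if "y' \<in> Y" for y'
    proof -
      have "(\<Sum>x2\<in>X. p x2 * g x2 y u2 * (\<Sum>v2\<in>U. g x2 y' v2)) \<le> m2 * n" if u2: "u2 \<in> U" for u2
      proof -
        have "(\<Sum>x2\<in>X. p x2 * g x2 y u2 * (\<Sum>v2\<in>U. g x2 y' v2)) \<le> (\<Sum>x2\<in>X. p x2 * g x2 y u2 * n)"
          using x u2 \<open>y' \<in> Y\<close> by (intro sum_mono mult_left_mono mult) (auto simp: p_nonneg g_nonneg)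
        also have "\<dots> = (\<Sum>x2\<in>X. p x2 * g x2 y u2) * n" by (simp add: sum_distrib_right)
        also have "\<dots> \<le> m2 * n" using x u2 nn by (intro mult_right_mono col) auto
        finally show ?thesis .
      qed
      then show ?thesis by (intro sum_bounded_above)
    qed
    have in2: "(\<Sum>y'\<in>Y. q y' * g x1 y' v1 * (\<Sum>u2\<in>U. \<Sum>x2\<in>X. p x2 * g x2 y u2 * (\<Sum>v2\<in>U. g x2 y' v2)))
        \<le> m1 * (real (card U) * (m2 * n))" if v1: "v1 \<in> U" for v1
    proof -
      have "(\<Sum>y'\<in>Y. q y' * g x1 y' v1 * (\<Sum>u2\<in>U. \<Sum>x2\<in>X. p x2 * g x2 y u2 * (\<Sum>v2\<in>U. g x2 y' v2)))
        \<le> (\<Sum>y'\<in>Y. q y' * g x1 y' v1 * (real (card U) * (m2 * n)))"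
        using x v1 by (intro sum_mono mult_left_mono in1) (auto simp: q_nonneg g_nonneg)
      also have "\<dots> = (\<Sum>y'\<in>Y. q y' * g x1 y' v1) * (real (card U) * (m2 * n))" by (simp add: sum_distrib_right)
      also have "\<dots> \<le> m1 * (real (card U) * (m2 * n))" using x v1 nn by (intro mult_right_mono row) auto
      finally show ?thesis .
    qed
    have "(\<Sum>v1\<in>U. of_bool (\<bar>u1 - v1\<bar> < w) *
      (\<Sum>y'\<in>Y. q y' * g x1 y' v1 * (\<Sum>u2\<in>U. \<Sum>x2\<in>X. p x2 * g x2 y u2 * (\<Sum>v2\<in>U. g x2 y' v2))))
      \<le> (\<Sum>v1\<in>U. of_bool (\<bar>u1 - v1\<bar> < w) * (m1 * (real (card U) * (m2 * n))))"
      using in2 by (intro sum_mono mult_left_mono) auto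
    also have "\<dots> = real (card {v \<in> U. \<bar>u1 - v\<bar> < w}) * (m1 * (real (card U) * (m2 * n)))"
      using fin by (simp add: sum_distrib_right[symmetric] of_bool_def sum.If_cases Int_def)
    also have "\<dots> \<le> n * (m1 * (real (card U) * (m2 * n)))"
      using nn x by (intro mult_right_mono near) auto
    finally show "(\<Sum>v1\<in>U. of_bool (\<bar>u1 - v1\<bar> < w) *
      (\<Sum>y'\<in>Y. q y' * g x1 y' v1 * (\<Sum>u2\<in>U. \<Sum>x2\<in>X. p x2 * g x2 y u2 * (\<Sum>v2\<in>U. g x2 y' v2))))
      \<le> n\<^sup>2 * real (card U) * m1 * m2" by (simp add: power2_eq_square mult_ac)
    show "0 \<le> p x1 * q y * g x1 y u1" using x by (simp add: p_nonneg q_nonneg g_nonneg)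
  qed
  also have "\<dots> = edge_sum * (n\<^sup>2 * real (card U) * m1 * m2)"
    unfolding edge_sum_def by (simp add: sum_distrib_right)
  finally show ?thesis .
qed

end

section \<open>Graphs of tangencies between two clusters of parabolas\<close>

lemma quad_uminus: "quad (\<lambda>i. - a i) (\<lambda>i. - b i) (\<lambda>i. - c i) x = (\<lambda>u. - quad a b c x u)"
  by (auto simp: quad_def)

locale touch_graph = weighted_graph X Y U p q g
  for X :: "'i set" and Y :: "'j set" and U :: "real set"
    and p :: "'i \<Rightarrow> real" and q :: "'j \<Rightarrow> real" and g :: "'i \<Rightarrow> 'j \<Rightarrow> real \<Rightarrow> real" +
  fixes a b c :: "'i \<Rightarrow> real" and a' b' c' :: "'j \<Rightarrow> real" and \<rho> t w k n m1 m2 :: real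
  assumes touch: "\<And>x y u. \<lbrakk>x \<in> X; y \<in> Y; u \<in> U; g x y u \<noteq> 0\<rbrakk> \<Longrightarrow>
      touch \<rho> t w (quad a b c x) (quad a' b' c' y) u"
    and g_le_1: "\<And>x y u. \<lbrakk>x \<in> X; y \<in> Y; u \<in> U\<rbrakk> \<Longrightarrow> g x y u \<le> 1"
    and cX: "\<And>x1 x2. \<lbrakk>x1 \<in> X; x2 \<in> X\<rbrakk> \<Longrightarrow> \<bar>c x1 - c x2\<bar> \<le> k"
    and cY: "\<And>y1 y2. \<lbrakk>y1 \<in> Y; y2 \<in> Y\<rbrakk> \<Longrightarrow> \<bar>c' y1 - c' y2\<bar> \<le> k"
    and pos: "0 < t" "0 < w" "4 * \<rho> \<le> t * w\<^sup>2"
    and row: "\<And>x u. x \<in> X \<Longrightarrow> u \<in> U \<Longrightarrow> (\<Sum>y\<in>Y. q y * g x y u) \<le> m1"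
    and col: "\<And>y u. y \<in> Y \<Longrightarrow> u \<in> U \<Longrightarrow> (\<Sum>x\<in>X. p x * g x y u) \<le> m2"
    and near: "\<And>u. u \<in> U \<Longrightarrow> real (card {v \<in> U. \<bar>u - v\<bar> < w}) \<le> n"
    and nn: "0 \<le> m1" "0 \<le> m2" "0 \<le> n"
begin

text \<open>Negating all parabolas turns touching from below into touching from above. Exchanging
  the sides at the same time gives an instance of the same locale, so each estimate is available for
  both sides.\<close>

lemma dual_touch: "touch_graph Y X U q p (\<lambda>y x. g x y)
    (\<lambda>y. - a' y) (\<lambda>y. - b' y) (\<lambda>y. - c' y) (\<lambda>x. - a x) (\<lambda>x. - b x) (\<lambda>x. - c x) \<rho> t w k n m2 m1"
proof (rule touch_graph.intro[OF dual], unfold_locales, goal_cases)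
  case (1 y x u)
  then show ?case using touch[of x y u] by (simp add: quad_uminus touch_uminus)
next
  case (3 y1 y2)
  then show ?case using cY[of y2 y1] by simp
next
  case (4 x1 x2)
  then show ?case using cX[of x2 x1] by simp
qed (use g_le_1 pos row col near nn in auto)

definition "deg_bound = edge_sum * (n\<^sup>2 * real (card U) * m1 * m2)"

lemma deg_bound_dual: "deg_bound = touch_graph.deg_bound Y X U q p (\<lambda>y x. g x y) n m2 m1"
  unfolding deg_bound_def touch_graph.deg_bound_def[OF dual_touch]
  by (simp add: edge_sum_dual)

lemma deg_bound_nonneg: "0 \<le> deg_bound"
  unfolding deg_bound_def using nn edge_sum_nonneg by simp

text \<open>At a second label at distance at least \<open>w\<close> the gap would be at most \<rho>
  and at least \<open>t / 2 * w\<^sup>2\<close>, contrary to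
  \<open>4 * \<rho> \<le> t * w\<^sup>2\<close>. Hence all labels of a pair lie in one
  window.\<close>

lemma multiplicity:
  assumes xy: "x \<in> X" "y \<in> Y"
  shows "(\<Sum>u\<in>U. g x y u) \<le> n"
proof (cases "\<exists>u\<in>U. g x y u \<noteq> 0")
  case False
  then show ?thesis using nn by simp
next
  case True
  then obtain u where u: "u \<in> U" "g x y u \<noteq> 0" by blast
  have "\<bar>u - v\<bar> < w" if v: "v \<in> U" "g x y v \<noteq> 0" for v
  proof (rule ccontr)
    assume "\<not> \<bar>u - v\<bar> < w"
    then have w: "w \<le> \<bar>v - u\<bar>" by (simp add: abs_minus_commute)
    then have "t / 2 * (v - u)\<^sup>2 \<le> quad a' b' c' y v - quad a b c x v"
      using touch[OF xy u] by (simp add: touch_def)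
    also have "\<dots> \<le> \<rho>" using touch[OF xy v] by (simp add: touch_def abs_le_iff)
    finally have "t * (v - u)\<^sup>2 \<le> 2 * \<rho>" by simp
    moreover have "w\<^sup>2 \<le> (v - u)\<^sup>2" using w pos by (metis abs_le_square_iff abs_of_pos)
    then have "t * w\<^sup>2 \<le> t * (v - u)\<^sup>2" using pos by simp
    moreover have "0 < t * w\<^sup>2" using pos by simp
    ultimately show False using pos(3) by linarith
  qed
  then have "(\<Sum>v\<in>U. g x y v) \<le> (\<Sum>v\<in>U. of_bool (\<bar>u - v\<bar> < w))"
    using xy by (intro sum_mono) (use g_le_1 in \<open>force simp: of_bool_def\<close>)
  also have "\<dots> = real (card {v \<in> U. \<bar>u - v\<bar> < w})"
    using fin by (simp add: of_bool_def sum.If_cases Int_def)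
  also have "\<dots> \<le> n" using u by (intro near)
  finally show ?thesis .
qed

lemma degenerate: "cyc (\<lambda>u1 u2 v1 v2. \<bar>u1 - v1\<bar> < w) \<le> deg_bound"
  unfolding deg_bound_def by (rule cycle_sum_degenerate[OF row col multiplicity near nn])

lemma degenerate': "cyc (\<lambda>u1 u2 v1 v2. \<bar>u2 - v2\<bar> < w) \<le> deg_bound"
  using degenerate cycle_sum_swap[of X Y U p q g "\<lambda>u1 u2 v1 v2. \<bar>u1 - v1\<bar> < w"] by simp

text \<open>Both \<open>u1\<close>, \<open>v1\<close> belong to edges at \<open>x1\<close>, and both
  \<open>u2\<close>, \<open>v2\<close> to edges at \<open>x2\<close>: closeness is measured along
  the vertices in \<open>X\<close>, and in the dual graph along those in \<open>Y\<close>.\<close>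

definition "narrow h = cyc (\<lambda>u1 u2 v1 v2. \<bar>u1 - v1\<bar> \<le> h \<and> \<bar>u2 - v2\<bar> \<le> h)"

lemma dual_narrow:
  "touch_graph.narrow Y X U q p (\<lambda>y x. g x y) h = cyc (\<lambda>u1 u2 v1 v2. \<bar>u1 - u2\<bar> \<le> h \<and> \<bar>v1 - v2\<bar> \<le> h)"
  unfolding touch_graph.narrow_def[OF dual_touch]
  using cycle_sum_dual[of X Y U p q g "\<lambda>u1 u2 v1 v2. \<bar>u1 - v1\<bar> \<le> h \<and> \<bar>u2 - v2\<bar> \<le> h"] by simp

text \<open>After the split by order, \<open>cycle_spacing\<close> moves closeness from
  \<open>X\<close> to \<open>Y\<close>, unless two labels at a common vertex are closer than
  \<open>w\<close>. A cycle has four vertices, each exception costs \<open>deg_bound\<close>, and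
  the split doubles everything: hence 8.\<close>

lemma narrow_step:
  "narrow h \<le> 2 * touch_graph.narrow Y X U q p (\<lambda>y x. g x y) (4 * k / t * h) + 8 * deg_bound"
proof -
  interpret D: touch_graph Y X U q p "\<lambda>y x. g x y" "\<lambda>y. - a' y" "\<lambda>y. - b' y" "\<lambda>y. - c' y"
    "\<lambda>x. - a x" "\<lambda>x. - b x" "\<lambda>x. - c x" \<rho> t w k n m2 m1
    by (rule dual_touch)
  define B where "B T = cyc (\<lambda>u1 u2 v1 v2. (T u1 v1 \<and> \<bar>u1 - v1\<bar> \<le> h) \<and> (T u2 v2 \<and> \<bar>u2 - v2\<bar> \<le> h))" for T
  define S where "S = cyc (\<lambda>u1 u2 v1 v2. (u1 < v1 \<and> u2 < v2 \<or> v1 \<le> u1 \<and> v2 \<le> u2) \<and> \<bar>u1 - v1\<bar> \<le> h \<and> \<bar>u2 - v2\<bar> \<le> h)"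
  have "narrow h \<le> 2 * B (<) + 2 * B (\<lambda>u v. v \<le> u)"
    unfolding narrow_def B_def by (rule cycle_sum_split) auto
  also have "B (<) + B (\<lambda>u v. v \<le> u) = S"
    unfolding B_def S_def cycle_sum_def sum.distrib[symmetric]
    by (intro sum.cong refl) auto
  then have "2 * B (<) + 2 * B (\<lambda>u v. v \<le> u) = 2 * S" by linarith
  finally have 1: "narrow h \<le> 2 * S" .
  define R1 where "R1 = (\<lambda>(u1 :: real) (u2 :: real) (v1 :: real) (v2 :: real). \<bar>u1 - v1\<bar> < w)"
  define R2 where "R2 = (\<lambda>(u1 :: real) (u2 :: real) (v1 :: real) (v2 :: real). \<bar>u2 - v2\<bar> < w)"
  define R3 where "R3 = (\<lambda>(u1 :: real) (u2 :: real) (v1 :: real) (v2 :: real). \<bar>u1 - u2\<bar> < w)"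
  define R4 where "R4 = (\<lambda>(u1 :: real) (u2 :: real) (v1 :: real) (v2 :: real). \<bar>v1 - v2\<bar> < w)"
  define N where "N = (\<lambda>(u1 :: real) (u2 :: real) (v1 :: real) (v2 :: real). \<bar>u1 - u2\<bar> \<le> 4 * k / t * h \<and> \<bar>v1 - v2\<bar> \<le> 4 * k / t * h)"
  have "S \<le> cyc N + cyc (\<lambda>u1 u2 v1 v2. R1 u1 u2 v1 v2 \<or> R2 u1 u2 v1 v2 \<or> R3 u1 u2 v1 v2 \<or> R4 u1 u2 v1 v2)"
    unfolding S_def
  proof (rule cycle_sum_le_add, goal_cases)
    case (1 x1 x2 y y' u1 u2 v1 v2)
    show ?case
    proof (cases "R1 u1 u2 v1 v2 \<or> R2 u1 u2 v1 v2 \<or> R3 u1 u2 v1 v2 \<or> R4 u1 u2 v1 v2")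
      case False
      then have "w \<le> \<bar>u1 - u2\<bar>" "w \<le> \<bar>v1 - v2\<bar>" "w \<le> \<bar>u1 - v1\<bar>" "w \<le> \<bar>u2 - v2\<bar>"
        by (auto simp: R1_def R2_def R3_def R4_def)
      then have "N u1 u2 v1 v2"
        unfolding N_def using 1
        by (intro cycle_spacing[OF touch touch touch touch _ _ _ _ pos cX, of x1 y u1 x2 u2 y' v1 v2]) auto
      then show ?thesis by blast
    qed simp
  qed
  also have "cyc N = D.narrow (4 * k / t * h)"
    unfolding N_def by (simp add: dual_narrow)
  also have "cyc (\<lambda>u1 u2 v1 v2. R1 u1 u2 v1 v2 \<or> R2 u1 u2 v1 v2 \<or> R3 u1 u2 v1 v2 \<or> R4 u1 u2 v1 v2)
      \<le> cyc R1 + cyc (\<lambda>u1 u2 v1 v2. R2 u1 u2 v1 v2 \<or> R3 u1 u2 v1 v2 \<or> R4 u1 u2 v1 v2)"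
    by (rule cycle_sum_le_add) blast
  also have "cyc (\<lambda>u1 u2 v1 v2. R2 u1 u2 v1 v2 \<or> R3 u1 u2 v1 v2 \<or> R4 u1 u2 v1 v2)
      \<le> cyc R2 + cyc (\<lambda>u1 u2 v1 v2. R3 u1 u2 v1 v2 \<or> R4 u1 u2 v1 v2)"
    by (rule cycle_sum_le_add) blast
  also have "cyc (\<lambda>u1 u2 v1 v2. R3 u1 u2 v1 v2 \<or> R4 u1 u2 v1 v2) \<le> cyc R3 + cyc R4"
    by (rule cycle_sum_le_add) blast
  also have "cyc R1 \<le> deg_bound" unfolding R1_def by (rule degenerate)
  also have "cyc R2 \<le> deg_bound" unfolding R2_def by (rule degenerate')
  also have "cyc R3 \<le> deg_bound"
    using D.degenerate cycle_sum_dual[of X Y U p q g "\<lambda>u1 u2 v1 v2. \<bar>u1 - v1\<bar> < w"]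
    by (simp add: R3_def deg_bound_dual)
  also have "cyc R4 \<le> deg_bound"
    using D.degenerate' cycle_sum_dual[of X Y U p q g "\<lambda>u1 u2 v1 v2. \<bar>u2 - v2\<bar> < w"]
    by (simp add: R4_def deg_bound_dual)
  finally show ?thesis using 1 by simp
qed

lemma narrow_base: "h < w \<Longrightarrow> narrow h \<le> deg_bound"
  unfolding narrow_def
  by (rule order_trans[OF cycle_sum_mono degenerate]) auto

end

text \<open>The factor \<open>9 * 2 ^ K - 8\<close> starts at 1 and solves the recursion that sends
  \<open>x\<close> to \<open>2 * x + 8\<close>.\<close>

lemma two_sided_iteration:
  fixes f f' :: "real \<Rightarrow> real"
  assumes step: "\<And>h. f h \<le> 2 * f' (\<theta> * h) + 8 * d" "\<And>h. f' h \<le> 2 * f (\<theta> * h) + 8 * d"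
    and base: "\<And>h. h < w \<Longrightarrow> f h \<le> d" "\<And>h. h < w \<Longrightarrow> f' h \<le> d"
  shows "\<theta> ^ K * h < w \<Longrightarrow> f h \<le> (9 * 2 ^ K - 8) * d \<and> f' h \<le> (9 * 2 ^ K - 8) * d"
proof (induction K arbitrary: h)
  case 0
  then show ?case using base by simp
next
  case (Suc K)
  then have "\<theta> ^ K * (\<theta> * h) < w" by (simp add: mult_ac)
  from Suc.IH[OF this] step[of h] show ?case by (auto simp: algebra_simps)
qed

text \<open>Since all labels lie in the unit interval, every cycle is counted by
  \<open>narrow 1\<close>, and after \<open>K\<close> steps only degenerate cycles are left. Their
  bound contains a factor \<open>edge_sum\<close>, which cancels one of the four.\<close>

lemma (in touch_graph) edge_sum_bound:
  assumes U: "U \<subseteq> {0..1}" and K: "(4 * k / t) ^ K < w"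
  shows "edge_sum ^ 3 \<le> (\<Sum>x\<in>X. p x)\<^sup>2 * (\<Sum>y\<in>Y. q y)\<^sup>2 * (9 * 2 ^ K * (n\<^sup>2 * real (card U) * m1 * m2))"
proof (cases "edge_sum = 0")
  case True
  then show ?thesis using nn by simp
next
  case False
  interpret D: touch_graph Y X U q p "\<lambda>y x. g x y" "\<lambda>y. - a' y" "\<lambda>y. - b' y" "\<lambda>y. - c' y"
    "\<lambda>x. - a x" "\<lambda>x. - b x" "\<lambda>x. - c x" \<rho> t w k n m2 m1
    by (rule dual_touch)
  have "D.narrow h \<le> 2 * narrow (4 * k / t * h) + 8 * deg_bound" for h
    using D.narrow_step[of h] by (simp add: deg_bound_dual)
  moreover have "D.narrow h \<le> deg_bound" if "h < w" for h
    using D.narrow_base[OF that] by (simp add: deg_bound_dual)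
  ultimately have "narrow 1 \<le> (9 * 2 ^ K - 8) * deg_bound"
    using two_sided_iteration[of narrow D.narrow "4 * k / t" deg_bound w K 1] narrow_step narrow_base K
    by simp
  also have "\<dots> \<le> 9 * 2 ^ K * deg_bound"
    using deg_bound_nonneg by (intro mult_right_mono) auto
  finally have nar: "narrow 1 \<le> 9 * 2 ^ K * deg_bound" .
  have "cyc (\<lambda>_ _ _ _. True) \<le> narrow 1"
    unfolding narrow_def
  proof (rule cycle_sum_mono, goal_cases)
    case (1 u1 u2 v1 v2)
    then have "u1 \<in> {0..1}" "u2 \<in> {0..1}" "v1 \<in> {0..1}" "v2 \<in> {0..1}" using U by blast+
    then show ?case by (auto simp: abs_le_iff)
  qed
  also note nar
  finally have "edge_sum ^ 4 \<le> (\<Sum>x\<in>X. p x)\<^sup>2 * (\<Sum>y\<in>Y. q y)\<^sup>2 * (9 * 2 ^ K * deg_bound)"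
    using edge_sum_power4_le by (smt (verit) mult_left_mono zero_le_power2 mult_nonneg_nonneg)
  then have "edge_sum * edge_sum ^ 3 \<le>
      edge_sum * ((\<Sum>x\<in>X. p x)\<^sup>2 * (\<Sum>y\<in>Y. q y)\<^sup>2 * (9 * 2 ^ K * (n\<^sup>2 * real (card U) * m1 * m2)))"
    unfolding deg_bound_def by (simp add: power4_eq_xxxx power3_eq_cube mult_ac)
  then show ?thesis using False edge_sum_nonneg by simp
qed

section \<open>Concentration of mass in strips around parabolas\<close>

definition grid :: "nat \<Rightarrow> real set" where
  "grid N = (\<lambda>k. real k / real N) ` {..<N}"

lemma finite_grid [simp]: "finite (grid N)"
  by (simp add: grid_def)

lemma card_grid: "card (grid N) = N"
proof -
  have "inj_on (\<lambda>k. real k / real N) {..<N}"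
    by (cases "N = 0") (auto simp: inj_on_def)
  then show ?thesis by (simp add: grid_def card_image)
qed

lemma grid_subset: "grid N \<subseteq> {0..1}"
  by (auto simp: grid_def field_simps)

lemma card_grid_window:
  assumes "0 \<le> d" and S: "S \<subseteq> grid N" "\<And>u v. u \<in> S \<Longrightarrow> v \<in> S \<Longrightarrow> \<bar>u - v\<bar> \<le> d"
  shows "real (card S) \<le> d * real N + 1"
proof (cases "S = {}")
  case False
  have fS: "finite S" using S by (meson finite_grid finite_subset)
  define m where "m = Min S"
  have m: "m \<in> S" "\<And>v. v \<in> S \<Longrightarrow> m \<le> v" using False fS by (auto simp: m_def)
  obtain k where k: "m = real k / real N" "k < N" using m S by (auto simp: grid_def)
  have "S \<subseteq> (\<lambda>j. real j / real N) ` {k..k + nat \<lfloor>d * N\<rfloor>}"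
  proof
    fix v assume v: "v \<in> S"
    then obtain j where j: "v = real j / real N" "j < N" using S by (auto simp: grid_def)
    have "real k \<le> real j" using m(2)[OF v] k j by (simp add: divide_le_cancel)
    moreover have "v - m \<le> d" using S(2)[OF v m(1)] by simp
    then have "real j - real k \<le> d * N" using k j by (simp add: field_simps)
    then have "int j - int k \<le> \<lfloor>d * N\<rfloor>" by (simp add: le_floor_iff)
    ultimately have "j \<in> {k..k + nat \<lfloor>d * N\<rfloor>}" by auto
    then show "v \<in> (\<lambda>j. real j / real N) ` {k..k + nat \<lfloor>d * N\<rfloor>}" using j by blast
  qed
  then have "card S \<le> card {k..k + nat \<lfloor>d * N\<rfloor>}"
    by (rule surj_card_le[rotated]) simp
  then have "real (card S) \<le> real (nat \<lfloor>d * N\<rfloor>) + 1" by simp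
  also have "real (nat \<lfloor>d * N\<rfloor>) \<le> d * N" using assms by simp
  finally show ?thesis by simp
qed (use assms in simp)

lemma card_grid_ball:
  assumes "0 \<le> d"
  shows "real (card {v \<in> grid N. \<bar>u - v\<bar> < d}) \<le> 2 * d * N + 1"
proof (rule card_grid_window)
  fix v v' assume "v \<in> {v \<in> grid N. \<bar>u - v\<bar> < d}" "v' \<in> {v \<in> grid N. \<bar>u - v\<bar> < d}"
  then have "\<bar>u - v\<bar> < d" "\<bar>u - v'\<bar> < d" by auto
  then show "\<bar>v - v'\<bar> \<le> 2 * d" by linarith
qed (use assms in auto)

definition slope :: "('i \<Rightarrow> real) \<Rightarrow> ('i \<Rightarrow> real) \<Rightarrow> 'i \<Rightarrow> real \<Rightarrow> real" where
  "slope b c i u = b i + 2 * c i * u"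

lemma quad_diff_expand:
  "quad a b c i v - quad a b c j v = (quad a b c i u - quad a b c j u)
    + (slope b c i u - slope b c j u) * (v - u) + (c i - c j) * (v - u)\<^sup>2"
  by (simp add: quad_def slope_def power2_eq_square algebra_simps)

text \<open>
  The index \<open>I\<close> bounds the number of induction steps, \<open>\<kappa>\<close> is the ratio of consecutive scales, and
  \<open>B (1 - \<sigma>) \<ge> 4\<close> makes \<open>\<kappa>\<^bsup>B (1 - \<sigma>)\<^esup>\<close> absorb the losses of the transversal case.
  The constant \<open>2985984 = 12\<^sup>6\<close> only has to be large.
\<close>

locale frostman_quads =
  fixes Z :: "'i set" and p a b c :: "'i \<Rightarrow> real" and \<delta> A \<sigma> \<kappa> :: real and N I B :: nat
  assumes finZ: "finite Z" and p_nonneg: "\<And>z. z \<in> Z \<Longrightarrow> 0 \<le> p z" and p_sum: "(\<Sum>z\<in>Z. p z) \<le> 1"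
    and frostman: "\<And>z r. \<lbrakk>z \<in> Z; \<delta> \<le> r; r \<le> 1\<rbrakk> \<Longrightarrow>
      (\<Sum>z' | z' \<in> Z \<and> \<bar>a z - a z'\<bar> \<le> r \<and> \<bar>b z - b z'\<bar> \<le> r \<and> \<bar>c z - c z'\<bar> \<le> r. p z') \<le> A * r powr \<sigma>"
    and \<delta>: "0 < \<delta>" "1 \<le> real N * \<delta>"
    and \<sigma>: "0 < \<sigma>" "\<sigma> < 1" and B: "4 \<le> B * (1 - \<sigma>)"
    and A: "1 \<le> A" and \<kappa>: "0 < \<kappa>"
    and small: "\<kappa> * (2985984 * A * (real I + 2) ^ 3 * 2 ^ I) \<le> 1"
begin

abbreviation "F \<equiv> quad a b c"
abbreviation "F' \<equiv> slope b c"
abbreviation "U \<equiv> grid N"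

definition near :: "'i \<Rightarrow> 'i \<Rightarrow> real \<Rightarrow> bool" where
  "near z z' r \<longleftrightarrow> \<bar>a z - a z'\<bar> \<le> r \<and> \<bar>b z - b z'\<bar> \<le> r \<and> \<bar>c z - c z'\<bar> \<le> r"

definition slab :: "real \<Rightarrow> real \<Rightarrow> 'i \<Rightarrow> real \<Rightarrow> real" where
  "slab \<rho> r z u = (\<Sum>z' | z' \<in> Z \<and> near z z' r \<and> \<bar>F z u - F z' u\<bar> \<le> \<rho>. p z')"

text \<open>The factor \<open>real n + 1\<close> leaves room for one more unit at each induction
  step, half for tangential and half for transversal pairs. The offset 71 is the one at which the
  powers of \<kappa> in \<open>tan_numerics\<close> balance.\<close>

definition level :: "nat \<Rightarrow> real \<Rightarrow> real" where
  "level n \<rho> = (real n + 1) * \<rho> powr \<sigma> / \<kappa> ^ (B + 71)"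

definition bad_mass :: "('i \<Rightarrow> real \<Rightarrow> bool) \<Rightarrow> real" where
  "bad_mass S = (\<Sum>z\<in>Z. \<Sum>u\<in>U. p z * of_bool (S z u))"

lemma small': "\<kappa> * y \<le> 1" if "y \<le> 2985984 * A * (real I + 2) ^ 3 * 2 ^ I" for y
  using mult_left_mono[OF that, of \<kappa>] \<kappa> small by linarith

lemma big_ge: "2985984 * A \<le> 2985984 * A * (real I + 2) ^ 3 * 2 ^ I"
proof -
  have "1 \<le> (real I + 2) ^ 3 * 2 ^ I"
    by (metis (no_types) mult_mono' one_le_power of_nat_0_le_iff zero_le_one mult_1 one_le_numeral
        add_increasing le_numeral_extra(4) numeral_One)
  then show ?thesis using A mult_left_mono[of 1 _ "2985984 * A"] by (simp add: mult.assoc)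
qed

lemma \<kappa>_A: "\<kappa> * (2985984 * A) \<le> 1"
  by (rule small'[OF big_ge])

lemma \<kappa>_small: "\<kappa> \<le> 1 / 2985984"
proof -
  have "\<kappa> * 2985984 * 1 \<le> \<kappa> * 2985984 * A" using A \<kappa> by (intro mult_left_mono) auto
  then show ?thesis using \<kappa>_A by (simp add: mult_ac)
qed

lemma \<kappa>_lt_1: "\<kappa> < 1" using \<kappa>_small by simp

lemma N_pos: "0 < N" using \<delta> by (cases N) auto

lemma bad_mass_mono:
  assumes "\<And>z u. \<lbrakk>z \<in> Z; u \<in> U; S z u\<rbrakk> \<Longrightarrow> T z u"
  shows "bad_mass S \<le> bad_mass T"
  unfolding bad_mass_def by (intro sum_mono mult_left_mono) (use assms p_nonneg in auto)

lemma bad_mass_disj: "bad_mass (\<lambda>z u. S z u \<or> T z u) \<le> bad_mass S + bad_mass T"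
  unfolding bad_mass_def sum.distrib[symmetric] distrib_left[symmetric]
  by (intro sum_mono mult_left_mono) (use p_nonneg in auto)

lemma bad_mass_Ex:
  assumes "finite L"
  shows "bad_mass (\<lambda>z u. \<exists>l\<in>L. S l z u) \<le> (\<Sum>l\<in>L. bad_mass (S l))"
  using assms
proof (induction L rule: finite_induct)
  case empty
  then show ?case by (simp add: bad_mass_def)
next
  case (insert l L)
  have "bad_mass (\<lambda>z u. \<exists>l\<in>insert l L. S l z u) \<le> bad_mass (\<lambda>z u. S l z u \<or> (\<exists>l\<in>L. S l z u))"
    by (rule bad_mass_mono) auto
  also note bad_mass_disj
  finally show ?case using insert by simp
qed

lemma slab_le_ball:
  assumes "z \<in> Z" "\<delta> \<le> r" "r \<le> 1"
  shows "slab \<rho> r z u \<le> A * r powr \<sigma>"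
proof -
  have "slab \<rho> r z u \<le> (\<Sum>z' | z' \<in> Z \<and> near z z' r. p z')"
    unfolding slab_def by (intro sum_mono2) (use finZ p_nonneg in auto)
  also have "\<dots> \<le> A * r powr \<sigma>" using frostman[OF assms] by (simp add: near_def)
  finally show ?thesis .
qed

text \<open>When \<rho> is not much smaller than \<open>r\<close>, the Frostman bound at radius
  \<open>r\<close> is enough, because the level is inflated by a larger negative power of \<kappa>.
  All other arguments may then assume \<open>\<rho> < \<kappa> ^ (B + 4) * r\<close>.\<close>

lemma slab_trivial:
  assumes "z \<in> Z" "\<delta> \<le> r" "r \<le> 1" "\<kappa> ^ (B + 4) * r \<le> \<rho>"
  shows "slab \<rho> r z u \<le> level n \<rho>"
proof -
  have r: "0 < r" using assms \<delta> by simp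
  have "0 < \<kappa> ^ (B + 4) * r" using r \<kappa> by simp
  then have \<rho>: "0 < \<rho>" using assms by linarith
  have "r \<le> \<rho> / \<kappa> ^ (B + 4)" using assms \<kappa> by (simp add: field_simps)
  then have "r powr \<sigma> \<le> (\<rho> / \<kappa> ^ (B + 4)) powr \<sigma>" using r \<sigma> by (intro powr_mono2) auto
  also have "\<dots> = \<rho> powr \<sigma> / (\<kappa> ^ (B + 4)) powr \<sigma>" by (rule powr_divide)
  also have "(\<kappa> ^ (B + 4)) powr 1 \<le> (\<kappa> ^ (B + 4)) powr \<sigma>"
    using \<kappa> \<kappa>_lt_1 \<sigma> by (intro powr_mono') (auto simp: power_le_one)
  then have "\<rho> powr \<sigma> / (\<kappa> ^ (B + 4)) powr \<sigma> \<le> \<rho> powr \<sigma> / \<kappa> ^ (B + 4)"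
    using \<kappa> by (intro divide_left_mono) auto
  finally have "A * r powr \<sigma> \<le> A * (\<rho> powr \<sigma> / \<kappa> ^ (B + 4))"
    using A by (intro mult_left_mono) auto
  also have "\<dots> \<le> (1 / \<kappa>) * (\<rho> powr \<sigma> / \<kappa> ^ (B + 4))"
    using \<kappa>_A \<kappa> A by (intro mult_right_mono) (auto simp: field_simps)
  also have "\<dots> = \<rho> powr \<sigma> / \<kappa> ^ (B + 5)" using \<kappa> by (simp add: field_simps power_add numeral_eq_Suc)
  also have "\<dots> \<le> \<rho> powr \<sigma> / \<kappa> ^ (B + 71)"
    using \<kappa> \<kappa>_lt_1 by (intro divide_left_mono power_decreasing) auto
  also have "\<dots> \<le> (real n + 1) * (\<rho> powr \<sigma> / \<kappa> ^ (B + 71))"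
    using \<kappa> by (simp add: mult_le_cancel_right1 field_simps)
  also have "\<dots> = level n \<rho>" by (simp add: level_def)
  finally show ?thesis using slab_le_ball[OF assms(1-3)] by (meson order_trans)
qed

text \<open>
  On an arc of length \<open>\<kappa>\<beta>/(8r)\<close> a pair at distance \<open>r\<close> with slope difference of order \<open>\<beta>\<close> stays
  transversal, so that it spends only a proportion of order \<open>\<rho>/\<beta>\<close> of the grid inside the slab of width \<open>\<rho>\<close>.
\<close>

definition trans_pair :: "real \<Rightarrow> real \<Rightarrow> real \<Rightarrow> 'i \<Rightarrow> 'i \<Rightarrow> real \<Rightarrow> bool" where
  "trans_pair \<beta> \<rho> r z z' u \<longleftrightarrow> near z z' r \<and> \<bar>F z u - F z' u\<bar> \<le> \<rho> \<and>
     \<kappa> * \<beta> < \<bar>F' z u - F' z' u\<bar> \<and> \<bar>F' z u - F' z' u\<bar> \<le> \<beta>"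

text \<open>Along an arc of this length the slope, at most \<beta>, and the curvature, at most
  \<open>r\<close>, change the difference only by a small fraction of
  \<open>\<beta>\<^sup>2 / r\<close>. So all pairs active somewhere on the arc lie in the coarse
  slab at any one parameter of it.\<close>

lemma trans_pair_drift:
  assumes t: "trans_pair \<beta> \<rho> r z z' u" and r: "0 < r" and \<beta>: "0 < \<beta>"
    and v: "\<bar>v - u\<bar> \<le> \<kappa> * \<beta> / (8 * r)" and \<rho>: "\<rho> \<le> \<beta>\<^sup>2 / (2 * r)"
  shows "\<bar>F z v - F z' v\<bar> \<le> \<beta>\<^sup>2 / r"
proof -
  have c: "\<bar>c z - c z'\<bar> \<le> r" using t by (simp add: trans_pair_def near_def)
  have "\<bar>(F' z u - F' z' u) * (v - u)\<bar> \<le> \<beta> * (\<kappa> * \<beta> / (8 * r))"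
    unfolding abs_mult using t v \<beta> by (intro mult_mono) (auto simp: trans_pair_def)
  moreover have "(v - u)\<^sup>2 \<le> (\<kappa> * \<beta> / (8 * r))\<^sup>2" using power_mono[OF v, of 2] by simp
  then have "\<bar>(c z - c z') * (v - u)\<^sup>2\<bar> \<le> r * (\<kappa> * \<beta> / (8 * r))\<^sup>2"
    unfolding abs_mult using c r by (intro mult_mono) auto
  moreover have "r * (\<kappa> * \<beta> / (8 * r))\<^sup>2 = \<beta>\<^sup>2 / r * (\<kappa>\<^sup>2 / 64)" "\<beta> * (\<kappa> * \<beta> / (8 * r)) = \<beta>\<^sup>2 / r * (\<kappa> / 8)"
    using r by (simp_all add: power2_eq_square field_simps)
  moreover have "\<bar>F z v - F z' v\<bar> \<le> \<bar>F z u - F z' u\<bar> + \<bar>(F' z u - F' z' u) * (v - u)\<bar> + \<bar>(c z - c z') * (v - u)\<^sup>2\<bar>"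
    unfolding quad_diff_expand[of a b c z v z' u] by linarith
  moreover have "\<bar>F z u - F z' u\<bar> \<le> \<beta>\<^sup>2 / r * (1 / 2)" using t \<rho> by (simp add: trans_pair_def)
  ultimately have "\<bar>F z v - F z' v\<bar> \<le> \<beta>\<^sup>2 / r * (1 / 2) + \<beta>\<^sup>2 / r * (\<kappa> / 8) + \<beta>\<^sup>2 / r * (\<kappa>\<^sup>2 / 64)"
    by linarith
  also have "\<dots> = \<beta>\<^sup>2 / r * (1 / 2 + \<kappa> / 8 + \<kappa>\<^sup>2 / 64)" by (simp only: distrib_left)
  also have "\<dots> \<le> \<beta>\<^sup>2 / r * 1"
  proof (intro mult_left_mono)
    have "\<kappa>\<^sup>2 \<le> 1" using \<kappa> \<kappa>_lt_1 by (simp add: power_le_one)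
    then show "1 / 2 + \<kappa> / 8 + \<kappa>\<^sup>2 / 64 \<le> 1" using \<kappa>_lt_1 by linarith
  qed (use r in auto)
  finally show ?thesis by simp
qed

text \<open>The slope exceeds \<open>\<kappa> * \<beta>\<close>, and on so short an arc the
  curvature undoes at most an eighth of its effect, while the difference is at most \<rho> at both
  ends.\<close>

lemma trans_pair_close:
  assumes t: "trans_pair \<beta> \<rho> r z z' u" "trans_pair \<beta> \<rho> r z z' v" and r: "0 < r" and \<beta>: "0 < \<beta>"
    and v: "\<bar>v - u\<bar> \<le> \<kappa> * \<beta> / (8 * r)"
  shows "\<bar>v - u\<bar> \<le> 3 * \<rho> / (\<kappa> * \<beta>)"
proof -
  define s where "s = \<bar>v - u\<bar>"
  have s: "0 \<le> s" by (simp add: s_def)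
  have c: "\<bar>c z - c z'\<bar> \<le> r" using t by (simp add: trans_pair_def near_def)
  have "\<bar>(c z - c z') * (v - u)\<^sup>2\<bar> = \<bar>c z - c z'\<bar> * (s * s)"
    by (simp add: abs_mult s_def power2_eq_square)
  also have "\<dots> \<le> r * (\<kappa> * \<beta> / (8 * r) * s)"
    using c v r s by (intro mult_mono) (auto simp: s_def)
  also have "\<dots> = \<kappa> * \<beta> * s / 8" using r by simp
  finally have 1: "\<bar>(c z - c z') * (v - u)\<^sup>2\<bar> \<le> \<kappa> * \<beta> * s / 8" .
  have "0 \<le> \<rho>" using t by (auto simp: trans_pair_def)
  have "\<kappa> * \<beta> * s \<le> \<bar>(F' z u - F' z' u) * (v - u)\<bar>"
    unfolding abs_mult s_def using t by (intro mult_right_mono) (auto simp: trans_pair_def)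
  also have "\<dots> \<le> \<bar>F z v - F z' v\<bar> + \<bar>F z u - F z' u\<bar> + \<bar>(c z - c z') * (v - u)\<^sup>2\<bar>"
    using quad_diff_expand[of a b c z v z' u] by linarith
  also have "\<dots> \<le> \<rho> + \<rho> + \<kappa> * \<beta> * s / 8" using t 1 by (auto simp: trans_pair_def)
  finally have "\<kappa> * \<beta> * s \<le> 3 * \<rho>" using \<open>0 \<le> \<rho>\<close> by linarith
  then show ?thesis using \<kappa> \<beta> by (simp add: s_def field_simps)
qed

text \<open>The unit interval is cut into at most \<open>9 * r / (\<kappa> * \<beta>)\<close> arcs.
  If an arc contains a parameter whose coarse slab has mass at most \<open>M\<close>, then all pairs
  active on the arc lie in that slab, and each is active at no more than
  \<open>4 * \<rho> * N / (\<kappa> * \<beta>)\<close> grid points.\<close>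

lemma trans_sum_bound:
  assumes z: "z \<in> Z" and r: "0 < r" and \<beta>: "0 < \<beta>" "\<beta> \<le> 3 * r" and \<rho>: "\<delta> \<le> \<rho>" "\<rho> \<le> \<beta>\<^sup>2 / (2 * r)"
    and r1: "r \<le> 1" and M: "0 \<le> M"
  shows "(\<Sum>u\<in>U. of_bool (slab (\<beta>\<^sup>2 / r) r z u \<le> M) * (\<Sum>z' | z' \<in> Z \<and> trans_pair \<beta> \<rho> r z z' u. p z'))
    \<le> 36 * r * \<rho> * real N / (\<kappa> * \<beta>)\<^sup>2 * M"
proof -
  define \<eta> where "\<eta> = \<kappa> * \<beta> / (8 * r)"
  have \<eta>: "0 < \<eta>" using \<kappa> \<beta> r by (simp add: \<eta>_def)
  define f where "f u = of_bool (slab (\<beta>\<^sup>2 / r) r z u \<le> M) * (\<Sum>z' | z' \<in> Z \<and> trans_pair \<beta> \<rho> r z z' u. p z')" for u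
  define Q where "Q = 4 * \<rho> * real N / (\<kappa> * \<beta>)"
  have \<rho>0: "0 < \<rho>" using \<rho> \<delta> by simp
  have \<kappa>\<beta>: "\<kappa> * \<beta> \<le> 1" "\<kappa> * \<beta> \<le> r"
  proof -
    have "\<kappa> * \<beta> \<le> (1 / 3) * (3 * r)" using \<beta> \<kappa> \<kappa>_small by (intro mult_mono) auto
    then show "\<kappa> * \<beta> \<le> r" by simp
    then show "\<kappa> * \<beta> \<le> 1" using r1 by simp
  qed
  have "1 \<le> \<rho> * N" using \<delta> \<rho> mult_left_mono[OF \<rho>(1), of "real N"] by (simp add: mult.commute)
  then have Q1: "3 * \<rho> / (\<kappa> * \<beta>) * N + 1 \<le> Q"
    unfolding Q_def using \<kappa>\<beta> \<kappa> \<beta> by (simp add: field_simps)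
  have Q0: "0 \<le> Q" unfolding Q_def using \<rho>0 \<kappa> \<beta> by simp
  have block: "(\<Sum>u | u \<in> U \<and> \<lfloor>u / \<eta>\<rfloor> = i. f u) \<le> Q * M" for i
  proof (cases "\<exists>u0. u0 \<in> U \<and> \<lfloor>u0 / \<eta>\<rfloor> = i \<and> slab (\<beta>\<^sup>2 / r) r z u0 \<le> M")
    case False
    then have "(\<Sum>u | u \<in> U \<and> \<lfloor>u / \<eta>\<rfloor> = i. f u) = 0"
      by (intro sum.neutral) (auto simp: f_def)
    then show ?thesis using Q0 M by simp
  next
    case True
    then obtain u0 where u0: "u0 \<in> U" "\<lfloor>u0 / \<eta>\<rfloor> = i" "slab (\<beta>\<^sup>2 / r) r z u0 \<le> M" by blast
    let ?V = "{u \<in> U. \<lfloor>u / \<eta>\<rfloor> = i}"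
    have close: "\<bar>v - u\<bar> \<le> \<eta>" if "\<lfloor>u / \<eta>\<rfloor> = i" "\<lfloor>v / \<eta>\<rfloor> = i" for u v
    proof -
      have "\<bar>v / \<eta> - u / \<eta>\<bar> < 1" using that by linarith
      then have "\<bar>(v - u) / \<eta>\<bar> < 1" by (simp add: diff_divide_distrib)
      then show ?thesis using \<eta> by (simp add: field_simps)
    qed
    have "(\<Sum>u\<in>?V. f u) \<le> (\<Sum>u\<in>?V. \<Sum>z' | z' \<in> Z \<and> trans_pair \<beta> \<rho> r z z' u. p z')"
      unfolding f_def by (intro sum_mono) (auto intro!: sum_nonneg p_nonneg)
    also have "\<dots> = (\<Sum>u\<in>?V. \<Sum>z'\<in>Z. if trans_pair \<beta> \<rho> r z z' u then p z' else 0)"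
      using finZ by (simp add: sum.inter_filter)
    also have "\<dots> = (\<Sum>z'\<in>Z. \<Sum>u\<in>?V. if trans_pair \<beta> \<rho> r z z' u then p z' else 0)"
      by (rule sum.swap)
    also have "\<dots> = (\<Sum>z'\<in>Z. p z' * real (card {u \<in> ?V. trans_pair \<beta> \<rho> r z z' u}))"
      by (intro sum.cong refl) (simp add: sum.inter_filter[symmetric])
    also have "\<dots> \<le> (\<Sum>z'\<in>Z. if near z z' r \<and> \<bar>F z u0 - F z' u0\<bar> \<le> \<beta>\<^sup>2 / r then p z' * Q else 0)"
    proof (intro sum_mono)
      fix z' assume z': "z' \<in> Z"
      let ?S = "{u \<in> ?V. trans_pair \<beta> \<rho> r z z' u}"
      have card: "real (card ?S) \<le> Q"
      proof (rule order_trans[OF card_grid_window Q1])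
        show "0 \<le> 3 * \<rho> / (\<kappa> * \<beta>)" using \<rho>0 \<kappa> \<beta> by simp
        fix u v assume "u \<in> ?S" "v \<in> ?S"
        then show "\<bar>u - v\<bar> \<le> 3 * \<rho> / (\<kappa> * \<beta>)"
          using trans_pair_close[of \<beta> \<rho> r z z' v u] close[of v u] r \<beta> by (simp add: \<eta>_def)
      qed auto
      show "p z' * real (card ?S) \<le> (if near z z' r \<and> \<bar>F z u0 - F z' u0\<bar> \<le> \<beta>\<^sup>2 / r then p z' * Q else 0)"
      proof (cases "?S = {}")
        case True
        then show ?thesis using p_nonneg[OF z'] Q0 by (simp only:) simp
      next
        case False
        then obtain u where u: "u \<in> U" "\<lfloor>u / \<eta>\<rfloor> = i" "trans_pair \<beta> \<rho> r z z' u" by blast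
        have "\<bar>F z u0 - F z' u0\<bar> \<le> \<beta>\<^sup>2 / r"
          using trans_pair_drift[OF u(3) r \<beta>(1) _ \<rho>(2)] close[OF u(2) u0(2)] by (simp add: \<eta>_def)
        moreover have "near z z' r" using u by (simp add: trans_pair_def)
        ultimately show ?thesis using card p_nonneg[OF z'] by (simp add: mult_left_mono)
      qed
    qed
    also have "\<dots> = slab (\<beta>\<^sup>2 / r) r z u0 * Q"
      unfolding slab_def using finZ by (simp add: sum.inter_filter[symmetric] sum_distrib_right)
    also have "\<dots> \<le> M * Q" using u0 Q0 by (intro mult_right_mono)
    finally show ?thesis by (simp add: mult.commute)
  qed
  have "(\<Sum>u\<in>U. f u) = (\<Sum>i\<in>(\<lambda>u. \<lfloor>u / \<eta>\<rfloor>) ` U. \<Sum>u | u \<in> U \<and> \<lfloor>u / \<eta>\<rfloor> = i. f u)"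
    by (rule sum.image_gen) simp
  also have "\<dots> \<le> real (card ((\<lambda>u. \<lfloor>u / \<eta>\<rfloor>) ` U)) * (Q * M)"
    using block by (intro sum_bounded_above)
  also have "\<dots> \<le> (9 * r / (\<kappa> * \<beta>)) * (Q * M)"
  proof (intro mult_right_mono)
    have "(\<lambda>u. \<lfloor>u / \<eta>\<rfloor>) ` U \<subseteq> {0..\<lfloor>1 / \<eta>\<rfloor>}"
    proof clarify
      fix u assume "u \<in> U"
      then have "u \<in> {0..1}" using grid_subset by blast
      then show "\<lfloor>u / \<eta>\<rfloor> \<in> {0..\<lfloor>1 / \<eta>\<rfloor>}" using \<eta> by (auto intro!: floor_mono divide_right_mono)
    qed
    then have "card ((\<lambda>u. \<lfloor>u / \<eta>\<rfloor>) ` U) \<le> card {0..\<lfloor>1 / \<eta>\<rfloor>}" by (intro card_mono) auto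
    also have "\<dots> = nat (\<lfloor>1 / \<eta>\<rfloor> + 1)" by simp
    finally have "real (card ((\<lambda>u. \<lfloor>u / \<eta>\<rfloor>) ` U)) \<le> real_of_int \<lfloor>1 / \<eta>\<rfloor> + 1"
      using \<eta> by (simp add: nat_le_iff le_nat_iff)
    also have "\<dots> \<le> 1 / \<eta> + 1" by simp
    also have "\<dots> \<le> 9 * r / (\<kappa> * \<beta>)" using \<kappa>\<beta> \<kappa> \<beta> by (simp add: \<eta>_def field_simps)
    finally show "real (card ((\<lambda>u. \<lfloor>u / \<eta>\<rfloor>) ` U)) \<le> 9 * r / (\<kappa> * \<beta>)" .
  qed (use Q0 M in auto)
  also have "\<dots> = 36 * r * \<rho> * real N / (\<kappa> * \<beta>)\<^sup>2 * M"
    by (simp add: Q_def power2_eq_square)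
  finally show ?thesis by (simp add: f_def)
qed

lemma B_ge_5: "5 \<le> B"
proof (rule ccontr)
  assume "\<not> 5 \<le> B"
  then have "real B \<le> 4" by simp
  note B
  also have "real B * (1 - \<sigma>) \<le> 4 * (1 - \<sigma>)"
    using \<sigma> \<open>real B \<le> 4\<close> by (intro mult_right_mono) auto
  also have "\<dots> < 4" using \<sigma> by simp
  finally show False by simp
qed

lemma \<kappa>_B_le: "\<kappa> ^ B \<le> \<kappa>"
  using power_decreasing[of 1 B \<kappa>] B_ge_5 \<kappa> \<kappa>_lt_1 by simp

lemma \<kappa>_B_powr: "y powr (1 - \<sigma>) \<le> \<kappa> ^ 4" if "0 \<le> y" "y \<le> \<kappa> ^ B"
proof -
  have "y powr (1 - \<sigma>) \<le> (\<kappa> ^ B) powr (1 - \<sigma>)" using that \<sigma> by (intro powr_mono2) auto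
  also have "\<dots> = \<kappa> powr (B * (1 - \<sigma>))" by (simp only: powr_realpow[OF \<kappa>, symmetric] powr_powr)
  also have "\<dots> \<le> \<kappa> powr 4" using B \<kappa> \<kappa>_lt_1 by (intro powr_mono') auto
  also have "\<dots> = \<kappa> ^ 4" using powr_realpow[OF \<kappa>, of 4] by simp
  finally show ?thesis .
qed

text \<open>Markov's inequality for the preceding average. With
  \<open>y = \<rho> / (\<beta>\<^sup>2 / r)\<close>, the coarse level exceeds the threshold by a
  factor of order \<open>y powr (- \<sigma>)\<close>, while the time spent in the slab is of order
  \<open>y / \<kappa>\<^sup>2\<close>. As \<open>y \<le> \<kappa> ^ B\<close>, the remaining power
  \<open>y powr (1 - \<sigma>)\<close> is at most \<open>\<kappa> ^ 4\<close> and beats the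
  loss.\<close>

lemma trans_bad_mass:
  assumes r: "\<delta> \<le> r" "r \<le> 1" and \<rho>: "\<delta> \<le> \<rho>" and \<beta>: "0 < \<beta>" "\<beta> \<le> 3 * r" "\<rho> / \<kappa> ^ B \<le> \<beta>\<^sup>2 / r"
  shows "bad_mass (\<lambda>z u. slab (\<beta>\<^sup>2 / r) r z u \<le> level n (\<beta>\<^sup>2 / r) \<and>
      \<rho> powr \<sigma> / \<kappa> ^ (B + 71) / (2 * (real n + 2)) < (\<Sum>z' | z' \<in> Z \<and> trans_pair \<beta> \<rho> r z z' u. p z'))
    \<le> 72 * (real n + 1) * (real n + 2) * \<kappa>\<^sup>2 * real N"
proof -
  define res where "res = \<beta>\<^sup>2 / r"
  define thr where "thr = \<rho> powr \<sigma> / \<kappa> ^ (B + 71) / (2 * (real n + 2))"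
  define M where "M = level n res"
  define tr where "tr z u = (\<Sum>z' | z' \<in> Z \<and> trans_pair \<beta> \<rho> r z z' u. p z')" for z u
  have pos: "0 < r" "0 < \<rho>" using r \<rho> \<delta> by linarith+
  then have res: "0 < res" using \<beta> by (simp add: res_def)
  have thr: "0 < thr" using pos \<kappa> by (simp add: thr_def)
  have M: "0 \<le> M" using \<kappa> by (simp add: M_def level_def)
  have tr: "0 \<le> tr z u" for z u unfolding tr_def by (intro sum_nonneg) (use p_nonneg in auto)
  define y where "y = \<rho> / res"
  have y: "0 < y" "y \<le> \<kappa> ^ B"
    using \<beta>(3) res pos \<kappa> by (auto simp: y_def res_def[symmetric] field_simps)
  have "y \<le> 1 / 2" using y \<kappa>_B_le \<kappa>_small by linarith
  then have \<rho>2: "\<rho> \<le> \<beta>\<^sup>2 / (2 * r)" using pos res by (simp add: y_def res_def field_simps)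
  have row: "(\<Sum>u\<in>U. of_bool (slab res r z u \<le> M) * tr z u) \<le> 36 * r * \<rho> * real N / (\<kappa> * \<beta>)\<^sup>2 * M" if "z \<in> Z" for z
    unfolding res_def tr_def
    by (rule trans_sum_bound) (use that pos \<beta> \<rho> \<rho>2 r M in auto)
  have "bad_mass (\<lambda>z u. slab res r z u \<le> M \<and> thr < tr z u)
      \<le> (\<Sum>z\<in>Z. \<Sum>u\<in>U. p z * (of_bool (slab res r z u \<le> M) * tr z u / thr))"
    unfolding bad_mass_def
    by (intro sum_mono mult_left_mono) (use thr tr p_nonneg in \<open>auto simp: field_simps\<close>)
  also have "\<dots> = (\<Sum>z\<in>Z. p z * ((\<Sum>u\<in>U. of_bool (slab res r z u \<le> M) * tr z u) / thr))"
    by (simp only: sum_distrib_left sum_divide_distrib times_divide_eq_right)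
  also have "\<dots> \<le> (\<Sum>z\<in>Z. p z * (36 * r * \<rho> * real N / (\<kappa> * \<beta>)\<^sup>2 * M / thr))"
    by (intro sum_mono mult_left_mono divide_right_mono row) (use thr p_nonneg in auto)
  also have "\<dots> = (\<Sum>z\<in>Z. p z) * (36 * r * \<rho> * real N / (\<kappa> * \<beta>)\<^sup>2 * M / thr)"
    by (simp only: sum_distrib_right)
  also have "\<dots> \<le> 1 * (36 * r * \<rho> * real N / (\<kappa> * \<beta>)\<^sup>2 * M / thr)"
    using p_sum pos M thr by (intro mult_right_mono) auto
  also have "36 * r * \<rho> * real N / (\<kappa> * \<beta>)\<^sup>2 * M / thr = 36 * y * real N / \<kappa>\<^sup>2 * (M / thr)"
  proof -
    have "(\<kappa> * \<beta>)\<^sup>2 = \<kappa>\<^sup>2 * (res * r)" using pos by (simp add: res_def power_mult_distrib)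
    then show ?thesis using pos by (simp add: y_def mult_ac)
  qed
  also have "M / thr = 2 * (real n + 1) * (real n + 2) * (res powr \<sigma> / \<rho> powr \<sigma>)"
    using \<kappa> pos by (simp add: M_def thr_def level_def field_simps)
  also have "res powr \<sigma> / \<rho> powr \<sigma> = y powr (- \<sigma>)"
    using res pos by (simp add: y_def powr_divide powr_minus_divide)
  also have "36 * y * real N / \<kappa>\<^sup>2 * (2 * (real n + 1) * (real n + 2) * y powr (- \<sigma>))
     = 72 * (real n + 1) * (real n + 2) * real N / \<kappa>\<^sup>2 * (y powr 1 * y powr (- \<sigma>))"
    using y by simp
  also have "y powr 1 * y powr (- \<sigma>) = y powr (1 - \<sigma>)"
    by (simp only: powr_add[symmetric]) simp
  also have "72 * (real n + 1) * (real n + 2) * real N / \<kappa>\<^sup>2 * y powr (1 - \<sigma>)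
      \<le> 72 * (real n + 1) * (real n + 2) * real N / \<kappa>\<^sup>2 * \<kappa> ^ 4"
    using y by (intro mult_left_mono \<kappa>_B_powr) auto
  also have "\<dots> = 72 * (real n + 1) * (real n + 2) * \<kappa>\<^sup>2 * real N"
    using \<kappa> by (simp add: power4_eq_xxxx power2_eq_square)
  finally show ?thesis by (simp add: res_def M_def thr_def tr_def)
qed

end

text \<open>For \<open>\<bar>v - u\<bar> \<ge> 4 * \<tau> / t\<close> the slope term and the initial
  error each use up at most a quarter of the curvature term \<open>t * (v - u)\<^sup>2\<close>, so
  half of it survives.\<close>

lemma touch_quadI:
  assumes "\<bar>quad a b c y u - quad a b c x u\<bar> \<le> \<rho>" "\<bar>slope b c y u - slope b c x u\<bar> \<le> \<tau>" "t \<le> c y - c x"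
    and "0 < t" "4 * \<rho> \<le> t * (4 * \<tau> / t)\<^sup>2"
  shows "touch \<rho> t (4 * \<tau> / t) (quad a b c x) (quad a b c y) u"
  unfolding touch_def
proof (intro conjI allI impI)
  fix v assume v: "4 * \<tau> / t \<le> \<bar>v - u\<bar>"
  have \<tau>: "0 \<le> \<tau>" using assms(2) by linarith
  have "4 * \<tau> \<le> t * \<bar>v - u\<bar>" using v assms(4) by (simp add: field_simps)
  then have "4 * \<tau> * \<bar>v - u\<bar> \<le> t * \<bar>v - u\<bar> * \<bar>v - u\<bar>" by (intro mult_right_mono) auto
  then have 1: "4 * \<tau> * \<bar>v - u\<bar> \<le> t * (v - u)\<^sup>2" by (simp add: power2_eq_square mult.assoc)
  have "(4 * \<tau> / t)\<^sup>2 \<le> (v - u)\<^sup>2"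
    using power_mono[OF v, of 2] \<tau> assms(4) by simp
  then have 2: "4 * \<rho> \<le> t * (v - u)\<^sup>2"
    using assms(4,5) by (smt (verit) mult_left_mono)
  have 3: "t * (v - u)\<^sup>2 \<le> (c y - c x) * (v - u)\<^sup>2" using assms(3) by (intro mult_right_mono) auto
  have "\<bar>(slope b c y u - slope b c x u) * (v - u)\<bar> \<le> \<tau> * \<bar>v - u\<bar>"
    unfolding abs_mult using assms(2) by (intro mult_right_mono) auto
  then have "- (\<tau> * \<bar>v - u\<bar>) \<le> (slope b c y u - slope b c x u) * (v - u)" by (simp only: abs_le_iff) linarith
  moreover have "- \<rho> \<le> quad a b c y u - quad a b c x u" using assms(1) by linarith
  ultimately show "t / 2 * (v - u)\<^sup>2 \<le> quad a b c y v - quad a b c x v"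
    unfolding quad_diff_expand[of a b c y v x u] using 1 2 3 by linarith
qed (rule assms)

text \<open>A lower bound for \<open>E\<close> that is linear in \<open>P\<close>, against an upper
  bound for \<open>E ^ 3\<close> that is only quadratic in \<open>P\<close>, bounds \<open>P\<close>
  itself.\<close>

lemma cube_le_imp_le:
  fixes P :: real
  assumes "E ^ 3 \<le> P\<^sup>2 * D" "P * L \<le> E" "0 \<le> P" "0 < L" "D \<le> L ^ 3 * C" "0 \<le> C"
  shows "P \<le> C"
proof (cases "P = 0")
  case False
  have "(P * L) ^ 3 \<le> E ^ 3" using assms by (intro power_mono) auto
  also have "\<dots> \<le> P\<^sup>2 * D" by (rule assms)
  also have "\<dots> \<le> P\<^sup>2 * (L ^ 3 * C)" using assms by (intro mult_left_mono) auto
  finally have "P\<^sup>2 * (P * L ^ 3) \<le> P\<^sup>2 * (C * L ^ 3)"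
    by (simp add: power_mult_distrib power3_eq_cube power2_eq_square mult_ac)
  then have "P * L ^ 3 \<le> C * L ^ 3" using False by simp
  then show ?thesis using assms(4) by simp
qed (use assms in simp)

section \<open>Tangential pairs between two small cells\<close>

context frostman_quads
begin

text \<open>Pairs within \<open>\<kappa> * r\<close> are left to the next smaller radius; removing
  them forces a definite difference in \<open>c\<close>.\<close>

definition tan_pair :: "real \<Rightarrow> real \<Rightarrow> real \<Rightarrow> 'i \<Rightarrow> 'i \<Rightarrow> real \<Rightarrow> bool" where
  "tan_pair \<tau> \<rho> r z z' u \<longleftrightarrow> near z z' r \<and> \<not> near z z' (\<kappa> * r) \<and> \<bar>F z u - F z' u\<bar> \<le> \<rho> \<and> \<bar>F' z u - F' z' u\<bar> \<le> \<tau>"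

definition cell :: "real \<Rightarrow> 'i \<Rightarrow> int \<times> int \<times> int" where
  "cell s z = (\<lfloor>a z / s\<rfloor>, \<lfloor>b z / s\<rfloor>, \<lfloor>c z / s\<rfloor>)"

lemma near_mono: "near z z' r \<Longrightarrow> r \<le> r' \<Longrightarrow> near z z' r'"
  by (auto simp: near_def)

lemma cell_near:
  assumes "cell s z = cell s z'" "0 < s"
  shows "near z z' s"
proof -
  have *: "\<bar>x - y\<bar> \<le> s" if "\<lfloor>x / s\<rfloor> = \<lfloor>y / s\<rfloor>" for x y :: real
  proof -
    have "\<bar>x / s - y / s\<bar> < 1" using that by linarith
    then have "\<bar>(x - y) / s\<bar> < 1" by (simp add: diff_divide_distrib)
    then show ?thesis using assms by (simp add: field_simps)
  qed
  show ?thesis using assms(1) * by (simp add: near_def cell_def)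
qed

text \<open>If \<open>c\<close> differed less, the slope at \<open>u\<close> would force
  \<open>b\<close>, and then the value at \<open>u\<close> would force \<open>a\<close>, to be close
  as well, so the pair would be within \<open>\<kappa> * r\<close>.\<close>

lemma tan_pair_c:
  assumes t: "tan_pair \<tau> \<rho> r z z' u" and u: "u \<in> {0..1}" and r: "0 < r" and small: "\<rho> + \<tau> \<le> \<kappa> * r / 2"
  shows "\<kappa> * r / 6 \<le> \<bar>c z - c z'\<bar>"
proof (rule ccontr)
  assume "\<not> ?thesis"
  then have c: "\<bar>c z - c z'\<bar> < \<kappa> * r / 6" by simp
  define d1 where "d1 = (c z - c z') * u"
  define d2 where "d2 = (c z - c z') * u\<^sup>2"
  define d3 where "d3 = (b z - b z') * u"
  have d: "\<bar>d1\<bar> \<le> \<bar>c z - c z'\<bar>" "\<bar>d2\<bar> \<le> \<bar>c z - c z'\<bar>" "\<bar>d3\<bar> \<le> \<bar>b z - b z'\<bar>"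
    using u by (auto simp: d1_def d2_def d3_def abs_mult mult_left_le power_le_one)
  have t': "\<bar>F z u - F z' u\<bar> \<le> \<rho>" "\<bar>F' z u - F' z' u\<bar> \<le> \<tau>" using t by (simp_all add: tan_pair_def)
  have "b z - b z' = (F' z u - F' z' u) - 2 * d1"
    by (simp add: slope_def d1_def algebra_simps)
  then have b: "\<bar>b z - b z'\<bar> \<le> \<tau> + 2 * \<bar>c z - c z'\<bar>"
    using t'(2) d(1) by (smt (verit))
  have "a z - a z' = (F z u - F z' u) - d3 - d2"
    by (simp add: quad_def d2_def d3_def algebra_simps)
  then have "\<bar>a z - a z'\<bar> \<le> \<rho> + \<tau> + 3 * \<bar>c z - c z'\<bar>"
    using t'(1) d b by (smt (verit))
  moreover have "0 \<le> \<rho>" "0 \<le> \<tau>" using t' by linarith+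
  ultimately have "near z z' (\<kappa> * r)"
    unfolding near_def using b c small by (intro conjI; linarith)
  then show False using t by (simp add: tan_pair_def)
qed

text \<open>After cancelling \<open>real N ^ 3 * T\<close>, the right side is
  \<open>\<kappa> ^ 48 * T\<^sup>2\<close>, with \<kappa>-exponent
  \<open>48 + 20 - 2 * (B + 71)\<close>. The left side has \<open>- (B + 2)\<close> from
  \<open>w\<^sup>2\<close>, \<open>- (B + 71)\<close> from the level, and one more
  \<open>1 / \<kappa>\<close> that absorbs the constants and \<open>2 ^ (n + 1)\<close>. The two
  exponents agree. The factor \<open>\<rho> / r\<close> in \<open>w\<^sup>2\<close> turns
  \<open>r powr \<sigma>\<close> into at most \<open>\<rho> powr \<sigma>\<close>.\<close>

lemma tan_numerics:
  assumes n: "n < I" and r: "0 < r" and \<rho>: "0 < \<rho>" "\<rho> \<le> r"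
  defines "w \<equiv> 4 * sqrt (\<rho> * r / \<kappa> ^ B) / (\<kappa> * r / 12)"
    and "T \<equiv> \<kappa> ^ 10 * (\<rho> powr \<sigma> / (2 * \<kappa> ^ (B + 71)))"
  shows "A * r powr \<sigma> * (9 * 2 ^ (n + 1) * ((3 * w * N)\<^sup>2 * N * T * (2 * level n \<rho>))) \<le> (\<kappa> ^ 12 * N * T) ^ 3 * \<kappa> ^ 12"
proof -
  define R where "R = \<rho> powr \<sigma>"
  have R: "0 < R" using \<rho> by (simp add: R_def)
  have T: "0 < T" using \<kappa> \<rho> by (simp add: T_def)
  have w2: "w\<^sup>2 = 2304 * (\<rho> / r) / \<kappa> ^ (B + 2)"
    unfolding w_def using r \<rho> \<kappa> by (simp add: power_divide power_mult_distrib power_add power2_eq_square field_simps)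
  have le_R: "r powr \<sigma> * (\<rho> / r) \<le> R"
  proof -
    have "(\<rho> / r) powr 1 \<le> (\<rho> / r) powr \<sigma>" using r \<rho> \<sigma> by (intro powr_mono') auto
    then have "r powr \<sigma> * (\<rho> / r) \<le> r powr \<sigma> * (\<rho> / r) powr \<sigma>" using r \<rho> by (intro mult_left_mono) auto
    also have "\<dots> = R" using r \<rho> by (simp add: powr_divide R_def)
    finally show ?thesis .
  qed
  have const: "\<kappa> * (A * 1492992 * ((real n + 1) * 2 ^ (n + 1))) \<le> 1"
  proof (rule small')
    have "(real n + 1) * 2 ^ (n + 1) \<le> (real I + 2) ^ 3 * 2 ^ I"
    proof (intro mult_mono)
      have "real n + 1 \<le> (real I + 2) ^ 1" using n by simp
      also have "\<dots> \<le> (real I + 2) ^ 3" by (intro power_increasing) auto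
      finally show "real n + 1 \<le> (real I + 2) ^ 3" .
      show "(2 :: real) ^ (n + 1) \<le> 2 ^ I" using n by (intro power_increasing) auto
    qed auto
    then have "A * 1492992 * ((real n + 1) * 2 ^ (n + 1)) \<le> A * 2985984 * ((real I + 2) ^ 3 * 2 ^ I)"
      by (rule mult_mono[rotated]) (use A in auto)
    then show "A * 1492992 * ((real n + 1) * 2 ^ (n + 1)) \<le> 2985984 * A * (real I + 2) ^ 3 * 2 ^ I"
      by (simp add: mult_ac)
  qed
  have "A * r powr \<sigma> * (9 * 2 ^ (n + 1) * ((3 * w * N)\<^sup>2 * N * T * (2 * level n \<rho>)))
      = real N ^ 3 * T * (162 * A * 2 ^ (n + 1) * (r powr \<sigma> * w\<^sup>2) * level n \<rho>)"
    by (simp add: power_mult_distrib power3_eq_cube power2_eq_square)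
  also have "\<dots> \<le> real N ^ 3 * T * (\<kappa> ^ 48 * T\<^sup>2)"
  proof (intro mult_left_mono)
    have "162 * A * 2 ^ (n + 1) * (r powr \<sigma> * w\<^sup>2) * level n \<rho>
       = (A * 1492992 * ((real n + 1) * 2 ^ (n + 1))) * (r powr \<sigma> * (\<rho> / r)) * R / (4 * \<kappa> ^ (B + 2) * \<kappa> ^ (B + 71))"
      unfolding w2 level_def R_def by (simp add: mult_ac)
    also have "\<dots> \<le> (1 / \<kappa>) * R * R / (4 * \<kappa> ^ (B + 2) * \<kappa> ^ (B + 71))"
      using const \<kappa> le_R R A r \<rho> by (intro divide_right_mono mult_mono) (auto simp: field_simps)
    also have "\<dots> = \<kappa> ^ 48 * T\<^sup>2"
      using \<kappa> by (simp add: T_def R_def[symmetric] power2_eq_square power_add field_simps eval_nat_numeral)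
    finally show "162 * A * 2 ^ (n + 1) * (r powr \<sigma> * w\<^sup>2) * level n \<rho> \<le> \<kappa> ^ 48 * T\<^sup>2" .
  qed (use T in auto)
  also have "\<dots> = (\<kappa> ^ 12 * N * T) ^ 3 * \<kappa> ^ 12"
    by (simp add: power_mult_distrib power3_eq_cube power2_eq_square flip: power_add power_mult)
  finally show ?thesis .
qed

text \<open>The graph joins \<open>x\<close> in \<open>X\<close> to \<open>y\<close> in
  \<open>Y\<close> at the good parameters \<open>u\<close> of near tangency. Its edge sum is at
  least \<open>\<kappa> ^ 12 * N * T\<close> times the mass of \<open>X\<close>, while the cycle
  bound for its cube is quadratic in the masses of \<open>X\<close> and \<open>Y\<close>. One factor
  of the mass of \<open>Y\<close> is estimated by the Frostman condition; the other remains and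
  dominates the mass of \<open>X\<close>.\<close>

lemma tan_cell_bound:
  fixes k1 k2 :: "int \<times> int \<times> int"
  assumes n: "n < I" and r: "\<delta> \<le> r" "r \<le> 1" and \<rho>: "\<delta> \<le> \<rho>" "\<kappa> ^ (n + 1) * r \<le> \<rho>" "\<rho> < \<kappa> ^ (B + 4) * r"
  defines "s \<equiv> \<kappa> ^ 3 * r" and "\<tau> \<equiv> sqrt (\<rho> * r / \<kappa> ^ B)"
    and "T \<equiv> \<kappa> ^ 10 * (\<rho> powr \<sigma> / (2 * \<kappa> ^ (B + 71)))"
  defines "Y \<equiv> {y \<in> Z. cell s y = k2}"
  defines "mY \<equiv> \<lambda>x u. \<Sum>y | y \<in> Y \<and> tan_pair \<tau> \<rho> r x y u. p y"
  defines "G \<equiv> \<lambda>x. {u \<in> U. slab \<rho> (\<kappa> * r) x u \<le> level n \<rho> \<and> T \<le> mY x u}"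
  defines "X \<equiv> {x \<in> Z. cell s x = k1 \<and> \<kappa> ^ 12 * N \<le> card (G x)}"
  shows "(\<Sum>x\<in>X. p x) \<le> \<kappa> ^ 12 * (\<Sum>y\<in>Y. p y)"
proof (cases "X = {}")
  case True
  have "0 \<le> (\<Sum>y\<in>Y. p y)" unfolding Y_def by (intro sum_nonneg) (use p_nonneg in auto)
  then show ?thesis using True \<kappa> by simp
next
  case False
  note pZ = p_nonneg
  have rpos: "0 < r" "0 < \<rho>" using r \<rho> \<delta> by linarith+
  have "\<kappa> ^ (B + 4) \<le> 1" using \<kappa> \<kappa>_lt_1 by (simp add: power_le_one)
  then have "\<kappa> ^ (B + 4) * r \<le> r" using rpos by (intro mult_left_le_one_le) (use \<kappa> in auto)
  then have \<rho>r: "\<rho> \<le> r" using \<rho> by simp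
  have s: "0 < s" using \<kappa> rpos by (simp add: s_def)
  have \<tau>: "0 < \<tau>" using \<kappa> rpos by (simp add: \<tau>_def)
  have \<tau>2: "\<tau>\<^sup>2 = \<rho> * r / \<kappa> ^ B" using \<kappa> rpos by (simp add: \<tau>_def)
  have T: "0 < T" using \<kappa> rpos by (simp add: T_def)
  have M: "0 \<le> level n \<rho>" using \<kappa> by (simp add: level_def)
  define t where "t = \<kappa> * r / 12"
  have t: "0 < t" using \<kappa> rpos by (simp add: t_def)
  define w where "w = 4 * \<tau> / t"
  have w: "0 < w" using \<tau> t by (simp add: w_def)
  have small_\<tau>: "\<rho> + \<tau> \<le> \<kappa> * r / 2"
  proof -
    have "\<rho> * r / \<kappa> ^ B \<le> \<kappa> ^ (B + 4) * r * r / \<kappa> ^ B"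
      using \<rho> rpos \<kappa> by (intro divide_right_mono mult_right_mono) auto
    also have "\<dots> = (\<kappa>\<^sup>2 * r)\<^sup>2"
      using \<kappa> by (simp add: power_add power_mult_distrib power2_eq_square eval_nat_numeral)
    finally have "\<tau>\<^sup>2 \<le> (\<kappa>\<^sup>2 * r)\<^sup>2" by (simp add: \<tau>2)
    then have "\<tau> \<le> \<kappa>\<^sup>2 * r" using rpos \<kappa> by (intro power2_le_imp_le[of \<tau> "\<kappa>\<^sup>2 * r"]) auto
    moreover have "\<rho> \<le> \<kappa>\<^sup>2 * r"
    proof -
      have "\<kappa> ^ (B + 4) \<le> \<kappa>\<^sup>2" using \<kappa> \<kappa>_lt_1 by (intro power_decreasing) auto
      then have "\<kappa> ^ (B + 4) * r \<le> \<kappa>\<^sup>2 * r" using rpos by (intro mult_right_mono) auto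
      then show ?thesis using \<rho> by simp
    qed
    moreover have "\<kappa>\<^sup>2 * r \<le> (1 / 4) * (\<kappa> * r)"
      unfolding power2_eq_square mult.assoc using \<kappa> \<kappa>_small rpos by (intro mult_right_mono) auto
    ultimately show ?thesis by simp
  qed
  have w\<rho>: "4 * \<rho> \<le> t * w\<^sup>2"
  proof -
    have "t * w\<^sup>2 = 16 * \<tau>\<^sup>2 / t" using t by (simp add: w_def power_divide power_mult_distrib power2_eq_square)
    also have "\<dots> = 192 * \<rho> / (\<kappa> * \<kappa> ^ B)" using rpos \<kappa> by (simp add: \<tau>2 t_def)
    also have "\<dots> \<ge> 192 * \<rho> / 1"
      using rpos \<kappa> \<kappa>_lt_1 by (intro divide_left_mono) (auto simp flip: power_Suc intro: power_le_one)
    finally show ?thesis using rpos by simp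
  qed
  have cellc: "\<bar>c x - c y\<bar> \<le> s" if "cell s x = cell s y" for x y
    using cell_near[OF that s] by (simp add: near_def)
  obtain x0 where x0: "x0 \<in> X" using False by blast
  have cN: "0 < \<kappa> ^ 12 * N" using \<kappa> N_pos by simp
  have "0 < real (card (G x0))" using x0 cN unfolding X_def by auto
  then obtain u0 where u0: "u0 \<in> G x0" by (metis card.empty equals0I of_nat_0 less_irrefl)
  have "0 < mY x0 u0" using u0 T by (auto simp: G_def)
  then obtain y0 where y0: "y0 \<in> Y" "tan_pair \<tau> \<rho> r x0 y0 u0"
    unfolding mY_def by (metis (mono_tags, lifting) mem_Collect_eq less_irrefl sum.not_neutral_contains_not_neutral)
  have "u0 \<in> U" using u0 by (simp add: G_def)
  then have "u0 \<in> {0..1}" using grid_subset by blast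
  then have c0: "\<kappa> * r / 6 \<le> \<bar>c x0 - c y0\<bar>" by (rule tan_pair_c[OF y0(2) _ rpos(1) small_\<tau>])
  \<comment> \<open>The cells are much smaller than the gap in \<open>c\<close>, so
    \<open>c y - c x\<close> has one sign for all \<open>x\<close> in \<open>X\<close> and
    \<open>y\<close> in \<open>Y\<close>. Multiplying by it makes \<open>X\<close> touch
    \<open>Y\<close> from below.\<close>
  define e where "e = sgn (c y0 - c x0)"
  have "0 < \<kappa> * r / 6" using \<kappa> rpos by simp
  then have e: "\<bar>e\<bar> = 1" "e * (c y0 - c x0) = \<bar>c x0 - c y0\<bar>"
    using c0 by (auto simp: e_def abs_sgn_eq sgn_if)
  have s_small: "s \<le> \<kappa> * r / 24"
  proof -
    have "\<kappa>\<^sup>2 \<le> 1 / 24" using power_mono[of \<kappa> "1/6" 2] \<kappa> \<kappa>_small by (simp add: power2_eq_square)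
    then have "\<kappa> * r * \<kappa>\<^sup>2 \<le> \<kappa> * r * (1 / 24)" using \<kappa> rpos by (intro mult_left_mono) auto
    then show ?thesis by (simp add: s_def power2_eq_square power3_eq_cube mult_ac)
  qed
  have sep: "t \<le> e * c y - e * c x" if "x \<in> X" "y \<in> Y" for x y
  proof -
    have "\<bar>c x - c x0\<bar> \<le> s" "\<bar>c y - c y0\<bar> \<le> s"
      using that x0 y0 by (auto intro!: cellc simp: X_def Y_def)
    then have "\<bar>e * (c x - c x0)\<bar> \<le> s" "\<bar>e * (c y - c y0)\<bar> \<le> s" using e by (simp_all add: abs_mult)
    moreover have "e * c y - e * c x = e * (c y0 - c x0) + e * (c y - c y0) - e * (c x - c x0)"
      by (simp add: algebra_simps)
    ultimately show ?thesis using e c0 s_small unfolding t_def by linarith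
  qed
  have qe: "quad (\<lambda>i. e * a i) (\<lambda>i. e * b i) (\<lambda>i. e * c i) z u = e * F z u"
    "slope (\<lambda>i. e * b i) (\<lambda>i. e * c i) z u = e * F' z u" for z u
    by (simp_all add: quad_def slope_def algebra_simps)
  \<comment> \<open>Rescaling makes every good row sum equal to \<open>T\<close>, so that surplus
    mass does not spoil the degree bound \<open>m1\<close>; the weights stay at most 1 because
    \<open>T \<le> mY x u\<close>.\<close>
  define g where "g x y u = (if u \<in> G x \<and> tan_pair \<tau> \<rho> r x y u then T / mY x u else 0)" for x y u
  have XZ: "X \<subseteq> Z" "Y \<subseteq> Z" by (auto simp: X_def Y_def)
  then have fin: "finite X" "finite Y" using finZ finite_subset by blast+
  have mY: "0 < mY x u" "T \<le> mY x u" if "u \<in> G x" for x u using that T by (auto simp: G_def)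
  have row_eq: "(\<Sum>y\<in>Y. p y * g x y u) = (if u \<in> G x then T else 0)" for x u
  proof (cases "u \<in> G x")
    case True
    then have "(\<Sum>y\<in>Y. p y * g x y u) = (\<Sum>y\<in>Y. if tan_pair \<tau> \<rho> r x y u then p y * (T / mY x u) else 0)"
      by (intro sum.cong) (auto simp: g_def)
    also have "\<dots> = (\<Sum>y | y \<in> Y \<and> tan_pair \<tau> \<rho> r x y u. p y * (T / mY x u))"
      using fin by (simp only: sum.inter_filter)
    also have "\<dots> = mY x u * (T / mY x u)"
      by (simp only: mY_def sum_distrib_right)
    also have "\<dots> = T" using mY[OF True] by simp
    finally show ?thesis using True by simp
  qed (simp add: g_def)
  have col: "(\<Sum>x\<in>X. p x * g x y u) \<le> 2 * level n \<rho>" for y u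
  proof -
    \<comment> \<open>Tangency with \<open>y\<close> confines \<open>F x u\<close> to an interval of
      length \<open>2 * \<rho>\<close> around \<open>F y u\<close>. On either side of
      \<open>F y u\<close> the values are within \<rho> of each other, so a single slab, at level
      \<open>n\<close> by the choice of \<open>G\<close>, bounds each half.\<close>
    define S1 where "S1 = {x \<in> X. u \<in> G x \<and> tan_pair \<tau> \<rho> r x y u \<and> F x u \<le> F y u}"
    define S2 where "S2 = {x \<in> X. u \<in> G x \<and> tan_pair \<tau> \<rho> r x y u \<and> F y u < F x u}"
    have half: "(\<Sum>x\<in>S. p x) \<le> level n \<rho>"
      if S: "S \<subseteq> {x \<in> X. u \<in> G x}" "\<And>x x'. x \<in> S \<Longrightarrow> x' \<in> S \<Longrightarrow> \<bar>F x u - F x' u\<bar> \<le> \<rho>" for S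
    proof (cases "S = {}")
      case False
      then obtain x1 where x1: "x1 \<in> S" by blast
      have "near x1 x (\<kappa> * r)" if "x \<in> S" for x
      proof (rule near_mono[OF cell_near[OF _ s]])
        show "cell s x1 = cell s x" using that x1 S(1) by (auto simp: X_def)
        show "s \<le> \<kappa> * r" using s_small mult_pos_pos[OF \<kappa> rpos(1)] by linarith
      qed
      then have "(\<Sum>x\<in>S. p x) \<le> slab \<rho> (\<kappa> * r) x1 u"
        unfolding slab_def using x1 S XZ finZ pZ by (intro sum_mono2) auto
      also have "\<dots> \<le> level n \<rho>" using x1 S by (auto simp: G_def)
      finally show ?thesis .
    qed (use M in simp)
    have "(\<Sum>x\<in>X. p x * g x y u) \<le> (\<Sum>x\<in>X. if u \<in> G x \<and> tan_pair \<tau> \<rho> r x y u then p x else 0)"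
    proof (intro sum_mono)
      fix x assume x: "x \<in> X"
      show "p x * g x y u \<le> (if u \<in> G x \<and> tan_pair \<tau> \<rho> r x y u then p x else 0)"
      proof (cases "u \<in> G x \<and> tan_pair \<tau> \<rho> r x y u")
        case True
        then have "T / mY x u \<le> 1" using mY by simp
        then have "p x * (T / mY x u) \<le> p x * 1" using x XZ pZ by (intro mult_left_mono) auto
        then show ?thesis using True by (simp add: g_def)
      qed (auto simp: g_def)
    qed
    also have "\<dots> = (\<Sum>x | x \<in> X \<and> (u \<in> G x \<and> tan_pair \<tau> \<rho> r x y u). p x)"
      using fin by (simp add: sum.inter_filter)
    also have "{x. x \<in> X \<and> (u \<in> G x \<and> tan_pair \<tau> \<rho> r x y u)} = S1 \<union> S2"
      by (auto simp: S1_def S2_def)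
    also have "(\<Sum>x\<in>S1 \<union> S2. p x) = (\<Sum>x\<in>S1. p x) + (\<Sum>x\<in>S2. p x)"
      using fin by (intro sum.union_disjoint) (auto simp: S1_def S2_def)
    also have "\<dots> \<le> level n \<rho> + level n \<rho>"
    proof (intro add_mono half)
      fix x x' assume "x \<in> S1" "x' \<in> S1"
      then show "\<bar>F x u - F x' u\<bar> \<le> \<rho>" unfolding S1_def tan_pair_def by (auto simp: abs_le_iff)
    next
      fix x x' assume "x \<in> S2" "x' \<in> S2"
      then show "\<bar>F x u - F x' u\<bar> \<le> \<rho>" unfolding S2_def tan_pair_def by (auto simp: abs_le_iff)
    qed (auto simp: S1_def S2_def)
    finally show ?thesis by simp
  qed
  interpret touch_graph X Y U p p g "\<lambda>i. e * a i" "\<lambda>i. e * b i" "\<lambda>i. e * c i" "\<lambda>i. e * a i" "\<lambda>i. e * b i" "\<lambda>i. e * c i"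
    \<rho> t w s "3 * w * N" T "2 * level n \<rho>"
  proof (unfold_locales, goal_cases)
    case (6 x y u)
    then show ?case using mY[of u x] T by (auto simp: g_def)
  next
    case (7 x y u)
    then have uG: "u \<in> G x" "tan_pair \<tau> \<rho> r x y u" by (auto simp: g_def split: if_splits)
    show ?case unfolding w_def
    proof (rule touch_quadI)
      show "\<bar>quad (\<lambda>i. e * a i) (\<lambda>i. e * b i) (\<lambda>i. e * c i) y u - quad (\<lambda>i. e * a i) (\<lambda>i. e * b i) (\<lambda>i. e * c i) x u\<bar> \<le> \<rho>"
        using uG e unfolding qe right_diff_distrib[symmetric] abs_mult by (simp add: tan_pair_def abs_minus_commute)
      show "\<bar>slope (\<lambda>i. e * b i) (\<lambda>i. e * c i) y u - slope (\<lambda>i. e * b i) (\<lambda>i. e * c i) x u\<bar> \<le> \<tau>"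
        using uG e unfolding qe right_diff_distrib[symmetric] abs_mult by (simp add: tan_pair_def abs_minus_commute)
      show "t \<le> e * c y - e * c x" using 7 sep by blast
      show "4 * \<rho> \<le> t * (4 * \<tau> / t)\<^sup>2" using w\<rho> by (simp add: w_def)
    qed (rule t)
  next
    case (8 x y u)
    then show ?case using mY[of u x] by (auto simp: g_def)
  next
    case (9 x1 x2)
    then have "\<bar>c x1 - c x2\<bar> \<le> s" by (intro cellc) (auto simp: X_def)
    then show ?case using e by (simp add: abs_mult flip: right_diff_distrib)
  next
    case (10 x1 x2)
    then have "\<bar>c x1 - c x2\<bar> \<le> s" by (intro cellc) (auto simp: Y_def)
    then show ?case using e by (simp add: abs_mult flip: right_diff_distrib)
  next
    case (14 x u)
    then show ?case using T by (simp add: row_eq)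
  next
    case (16 u)
    have "1 \<le> w * N"
    proof -
      have "\<rho>\<^sup>2 \<le> \<tau>\<^sup>2"
      proof -
        have "\<rho>\<^sup>2 \<le> \<rho> * r" unfolding power2_eq_square using rpos \<rho>r by simp
        also have "\<dots> \<le> \<rho> * r / \<kappa> ^ B"
          using rpos \<kappa> \<kappa>_lt_1 by (simp add: le_divide_eq mult_left_le power_le_one)
        finally show ?thesis by (simp add: \<tau>2)
      qed
      then have "\<rho> \<le> \<tau>" using \<tau> by (intro power2_le_imp_le[of \<rho> \<tau>]) auto
      also have "\<tau> \<le> w"
      proof -
        have "t \<le> 4" using \<kappa>_lt_1 \<kappa> r mult_mono[of \<kappa> 1 r 1] rpos by (simp add: t_def)
        then show ?thesis using t \<tau> by (simp add: w_def field_simps)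
      qed
      finally have "\<delta> \<le> w" using \<rho> by simp
      then have "N * \<delta> \<le> N * w" by (intro mult_left_mono) auto
      then show ?thesis using \<delta> by (simp add: mult.commute)
    qed
    then show ?case using card_grid_ball[of w N u] w by (simp add: mult_ac)
  qed (use fin XZ pZ t w w\<rho> T M col in auto)
  have edge_ge: "(\<Sum>x\<in>X. p x) * (\<kappa> ^ 12 * N * T) \<le> edge_sum"
  proof -
    have "edge_sum = (\<Sum>x\<in>X. p x * (\<Sum>u\<in>U. \<Sum>y\<in>Y. p y * g x y u))"
      unfolding edge_sum_def by (subst (2) sum.swap) (simp add: sum_distrib_left mult.assoc)
    also have "\<dots> = (\<Sum>x\<in>X. p x * (real (card (G x)) * T))"
    proof (intro sum.cong refl arg_cong2[of _ _ _ _ "(*)"])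
      fix x assume "x \<in> X"
      have "G x \<subseteq> U" by (auto simp: G_def)
      then show "(\<Sum>u\<in>U. \<Sum>y\<in>Y. p y * g x y u) = real (card (G x)) * T"
        unfolding row_eq by (simp add: sum.If_cases Int_absorb1)
    qed
    also have "\<dots> \<ge> (\<Sum>x\<in>X. p x * (\<kappa> ^ 12 * N * T))"
      by (intro sum_mono mult_left_mono mult_right_mono) (use T XZ pZ in \<open>auto simp: X_def\<close>)
    finally show ?thesis by (simp add: sum_distrib_right)
  qed
  \<comment> \<open>The contraction factor is \<open>48 * \<kappa>\<^sup>2 \<le> \<kappa>\<close>.
    Since \<open>\<kappa> ^ (n + 1) \<le> \<rho> / r\<close> and \<open>w\<^sup>2\<close> is larger
    than \<open>\<rho> / r\<close>, \<open>n + 1\<close> steps lead below \<open>w\<close>.\<close>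
  have "(4 * s / t) ^ (n + 1) < w"
  proof -
    have "4 * s / t = 48 * \<kappa> * \<kappa>" using rpos \<kappa> by (simp add: s_def t_def power3_eq_cube)
    also have "\<dots> \<le> 1 * \<kappa>" using \<kappa> \<kappa>_small by (intro mult_right_mono) auto
    finally have "(4 * s / t) ^ (n + 1) \<le> \<kappa> ^ (n + 1)" using s t by (intro power_mono) auto
    also have "\<dots> < w"
    proof (rule power2_less_imp_less)
      have "(\<kappa> ^ (n + 1))\<^sup>2 \<le> \<kappa> ^ (n + 1)"
        unfolding power2_eq_square using \<kappa> power_le_one[of \<kappa> "n + 1"] \<kappa>_lt_1
        by (intro mult_left_le) auto
      also have "\<dots> \<le> \<rho> / r" using \<rho> rpos by (simp add: field_simps)
      also have "\<dots> < 2304 * (\<rho> / r) / (\<kappa> ^ (B + 2))"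
      proof -
        have "\<kappa> ^ (B + 2) < 2304" using power_le_one[of \<kappa> "B + 2"] \<kappa> \<kappa>_lt_1 by simp
        then have "\<rho> / r * \<kappa> ^ (B + 2) < \<rho> / r * 2304" using rpos by (intro mult_strict_left_mono) auto
        moreover have "0 < \<kappa> ^ (B + 2)" using \<kappa> by simp
        ultimately show ?thesis by (simp only: pos_less_divide_eq mult.commute[of 2304])
      qed
      also have "\<dots> = w\<^sup>2"
        using rpos \<kappa> by (simp add: w_def t_def \<tau>2 power_divide power_mult_distrib power_add power2_eq_square[of \<kappa>] power2_eq_square[of r])
      finally show "(\<kappa> ^ (n + 1))\<^sup>2 < w\<^sup>2" .
    qed (use w in simp)
    finally show ?thesis .
  qed
  from edge_sum_bound[OF grid_subset this]
  have main: "edge_sum ^ 3 \<le> (\<Sum>x\<in>X. p x)\<^sup>2 * ((\<Sum>y\<in>Y. p y)\<^sup>2 * (9 * 2 ^ (n + 1) * ((3 * w * N)\<^sup>2 * N * T * (2 * level n \<rho>))))"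
    by (simp add: card_grid mult.assoc)
  have Y0: "0 \<le> (\<Sum>y\<in>Y. p y)" using XZ pZ by (intro sum_nonneg) auto
  have Yle: "(\<Sum>y\<in>Y. p y) \<le> A * r powr \<sigma>"
  proof -
    have "(\<Sum>y\<in>Y. p y) \<le> (\<Sum>z' | z' \<in> Z \<and> near y0 z' r. p z')"
    proof (rule sum_mono2)
      have "near y0 y r" if "y \<in> Y" for y
      proof (rule near_mono[OF cell_near[OF _ s]])
        show "cell s y0 = cell s y" using that y0 by (auto simp: Y_def)
        have "\<kappa> * r / 24 \<le> r" using \<kappa>_lt_1 rpos by simp
        then show "s \<le> r" using s_small by simp
      qed
      then show "Y \<subseteq> {z' \<in> Z. near y0 z' r}" using XZ by auto
    qed (use finZ pZ in auto)
    also have "\<dots> \<le> A * r powr \<sigma>" using frostman[of y0 r] y0 XZ r by (auto simp: near_def)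
    finally show ?thesis .
  qed
  define D0 where "D0 = 9 * 2 ^ (n + 1) * ((3 * w * N)\<^sup>2 * N * T * (2 * level n \<rho>))"
  have D0: "0 \<le> D0" using T M by (simp add: D0_def)
  show ?thesis
  proof (rule cube_le_imp_le[OF main edge_ge, folded D0_def])
    show "0 \<le> (\<Sum>x\<in>X. p x)" using XZ pZ by (intro sum_nonneg) auto
    show "0 < \<kappa> ^ 12 * N * T" using cN T by simp
    have "(\<Sum>y\<in>Y. p y) * D0 \<le> A * r powr \<sigma> * D0" using Yle D0 by (intro mult_right_mono)
    also have "\<dots> \<le> (\<kappa> ^ 12 * N * T) ^ 3 * \<kappa> ^ 12"
      using tan_numerics[OF n rpos \<rho>r] unfolding D0_def w_def t_def \<tau>_def T_def by simp
    finally have "(\<Sum>y\<in>Y. p y) * ((\<Sum>y\<in>Y. p y) * D0) \<le> (\<Sum>y\<in>Y. p y) * ((\<kappa> ^ 12 * N * T) ^ 3 * \<kappa> ^ 12)"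
      using Y0 by (intro mult_left_mono)
    then show "(\<Sum>y\<in>Y. p y)\<^sup>2 * D0 \<le> (\<kappa> ^ 12 * N * T) ^ 3 * (\<kappa> ^ 12 * (\<Sum>y\<in>Y. p y))"
      by (simp only: power2_eq_square mult_ac)
    show "0 \<le> \<kappa> ^ 12 * (\<Sum>y\<in>Y. p y)" using Y0 \<kappa> by simp
  qed
qed

end

lemma sum_Un_le:
  fixes f :: "'a \<Rightarrow> real"
  assumes "finite S" "finite T" "\<And>x. x \<in> S \<Longrightarrow> 0 \<le> f x"
  shows "sum f (S \<union> T) \<le> sum f S + sum f T"
proof -
  have "0 \<le> sum f (S \<inter> T)" using assms by (intro sum_nonneg) auto
  then show ?thesis using assms by (simp add: sum_Un)
qed

lemma sum_UN_le:
  fixes f :: "'a \<Rightarrow> real"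
  assumes "finite L" "\<And>l. l \<in> L \<Longrightarrow> finite (S l)" "\<And>l x. l \<in> L \<Longrightarrow> x \<in> S l \<Longrightarrow> 0 \<le> f x"
  shows "sum f (\<Union>l\<in>L. S l) \<le> (\<Sum>l\<in>L. sum f (S l))"
  using assms
proof (induction L rule: finite_induct)
  case (insert l L)
  have "sum f (\<Union>l\<in>insert l L. S l) \<le> sum f (S l) + sum f (\<Union>l\<in>L. S l)"
    unfolding UN_insert using insert by (intro sum_Un_le) auto
  also have "sum f (\<Union>l\<in>L. S l) \<le> (\<Sum>l\<in>L. sum f (S l))"
    using insert by (intro insert.IH) auto
  finally show ?case using insert by simp
qed simp

section \<open>Summation over adjacent cells\<close>

context frostman_quads
begin

definition adj :: "int \<times> int \<times> int \<Rightarrow> (int \<times> int \<times> int) set" where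
  "adj = (\<lambda>(i, j, k). let L = \<lfloor>1 / \<kappa> ^ 3\<rfloor> + 1 in {i - L..i + L} \<times> {j - L..j + L} \<times> {k - L..k + L})"

lemma adj_sym: "k \<in> adj k' \<longleftrightarrow> k' \<in> adj k"
  by (cases k; cases k') (auto simp: adj_def Let_def)

lemma finite_adj [simp]: "finite (adj k)"
  by (cases k) (auto simp: adj_def Let_def)

text \<open>There are at most \<open>(5 / \<kappa> ^ 3) ^ 3\<close> such cells, and the tenth power
  of \<kappa> absorbs the constant 125.\<close>

lemma card_adj: "real (card (adj k)) \<le> 1 / \<kappa> ^ 10"
proof -
  define L where "L = \<lfloor>1 / \<kappa> ^ 3\<rfloor> + 1"
  have one: "1 \<le> 1 / \<kappa> ^ 3" using \<kappa> \<kappa>_lt_1 by (simp add: power_le_one)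
  then have L: "0 \<le> L" unfolding L_def by linarith
  obtain i j l where k: "k = (i, j, l)" by (cases k)
  have "adj k = {i - L..i + L} \<times> {j - L..j + L} \<times> {l - L..l + L}"
    by (simp add: k adj_def L_def Let_def)
  then have "real (card (adj k)) = real (nat (2 * L + 1)) ^ 3"
    using L by (simp add: card_cartesian_product power3_eq_cube algebra_simps)
  also have "real (nat (2 * L + 1)) = 2 * real_of_int L + 1" using L by simp
  also have "(2 * real_of_int L + 1) ^ 3 \<le> (5 / \<kappa> ^ 3) ^ 3"
  proof (rule power_mono)
    have "real_of_int L \<le> 1 / \<kappa> ^ 3 + 1" by (simp add: L_def)
    then show "2 * real_of_int L + 1 \<le> 5 / \<kappa> ^ 3" using one by simp
  qed (use L in simp)
  also have "\<dots> = 125 / \<kappa> ^ 9" by (simp add: power_divide flip: power_mult)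
  also have "\<dots> = 125 * \<kappa> / \<kappa> ^ 10" using \<kappa> by (simp add: eval_nat_numeral)
  also have "\<dots> \<le> 1 / \<kappa> ^ 10" using \<kappa> \<kappa>_small by (intro divide_right_mono) auto
  finally show ?thesis .
qed

lemma near_adj:
  assumes "near z z' r" "0 < r"
  shows "cell (\<kappa> ^ 3 * r) z' \<in> adj (cell (\<kappa> ^ 3 * r) z)"
proof -
  have *: "\<lfloor>y / (\<kappa> ^ 3 * r)\<rfloor> \<in> {\<lfloor>x / (\<kappa> ^ 3 * r)\<rfloor> - (\<lfloor>1 / \<kappa> ^ 3\<rfloor> + 1)..\<lfloor>x / (\<kappa> ^ 3 * r)\<rfloor> + (\<lfloor>1 / \<kappa> ^ 3\<rfloor> + 1)}"
    if "\<bar>x - y\<bar> \<le> r" for x y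
  proof -
    define s where "s = \<kappa> ^ 3 * r"
    have s: "0 < s" using \<kappa> assms by (simp add: s_def)
    have "\<bar>x / s - y / s\<bar> = \<bar>x - y\<bar> / s" using s by (simp add: diff_divide_distrib[symmetric])
    also have "\<dots> \<le> r / s" using that s by (intro divide_right_mono) auto
    also have "r / s = 1 / \<kappa> ^ 3" using assms by (simp add: s_def)
    finally have "\<bar>x / s - y / s\<bar> \<le> 1 / \<kappa> ^ 3" .
    then have "\<bar>\<lfloor>x / s\<rfloor> - \<lfloor>y / s\<rfloor>\<bar> \<le> \<lfloor>1 / \<kappa> ^ 3\<rfloor> + 1" by linarith
    then show ?thesis by (auto simp: s_def)
  qed
  show ?thesis
    using assms(1) * unfolding near_def adj_def cell_def Let_def by (simp only: mem_Times_iff fst_conv snd_conv prod.case)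
qed

text \<open>By pigeonhole some cell adjacent to that of \<open>z\<close> carries at least the
  fraction \<open>\<kappa> ^ 10\<close> of the tangential mass. For a given adjacent cell, either
  this happens at fewer than \<open>\<kappa> ^ 12 * N\<close> parameters, or \<open>z\<close>
  belongs to the set \<open>X\<close> of \<open>tan_cell_bound\<close>, whose mass is at most
  \<open>\<kappa> ^ 12\<close> times that of the cell. With at most \<open>1 / \<kappa> ^ 10\<close>
  adjacent cells, each alternative costs \<open>\<kappa>\<^sup>2 * N\<close>.\<close>

lemma tan_bad_mass:
  assumes n: "n < I" and r: "\<delta> \<le> r" "r \<le> 1" and \<rho>: "\<delta> \<le> \<rho>" "\<kappa> ^ (n + 1) * r \<le> \<rho>" "\<rho> < \<kappa> ^ (B + 4) * r"
  defines "\<tau> \<equiv> sqrt (\<rho> * r / \<kappa> ^ B)"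
  shows "bad_mass (\<lambda>z u. slab \<rho> (\<kappa> * r) z u \<le> level n \<rho> \<and>
      \<rho> powr \<sigma> / (2 * \<kappa> ^ (B + 71)) < (\<Sum>z' | z' \<in> Z \<and> tan_pair \<tau> \<rho> r z z' u. p z'))
    \<le> 2 * \<kappa>\<^sup>2 * real N"
proof -
  have pos: "0 < r" "0 < \<rho>" using r \<rho> \<delta> by linarith+
  define s where "s = \<kappa> ^ 3 * r"
  define thr where "thr = \<rho> powr \<sigma> / (2 * \<kappa> ^ (B + 71))"
  define T where "T = \<kappa> ^ 10 * thr"
  have thr: "0 < thr" using pos \<kappa> by (simp add: thr_def)
  have T: "0 < T" using thr \<kappa> by (simp add: T_def)
  define Y where "Y k = {y \<in> Z. cell s y = k}" for k
  define mY where "mY k x u = (\<Sum>y | y \<in> Y k \<and> tan_pair \<tau> \<rho> r x y u. p y)" for k x u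
  define G where "G k x = {u \<in> U. slab \<rho> (\<kappa> * r) x u \<le> level n \<rho> \<and> T \<le> mY k x u}" for k x
  define X where "X k1 k = {x \<in> Z. cell s x = k1 \<and> \<kappa> ^ 12 * N \<le> card (G k x)}" for k1 k
  have X: "(\<Sum>x\<in>X k1 k. p x) \<le> \<kappa> ^ 12 * (\<Sum>y\<in>Y k. p y)" for k1 k
    using tan_cell_bound[OF n r \<rho>, of k1 k]
    unfolding X_def Y_def G_def mY_def T_def thr_def s_def \<tau>_def by simp
  have cover: "\<exists>k\<in>adj (cell s z). u \<in> G k z"
    if z: "z \<in> Z" "u \<in> U" and bad: "slab \<rho> (\<kappa> * r) z u \<le> level n \<rho>"
      "thr < (\<Sum>z' | z' \<in> Z \<and> tan_pair \<tau> \<rho> r z z' u. p z')" for z u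
  proof (rule ccontr)
    assume "\<not> ?thesis"
    then have small: "mY k z u \<le> T" if "k \<in> adj (cell s z)" for k
      using that z bad by (force simp: G_def)
    let ?S = "{z'. z' \<in> Z \<and> tan_pair \<tau> \<rho> r z z' u}"
    have "(\<Sum>z'\<in>?S. p z') = (\<Sum>k\<in>adj (cell s z). \<Sum>z' | z' \<in> ?S \<and> cell s z' = k. p z')"
    proof (rule sum.group[symmetric])
      show "cell s ` ?S \<subseteq> adj (cell s z)"
        using near_adj[OF _ pos(1)] by (auto simp: s_def tan_pair_def)
    qed (use finZ in auto)
    also have "\<dots> = (\<Sum>k\<in>adj (cell s z). mY k z u)"
      unfolding mY_def Y_def by (intro sum.cong) auto
    also have "\<dots> \<le> real (card (adj (cell s z))) * T" using small by (intro sum_bounded_above)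
    also have "\<dots> \<le> 1 / \<kappa> ^ 10 * T" using T card_adj by (intro mult_right_mono) auto
    also have "\<dots> = thr" using \<kappa> by (simp add: T_def)
    finally show False using bad by simp
  qed
  have cardG: "real (card (G k z)) \<le> \<kappa> ^ 12 * N + real N * of_bool (z \<in> X (cell s z) k)" if "z \<in> Z" for k z
  proof (cases "z \<in> X (cell s z) k")
    case True
    have "card (G k z) \<le> card U" by (intro card_mono) (auto simp: G_def)
    then have "real (card (G k z)) \<le> N" by (simp add: card_grid)
    also have "\<dots> \<le> \<kappa> ^ 12 * N + N" using \<kappa> by simp
    finally show ?thesis using True by simp
  qed (use that in \<open>simp add: X_def\<close>)
  have "bad_mass (\<lambda>z u. slab \<rho> (\<kappa> * r) z u \<le> level n \<rho> \<and>
      thr < (\<Sum>z' | z' \<in> Z \<and> tan_pair \<tau> \<rho> r z z' u. p z'))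
    \<le> (\<Sum>z\<in>Z. \<Sum>u\<in>U. p z * (\<Sum>k\<in>adj (cell s z). of_bool (u \<in> G k z)))"
    unfolding bad_mass_def
  proof (intro sum_mono mult_left_mono)
    fix z u assume z: "z \<in> Z" "u \<in> U"
    let ?bad = "slab \<rho> (\<kappa> * r) z u \<le> level n \<rho> \<and> thr < (\<Sum>z' | z' \<in> Z \<and> tan_pair \<tau> \<rho> r z z' u. p z')"
    show "of_bool ?bad \<le> (\<Sum>k\<in>adj (cell s z). of_bool (u \<in> G k z) :: real)"
    proof (cases ?bad)
      case True
      then obtain k where k: "k \<in> adj (cell s z)" "u \<in> G k z" using cover[OF z] by blast
      have "(\<Sum>k\<in>{k}. of_bool (u \<in> G k z) :: real) \<le> (\<Sum>k\<in>adj (cell s z). of_bool (u \<in> G k z))"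
        using k by (intro sum_mono2) auto
      then show ?thesis using True k by simp
    next
      case False
      then show ?thesis by (simp only: of_bool_eq) (simp add: sum_nonneg)
    qed
  qed (use p_nonneg in auto)
  also have "\<dots> = (\<Sum>z\<in>Z. \<Sum>k\<in>adj (cell s z). p z * real (card (G k z)))"
  proof (intro sum.cong refl)
    fix z assume "z \<in> Z"
    have "(\<Sum>u\<in>U. p z * (\<Sum>k\<in>adj (cell s z). of_bool (u \<in> G k z)))
        = (\<Sum>k\<in>adj (cell s z). p z * (\<Sum>u\<in>U. of_bool (u \<in> G k z)))"
      unfolding sum_distrib_left by (rule sum.swap)
    also have "\<dots> = (\<Sum>k\<in>adj (cell s z). p z * real (card (G k z)))"
    proof (intro sum.cong refl)
      fix k
      have "U \<inter> G k z = G k z" by (auto simp: G_def)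
      then show "p z * (\<Sum>u\<in>U. of_bool (u \<in> G k z)) = p z * real (card (G k z))"
        by (simp add: of_bool_def sum.If_cases)
    qed
    finally show "(\<Sum>u\<in>U. p z * (\<Sum>k\<in>adj (cell s z). of_bool (u \<in> G k z)))
        = (\<Sum>k\<in>adj (cell s z). p z * real (card (G k z)))" .
  qed
  also have "\<dots> \<le> (\<Sum>z\<in>Z. \<Sum>k\<in>adj (cell s z). p z * (\<kappa> ^ 12 * N + real N * of_bool (z \<in> X (cell s z) k)))"
    using cardG p_nonneg by (intro sum_mono mult_left_mono) auto
  also have "\<dots> = (\<Sum>z\<in>Z. p z * real (card (adj (cell s z)))) * (\<kappa> ^ 12 * N)
      + N * (\<Sum>z\<in>Z. \<Sum>k\<in>adj (cell s z). p z * of_bool (z \<in> X (cell s z) k))"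
  proof -
    have "(\<Sum>z\<in>Z. \<Sum>k\<in>adj (cell s z). p z * (\<kappa> ^ 12 * N + N * h z k))
        = (\<Sum>z\<in>Z. p z * real (card (adj (cell s z)))) * (\<kappa> ^ 12 * N)
          + N * (\<Sum>z\<in>Z. \<Sum>k\<in>adj (cell s z). p z * h z k)" for h :: "'i \<Rightarrow> _ \<Rightarrow> real"
      by (simp add: distrib_left sum.distrib sum_distrib_left sum_distrib_right mult_ac)
    then show ?thesis .
  qed
  also have "\<dots> \<le> (1 / \<kappa> ^ 10) * (\<kappa> ^ 12 * N) + N * (\<kappa> ^ 12 * (1 / \<kappa> ^ 10))"
  proof (intro add_mono mult_right_mono mult_left_mono)
    have avg: "(\<Sum>z\<in>Z. p z * f z) \<le> 1 / \<kappa> ^ 10" if "\<And>z. z \<in> Z \<Longrightarrow> f z \<le> 1 / \<kappa> ^ 10" for f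
    proof -
      have "(\<Sum>z\<in>Z. p z * f z) \<le> (\<Sum>z\<in>Z. p z * (1 / \<kappa> ^ 10))"
        using that p_nonneg by (intro sum_mono mult_left_mono)
      also have "\<dots> = (\<Sum>z\<in>Z. p z) * (1 / \<kappa> ^ 10)" by (simp only: sum_distrib_right)
      also have "\<dots> \<le> 1 * (1 / \<kappa> ^ 10)" using p_sum \<kappa> by (intro mult_right_mono) auto
      finally show ?thesis by simp
    qed
    show "(\<Sum>z\<in>Z. p z * real (card (adj (cell s z)))) \<le> 1 / \<kappa> ^ 10"
      by (rule avg) (rule card_adj)
    let ?K = "cell s ` Z"
    have "(\<Sum>z\<in>Z. \<Sum>k\<in>adj (cell s z). p z * of_bool (z \<in> X (cell s z) k))
        = (\<Sum>k1\<in>?K. \<Sum>z | z \<in> Z \<and> cell s z = k1. \<Sum>k\<in>adj (cell s z). p z * of_bool (z \<in> X (cell s z) k))"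
      using finZ by (rule sum.image_gen)
    also have "\<dots> = (\<Sum>k1\<in>?K. \<Sum>k\<in>adj k1. \<Sum>z | z \<in> Z \<and> cell s z = k1. p z * of_bool (z \<in> X k1 k))"
    proof (intro sum.cong refl)
      fix k1
      have "(\<Sum>z | z \<in> Z \<and> cell s z = k1. \<Sum>k\<in>adj (cell s z). p z * of_bool (z \<in> X (cell s z) k))
          = (\<Sum>z | z \<in> Z \<and> cell s z = k1. \<Sum>k\<in>adj k1. p z * of_bool (z \<in> X k1 k))"
        by (intro sum.cong) auto
      also have "\<dots> = (\<Sum>k\<in>adj k1. \<Sum>z | z \<in> Z \<and> cell s z = k1. p z * of_bool (z \<in> X k1 k))"
        by (rule sum.swap)
      finally show "(\<Sum>z | z \<in> Z \<and> cell s z = k1. \<Sum>k\<in>adj (cell s z). p z * of_bool (z \<in> X (cell s z) k))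
          = (\<Sum>k\<in>adj k1. \<Sum>z | z \<in> Z \<and> cell s z = k1. p z * of_bool (z \<in> X k1 k))" .
    qed
    also have "\<dots> = (\<Sum>k1\<in>?K. \<Sum>k\<in>adj k1. \<Sum>z\<in>X k1 k. p z)"
    proof (rule sum.cong[OF refl], rule sum.cong[OF refl])
      fix k1 k
      have "(\<Sum>z | z \<in> Z \<and> cell s z = k1. p z * of_bool (z \<in> X k1 k))
         = (\<Sum>z | z \<in> Z \<and> cell s z = k1. if z \<in> X k1 k then p z else 0)"
        by (intro sum.cong) auto
      also have "\<dots> = (\<Sum>z | z \<in> {z \<in> Z. cell s z = k1} \<and> z \<in> X k1 k. p z)"
        by (rule sum.inter_filter[symmetric]) (use finZ in auto)
      also have "{z. z \<in> {z \<in> Z. cell s z = k1} \<and> z \<in> X k1 k} = X k1 k" by (auto simp: X_def)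
      finally show "(\<Sum>z | z \<in> Z \<and> cell s z = k1. p z * of_bool (z \<in> X k1 k)) = (\<Sum>z\<in>X k1 k. p z)" .
    qed
    also have "\<dots> \<le> (\<Sum>k1\<in>?K. \<Sum>k\<in>adj k1. \<kappa> ^ 12 * (\<Sum>y\<in>Y k. p y))"
      by (intro sum_mono X)
    also have "\<dots> = \<kappa> ^ 12 * (\<Sum>k1\<in>?K. \<Sum>k\<in>adj k1. \<Sum>y\<in>Z. p y * of_bool (cell s y = k))"
    proof -
      have "(\<Sum>y\<in>Y k. p y) = (\<Sum>y\<in>Z. p y * of_bool (cell s y = k))" for k
        unfolding Y_def sum.inter_filter[OF finZ] by (intro sum.cong) auto
      then show ?thesis by (simp only: sum_distrib_left)
    qed
    also have "(\<Sum>k1\<in>?K. \<Sum>k\<in>adj k1. \<Sum>y\<in>Z. p y * of_bool (cell s y = k))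
       = (\<Sum>y\<in>Z. \<Sum>k1\<in>?K. p y * of_bool (cell s y \<in> adj k1))"
    proof -
      have "(\<Sum>k1\<in>?K. \<Sum>k\<in>adj k1. \<Sum>y\<in>Z. p y * of_bool (cell s y = k))
         = (\<Sum>k1\<in>?K. \<Sum>y\<in>Z. \<Sum>k\<in>adj k1. p y * of_bool (cell s y = k))"
        by (intro sum.cong refl sum.swap)
      also have "\<dots> = (\<Sum>k1\<in>?K. \<Sum>y\<in>Z. p y * of_bool (cell s y \<in> adj k1))"
        by (intro sum.cong refl) (simp add: of_bool_def sum.delta' flip: sum_distrib_left)
      also have "\<dots> = (\<Sum>y\<in>Z. \<Sum>k1\<in>?K. p y * of_bool (cell s y \<in> adj k1))" by (rule sum.swap)
      finally show ?thesis .
    qed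
    \<comment> \<open>Adjacency is symmetric, so \<open>y\<close> is counted once for each occupied
      cell adjacent to its own.\<close>
    also have "\<dots> = (\<Sum>y\<in>Z. p y * real (card (?K \<inter> adj (cell s y))))"
    proof (intro sum.cong refl)
      fix y
      have "(\<Sum>k1\<in>?K. p y * of_bool (cell s y \<in> adj k1)) = p y * (\<Sum>k1\<in>?K. of_bool (k1 \<in> adj (cell s y)))"
        by (simp only: sum_distrib_left adj_sym[of "cell s y"])
      also have "(\<Sum>k1\<in>?K. of_bool (k1 \<in> adj (cell s y)) :: real) = real (card (?K \<inter> adj (cell s y)))"
        using finZ by (simp add: of_bool_def sum.If_cases)
      finally show "(\<Sum>k1\<in>?K. p y * of_bool (cell s y \<in> adj k1)) = p y * real (card (?K \<inter> adj (cell s y)))" .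
    qed
    also have "\<kappa> ^ 12 * (\<Sum>y\<in>Z. p y * real (card (?K \<inter> adj (cell s y)))) \<le> \<kappa> ^ 12 * (1 / \<kappa> ^ 10)"
    proof (intro mult_left_mono avg)
      fix y
      have "card (?K \<inter> adj (cell s y)) \<le> card (adj (cell s y))" by (intro card_mono) auto
      then show "real (card (?K \<inter> adj (cell s y))) \<le> 1 / \<kappa> ^ 10"
        using card_adj[of "cell s y"] by linarith
    qed (use \<kappa> in simp)
    finally show "(\<Sum>z\<in>Z. \<Sum>k\<in>adj (cell s z). p z * of_bool (z \<in> X (cell s z) k)) \<le> \<kappa> ^ 12 * (1 / \<kappa> ^ 10)" .
  qed (use \<kappa> in auto)
  also have "\<dots> = 2 * \<kappa>\<^sup>2 * real N" using \<kappa> by (simp add: eval_nat_numeral)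
  finally show ?thesis by (simp add: thr_def)
qed

end

text \<open>In units of \<open>\<kappa> * N\<close>: a step calls the previous bound once for the
  smaller radius and at most \<open>n + 2\<close> times for coarser slabs, and the new tangential
  and transversal losses add up to at most 2.\<close>

fun bad_mass_const :: "nat \<Rightarrow> real" where
  "bad_mass_const 0 = 0"
| "bad_mass_const (Suc n) = (real n + 3) * bad_mass_const n + 2"

lemma bad_mass_const_nonneg: "0 \<le> bad_mass_const n"
  by (induction n) auto

section \<open>The induction on scales\<close>

context frostman_quads
begin

lemma slope_diff_le: "\<bar>F' z u - F' z' u\<bar> \<le> 3 * r" if "near z z' r" "u \<in> {0..1}"
proof -
  have "F' z u - F' z' u = (b z - b z') + 2 * ((c z - c z') * u)" by (simp add: slope_def algebra_simps)
  moreover have "\<bar>(c z - c z') * u\<bar> \<le> r * 1"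
    unfolding abs_mult using that by (intro mult_mono) (auto simp: near_def)
  moreover have "\<bar>b z - b z'\<bar> \<le> r" using that by (simp add: near_def)
  ultimately show ?thesis by linarith
qed

text \<open>Each pair of the slab is close, tangential, or transversal at one of the slope scales
  \<open>3 * r * \<kappa> ^ l\<close>. The scales up to \<open>n + 1\<close> suffice because
  \<open>\<tau> \<ge> \<kappa> ^ (n + 1) * r\<close>. The value of \<tau> is such that
  \<open>\<tau>\<^sup>2 / r = \<rho> / \<kappa> ^ B\<close>: slopes above \<tau> lead to coarse
  slabs at least \<open>1 / \<kappa> ^ B\<close> times as wide.\<close>

lemma slab_split:
  assumes z: "z \<in> Z" "u \<in> U" and \<rho>: "0 < \<rho>" and r: "0 < r" and n: "\<kappa> ^ (n + 1) * r \<le> \<rho>"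
  defines "\<tau> \<equiv> sqrt (\<rho> * r / \<kappa> ^ B)"
  defines "\<beta> \<equiv> \<lambda>l. 3 * r * \<kappa> ^ l"
  shows "slab \<rho> r z u \<le> slab \<rho> (\<kappa> * r) z u + (\<Sum>z' | z' \<in> Z \<and> tan_pair \<tau> \<rho> r z z' u. p z')
    + (\<Sum>l | l \<le> n + 1 \<and> \<rho> / \<kappa> ^ B \<le> (\<beta> l)\<^sup>2 / r. \<Sum>z' | z' \<in> Z \<and> trans_pair (\<beta> l) \<rho> r z z' u. p z')"
proof -
  define L where "L = {l. l \<le> n + 1 \<and> \<rho> / \<kappa> ^ B \<le> (\<beta> l)\<^sup>2 / r}"
  have fL: "finite L" by (simp add: L_def)
  have u: "u \<in> {0..1}" using z grid_subset by blast
  have \<tau>: "0 \<le> \<tau>" "\<tau>\<^sup>2 = \<rho> * r / \<kappa> ^ B" using \<rho> r \<kappa> by (simp_all add: \<tau>_def)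
  have \<tau>_ge: "\<kappa> ^ (n + 1) * r \<le> \<tau>"
  proof (rule power2_le_imp_le)
    have "(\<kappa> ^ (n + 1) * r)\<^sup>2 = \<kappa> ^ (n + 1) * ((\<kappa> ^ (n + 1) * r) * r)" by (simp add: power2_eq_square mult_ac)
    also have "\<dots> \<le> 1 * ((\<kappa> ^ (n + 1) * r) * r)"
      using \<kappa> r power_le_one[of \<kappa> "n + 1"] \<kappa>_lt_1 by (intro mult_right_mono) auto
    also have "\<dots> \<le> \<rho> * r" using n r by simp
    also have "\<dots> \<le> \<rho> * r / \<kappa> ^ B" using \<rho> r \<kappa> \<kappa>_lt_1 by (simp add: le_divide_eq mult_left_le power_le_one)
    finally show "(\<kappa> ^ (n + 1) * r)\<^sup>2 \<le> \<tau>\<^sup>2" by (simp add: \<tau>)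
  qed (rule \<tau>)
  have cls: "\<exists>l\<in>L. trans_pair (\<beta> l) \<rho> r z z' u"
    if z': "near z z' r" "\<bar>F z u - F z' u\<bar> \<le> \<rho>" "\<tau> < \<bar>F' z u - F' z' u\<bar>" for z'
  proof -
    let ?d = "\<bar>F' z u - F' z' u\<bar>"
    have "\<exists>l\<le>n + 1. ?d \<le> \<beta> l \<and> \<beta> (Suc l) < ?d"
    proof (rule ccontr)
      assume a: "\<not> ?thesis"
      have "?d \<le> \<beta> l" if "l \<le> n + 2" for l
        using that
      proof (induction l)
        case 0
        then show ?case using slope_diff_le[OF z'(1) u] by (simp add: \<beta>_def)
      next
        case (Suc l)
        then have "l \<le> n + 1" "?d \<le> \<beta> l" by auto
        then have "\<not> \<beta> (Suc l) < ?d" using a by blast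
        then show ?case by simp
      qed
      then have "?d \<le> \<beta> (n + 2)" by simp
      also have "\<dots> = 3 * \<kappa> * (\<kappa> ^ (n + 1) * r)" by (simp add: \<beta>_def)
      also have "\<dots> \<le> 1 * (\<kappa> ^ (n + 1) * r)"
        using \<kappa> \<kappa>_small r by (intro mult_right_mono) auto
      finally show False using \<tau>_ge z'(3) by simp
    qed
    then obtain l where l: "l \<le> n + 1" "?d \<le> \<beta> l" "\<beta> (Suc l) < ?d" by blast
    have "\<tau>\<^sup>2 \<le> (\<beta> l)\<^sup>2" using l z'(3) \<tau> by (intro power_mono) auto
    then have "\<rho> / \<kappa> ^ B \<le> (\<beta> l)\<^sup>2 / r" using r by (simp add: \<tau> le_divide_eq mult.commute)
    moreover have "trans_pair (\<beta> l) \<rho> r z z' u"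
      using l z' by (simp add: trans_pair_def \<beta>_def mult_ac)
    ultimately show ?thesis using l by (auto simp: L_def)
  qed
  let ?S = "{z' \<in> Z. near z z' r \<and> \<bar>F z u - F z' u\<bar> \<le> \<rho>}"
  let ?A = "{z' \<in> Z. near z z' (\<kappa> * r) \<and> \<bar>F z u - F z' u\<bar> \<le> \<rho>}"
  let ?B = "{z' \<in> Z. tan_pair \<tau> \<rho> r z z' u}"
  let ?C = "\<Union>l\<in>L. {z' \<in> Z. trans_pair (\<beta> l) \<rho> r z z' u}"
  have fin: "finite ?A" "finite ?B" "finite ?C" using finZ by (auto simp: fL)
  have "?S \<subseteq> ?A \<union> ?B \<union> ?C"
  proof (rule subsetI, rule ccontr)
    fix z' assume z': "z' \<in> ?S" "z' \<notin> ?A \<union> ?B \<union> ?C"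
    then have "\<not> \<tau> < \<bar>F' z u - F' z' u\<bar>" using cls[of z'] by blast
    then show False using z' by (auto simp: tan_pair_def)
  qed
  then have "slab \<rho> r z u \<le> (\<Sum>z'\<in>?A \<union> ?B \<union> ?C. p z')"
    unfolding slab_def using fin p_nonneg by (intro sum_mono2) auto
  also have "\<dots> \<le> (\<Sum>z'\<in>?A \<union> ?B. p z') + (\<Sum>z'\<in>?C. p z')"
    using fin p_nonneg by (intro sum_Un_le) (auto intro: sum_nonneg)
  also have "(\<Sum>z'\<in>?A \<union> ?B. p z') \<le> (\<Sum>z'\<in>?A. p z') + (\<Sum>z'\<in>?B. p z')"
    using fin p_nonneg by (intro sum_Un_le) (auto intro: sum_nonneg)
  also have "(\<Sum>z'\<in>?C. p z') \<le> (\<Sum>l\<in>L. \<Sum>z' | z' \<in> Z \<and> trans_pair (\<beta> l) \<rho> r z z' u. p z')"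
    using finZ fL p_nonneg by (intro sum_UN_le) auto
  finally show ?thesis by (simp add: slab_def L_def)
qed

text \<open>The induction hypothesis is used both at the smaller radius \<open>\<kappa> * r\<close>
  and at the coarser widths \<open>(\<beta> l)\<^sup>2 / r\<close>, so \<rho> and \<open>r\<close>
  have to vary. Either change raises the ratio of width to radius by a factor of at least
  \<open>1 / \<kappa>\<close>, which lowers \<open>n\<close> by one.\<close>

lemma bad_mass_slab_le:
  assumes "n \<le> I" "\<delta> \<le> \<rho>" "\<delta> \<le> r" "r \<le> 1" "\<kappa> ^ n * r \<le> \<rho>"
  shows "bad_mass (\<lambda>z u. level n \<rho> < slab \<rho> r z u) \<le> bad_mass_const n * \<kappa> * N"
  using assms
proof (induction n arbitrary: \<rho> r)
  case 0
  have "0 < r" using 0 \<delta> by simp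
  then have "\<kappa> ^ (B + 4) * r \<le> r" using \<kappa> \<kappa>_lt_1 by (simp add: mult_left_le_one_le power_le_one)
  then have "\<kappa> ^ (B + 4) * r \<le> \<rho>" using 0 by simp
  then have "bad_mass (\<lambda>z u. level 0 \<rho> < slab \<rho> r z u) \<le> bad_mass (\<lambda>z u. False)"
    using 0 by (intro bad_mass_mono) (metis slab_trivial not_less)
  then show ?case by (simp add: bad_mass_def)
next
  case (Suc n)
  have pos: "0 < r" "0 < \<rho>" using Suc.prems \<delta> by linarith+
  have nI: "n < I" using Suc.prems by simp
  show ?case
  proof (cases "\<kappa> ^ (B + 4) * r \<le> \<rho>")
    case True
    then have "bad_mass (\<lambda>z u. level (Suc n) \<rho> < slab \<rho> r z u) \<le> bad_mass (\<lambda>z u. False)"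
      using Suc.prems by (intro bad_mass_mono) (metis slab_trivial not_less)
    also have "\<dots> = 0" by (simp add: bad_mass_def)
    also have "0 \<le> bad_mass_const (Suc n) * \<kappa> * N" using bad_mass_const_nonneg \<kappa> by (intro mult_nonneg_nonneg) auto
    finally show ?thesis .
  next
    case False
    define R where "R = \<rho> powr \<sigma> / \<kappa> ^ (B + 71)"
    have R: "0 < R" using pos \<kappa> by (simp add: R_def)
    define \<tau> where "\<tau> = sqrt (\<rho> * r / \<kappa> ^ B)"
    define \<beta> where "\<beta> l = 3 * r * \<kappa> ^ l" for l
    define L where "L = {l. l \<le> n + 1 \<and> \<rho> / \<kappa> ^ B \<le> (\<beta> l)\<^sup>2 / r}"
    have L: "finite L" "card L \<le> n + 2"
    proof -
      have "L \<subseteq> {..n + 1}" by (auto simp: L_def)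
      then show "finite L" "card L \<le> n + 2" using card_mono[of "{..n+1}" L] by (auto intro: finite_subset)
    qed
    have \<rho>_lt: "\<rho> < \<kappa> ^ (B + 4) * r" using False by simp
    have \<kappa>r: "\<kappa> ^ (n + 1) * r \<le> \<rho>" using Suc.prems by simp
    define tn where "tn z u = (\<Sum>z' | z' \<in> Z \<and> tan_pair \<tau> \<rho> r z z' u. p z')" for z u
    define tr where "tr l z u = (\<Sum>z' | z' \<in> Z \<and> trans_pair (\<beta> l) \<rho> r z z' u. p z')" for l z u
    define E0 where "E0 z u \<longleftrightarrow> level n \<rho> < slab \<rho> (\<kappa> * r) z u" for z u
    define E1 where "E1 z u \<longleftrightarrow> slab \<rho> (\<kappa> * r) z u \<le> level n \<rho> \<and> \<rho> powr \<sigma> / (2 * \<kappa> ^ (B + 71)) < tn z u" for z u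
    define E2 where "E2 l z u \<longleftrightarrow> level n ((\<beta> l)\<^sup>2 / r) < slab ((\<beta> l)\<^sup>2 / r) r z u" for l z u
    define E3 where "E3 l z u \<longleftrightarrow> slab ((\<beta> l)\<^sup>2 / r) r z u \<le> level n ((\<beta> l)\<^sup>2 / r) \<and>
      \<rho> powr \<sigma> / \<kappa> ^ (B + 71) / (2 * (real n + 2)) < tr l z u" for l z u
    have "bad_mass (\<lambda>z u. level (Suc n) \<rho> < slab \<rho> r z u)
       \<le> bad_mass (\<lambda>z u. E0 z u \<or> E1 z u \<or> (\<exists>l\<in>L. E2 l z u \<or> E3 l z u))"
    proof (rule bad_mass_mono, rule ccontr)
      fix z u assume z: "z \<in> Z" "u \<in> U" and big: "level (Suc n) \<rho> < slab \<rho> r z u"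
        and "\<not> (E0 z u \<or> E1 z u \<or> (\<exists>l\<in>L. E2 l z u \<or> E3 l z u))"
      then have 1: "slab \<rho> (\<kappa> * r) z u \<le> level n \<rho>" "tn z u \<le> R / 2"
        and 2: "\<And>l. l \<in> L \<Longrightarrow> tr l z u \<le> R / (2 * (real n + 2))"
        by (auto simp: E0_def E1_def E2_def E3_def R_def not_less not_le field_simps)
      have "(\<Sum>l\<in>L. tr l z u) \<le> real (card L) * (R / (2 * (real n + 2)))"
        by (intro sum_bounded_above 2)
      also have "\<dots> \<le> (real n + 2) * (R / (2 * (real n + 2)))"
        using L R by (intro mult_right_mono) auto
      also have "\<dots> = R / 2"
      proof -
        have "x * (R / (2 * x)) = R / 2" if "x \<noteq> 0" for x using that by simp
        from this[of "real n + 2"] show ?thesis by simp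
      qed
      finally have "(\<Sum>l\<in>L. tr l z u) \<le> R / 2" .
      with 1 slab_split[OF z pos(2,1) \<kappa>r] have "slab \<rho> r z u \<le> level n \<rho> + R / 2 + R / 2"
        unfolding tn_def tr_def L_def \<beta>_def \<tau>_def by linarith
      also have "\<dots> = level (Suc n) \<rho>"
      proof -
        have "level j \<rho> = (real j + 1) * R" for j by (simp add: level_def R_def)
        then show ?thesis by (simp add: algebra_simps)
      qed
      finally show False using big by simp
    qed
    also have "\<dots> \<le> bad_mass E0 + bad_mass (\<lambda>z u. E1 z u \<or> (\<exists>l\<in>L. E2 l z u \<or> E3 l z u))"
      by (rule bad_mass_disj)
    also have "bad_mass (\<lambda>z u. E1 z u \<or> (\<exists>l\<in>L. E2 l z u \<or> E3 l z u))
        \<le> bad_mass E1 + bad_mass (\<lambda>z u. \<exists>l\<in>L. E2 l z u \<or> E3 l z u)"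
      by (rule bad_mass_disj)
    also have "bad_mass (\<lambda>z u. \<exists>l\<in>L. E2 l z u \<or> E3 l z u) \<le> (\<Sum>l\<in>L. bad_mass (\<lambda>z u. E2 l z u \<or> E3 l z u))"
      by (rule bad_mass_Ex[OF L(1)])
    also have "\<dots> \<le> (\<Sum>l\<in>L. bad_mass (E2 l) + bad_mass (E3 l))"
      by (intro sum_mono bad_mass_disj)
    also have "bad_mass E0 \<le> bad_mass_const n * \<kappa> * N"
      unfolding E0_def
    proof (rule Suc.IH)
      have "\<kappa> ^ (B + 4) * r \<le> \<kappa> ^ 1 * r" using \<kappa> \<kappa>_lt_1 pos by (intro mult_right_mono power_decreasing) auto
      then show "\<delta> \<le> \<kappa> * r" using \<rho>_lt Suc.prems by simp
      have "\<kappa> * r \<le> r" using \<kappa>_lt_1 pos by simp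
      then show "\<kappa> * r \<le> 1" using Suc.prems by simp
      show "\<kappa> ^ n * (\<kappa> * r) \<le> \<rho>" using \<kappa>r by (simp add: mult_ac)
    qed (use Suc.prems in auto)
    also have "bad_mass E1 \<le> 2 * \<kappa>\<^sup>2 * N"
      unfolding E1_def tn_def \<tau>_def
      by (rule tan_bad_mass) (use nI Suc.prems \<kappa>r \<rho>_lt in auto)
    also have "(\<Sum>l\<in>L. bad_mass (E2 l) + bad_mass (E3 l))
        \<le> (\<Sum>l\<in>L. bad_mass_const n * \<kappa> * N + 72 * (real n + 1) * (real n + 2) * \<kappa>\<^sup>2 * N)"
    proof (intro sum_mono add_mono)
      fix l assume l: "l \<in> L"
      then have res: "\<rho> / \<kappa> ^ B \<le> (\<beta> l)\<^sup>2 / r" by (simp add: L_def)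
      have kB: "0 < \<kappa> ^ B" "\<kappa> ^ B \<le> 1" using \<kappa> \<kappa>_lt_1 by (auto simp: power_le_one)
      have "\<rho> \<le> \<rho> / \<kappa> ^ B" using kB pos by (simp add: le_divide_eq mult_left_le)
      show "bad_mass (E2 l) \<le> bad_mass_const n * \<kappa> * N"
        unfolding E2_def
      proof (rule Suc.IH)
        show "\<delta> \<le> (\<beta> l)\<^sup>2 / r" using Suc.prems \<open>\<rho> \<le> \<rho> / \<kappa> ^ B\<close> res by linarith
        have "\<kappa> ^ n * r * \<kappa> ^ B \<le> \<kappa> ^ n * r * \<kappa>" using \<kappa>_B_le pos \<kappa> by (intro mult_left_mono) auto
        also have "\<dots> \<le> \<rho>" using \<kappa>r by (simp add: mult_ac)
        finally have "\<kappa> ^ n * r \<le> \<rho> / \<kappa> ^ B" using kB by (simp add: le_divide_eq)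
        then show "\<kappa> ^ n * r \<le> (\<beta> l)\<^sup>2 / r" using res by simp
      qed (use Suc.prems in auto)
      show "bad_mass (E3 l) \<le> 72 * (real n + 1) * (real n + 2) * \<kappa>\<^sup>2 * N"
        unfolding E3_def tr_def
      proof (rule trans_bad_mass)
        show "0 < \<beta> l" using pos \<kappa> by (simp add: \<beta>_def)
        show "\<beta> l \<le> 3 * r" using pos \<kappa> \<kappa>_lt_1 by (simp add: \<beta>_def mult_left_le power_le_one)
      qed (use Suc.prems res in auto)
    qed
    also have "\<dots> = real (card L) * (bad_mass_const n * \<kappa> * N + 72 * (real n + 1) * (real n + 2) * \<kappa>\<^sup>2 * N)"
      by simp
    also have "\<dots> \<le> (real n + 2) * (bad_mass_const n * \<kappa> * N + 72 * (real n + 1) * (real n + 2) * \<kappa>\<^sup>2 * N)"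
      using L bad_mass_const_nonneg \<kappa> by (intro mult_right_mono add_nonneg_nonneg mult_nonneg_nonneg) auto
    finally have sum: "bad_mass (\<lambda>z u. level (Suc n) \<rho> < slab \<rho> r z u)
      \<le> bad_mass_const n * \<kappa> * N + (2 * \<kappa>\<^sup>2 * N +
        (real n + 2) * (bad_mass_const n * \<kappa> * N + 72 * (real n + 1) * (real n + 2) * \<kappa>\<^sup>2 * N))"
      by linarith
    have k1: "\<kappa> * (72 * ((real n + 2) * (real n + 1) * (real n + 2))) \<le> 1"
    proof (rule small')
      have "(real n + 2) * (real n + 1) * (real n + 2) \<le> (real I + 2) * (real I + 2) * (real I + 2)"
        using nI by (intro mult_mono) auto
      also have "\<dots> = (real I + 2) ^ 3" by (simp add: power3_eq_cube)
      also have "\<dots> \<le> (real I + 2) ^ 3 * 2 ^ I" by (simp add: mult_le_cancel_left1)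
      finally have "72 * ((real n + 2) * (real n + 1) * (real n + 2)) \<le> (2985984 * A) * ((real I + 2) ^ 3 * 2 ^ I)"
        by (rule mult_mono[rotated]) (use A in auto)
      then show "72 * ((real n + 2) * (real n + 1) * (real n + 2)) \<le> 2985984 * A * (real I + 2) ^ 3 * 2 ^ I"
        by (simp add: mult_ac)
    qed
    have "2 * \<kappa>\<^sup>2 * N + (real n + 2) * (72 * (real n + 1) * (real n + 2) * \<kappa>\<^sup>2 * N)
        = (2 * \<kappa> + \<kappa> * (72 * ((real n + 2) * (real n + 1) * (real n + 2)))) * (\<kappa> * N)"
      by (simp add: power2_eq_square algebra_simps)
    also have "\<dots> \<le> 2 * (\<kappa> * N)" using k1 \<kappa> \<kappa>_small by (intro mult_right_mono) auto
    finally show ?thesis using sum by (simp add: algebra_simps)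
  qed
qed

end

section \<open>Dyadic content\<close>

locale nested_cells =
  fixes cell :: "nat \<Rightarrow> 'a \<Rightarrow> 'k"
  assumes refine: "cell (Suc n) x = cell (Suc n) y \<Longrightarrow> cell n x = cell n y"
begin

definition cube :: "nat \<times> 'k \<Rightarrow> 'a set" where
  "cube Q = {x. cell (fst Q) x = snd Q}"

text \<open>The sum of the \<open>s\<close>-th powers of the side lengths
  \<open>2 powr (- n)\<close>, written as a weighted counting measure so that additivity and
  continuity along increasing families are those of a measure.\<close>

definition total :: "real \<Rightarrow> (nat \<times> 'k) set \<Rightarrow> ennreal" where
  "total s \<U> = emeasure (density (count_space UNIV) (\<lambda>Q. ennreal (2 powr (- s * real (fst Q))))) \<U>"

definition content :: "real \<Rightarrow> 'a set \<Rightarrow> ennreal" where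
  "content s E = Inf {total s \<U> | \<U>. E \<subseteq> (\<Union>Q\<in>\<U>. cube Q)}"

lemma total_mono: "\<U> \<subseteq> \<V> \<Longrightarrow> total s \<U> \<le> total s \<V>"
  unfolding total_def by (rule emeasure_mono) auto

lemma total_Un_le: "total s (\<U> \<union> \<V>) \<le> total s \<U> + total s \<V>"
  unfolding total_def by (rule emeasure_subadditive) auto

lemma total_Diff: "\<V> \<subseteq> \<U> \<Longrightarrow> total s \<U> = total s (\<U> - \<V>) + total s \<V>"
  unfolding total_def by (subst plus_emeasure) (auto intro!: arg_cong2[of _ _ _ _ emeasure])

lemma total_singleton: "total s {Q} = ennreal (2 powr (- s * real (fst Q)))"
  unfolding total_def by (subst emeasure_density) (auto simp: nn_integral_count_space_indicator[symmetric])

lemma content_le: "E \<subseteq> (\<Union>Q\<in>\<U>. cube Q) \<Longrightarrow> content s E \<le> total s \<U>"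
  unfolding content_def by (rule Inf_lower) auto

lemma content_approx:
  assumes "content s E < y"
  obtains \<U> where "E \<subseteq> (\<Union>Q\<in>\<U>. cube Q)" "total s \<U> < y"
  using assms unfolding content_def Inf_less_iff by auto

lemma content_mono: "E \<subseteq> E' \<Longrightarrow> content s E \<le> content s E'"
  unfolding content_def by (rule Inf_superset_mono) auto

lemma content_Un_le: "content s (E \<union> E') \<le> content s E + content s E'"
proof (rule ennreal_le_epsilon)
  fix e :: real assume e: "0 < e" and fin: "content s E + content s E' < top"
  have lt: "y < y + ennreal (e / 2)" if "y < top" for y
    using ennreal_add_left_cancel_less[of y 0 "ennreal (e / 2)"] e that by (simp add: less_top)
  have "content s E < content s E + ennreal (e / 2)" "content s E' < content s E' + ennreal (e / 2)"
    using fin e by (auto intro!: lt)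
  then obtain \<U> \<U>' where "E \<subseteq> (\<Union>Q\<in>\<U>. cube Q)" "total s \<U> < content s E + ennreal (e / 2)"
    "E' \<subseteq> (\<Union>Q\<in>\<U>'. cube Q)" "total s \<U>' < content s E' + ennreal (e / 2)"
    by (metis content_approx)
  moreover from this have "content s (E \<union> E') \<le> total s (\<U> \<union> \<U>')"
    by (intro content_le) auto
  ultimately have "content s (E \<union> E') \<le> (content s E + ennreal (e / 2)) + (content s E' + ennreal (e / 2))"
    using total_Un_le[of s \<U> \<U>'] by (meson add_mono less_imp_le order_trans)
  also have "\<dots> = content s E + content s E' + ennreal e"
    using e by (simp add: add_ac flip: ennreal_plus)
  finally show "content s (E \<union> E') \<le> content s E + content s E' + ennreal e" .
qed

lemma content_empty [simp]: "content s {} = 0"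
proof -
  have "content s {} \<le> total s {}" by (rule content_le) auto
  then show ?thesis by (simp add: total_def)
qed

lemma content_UN_le:
  assumes "finite L"
  shows "content s (\<Union>l\<in>L. E l) \<le> (\<Sum>l\<in>L. content s (E l))"
  using assms
proof (induction L rule: finite_induct)
  case (insert l L)
  have "content s (\<Union>l\<in>insert l L. E l) \<le> content s (E l) + content s (\<Union>l\<in>L. E l)"
    using content_Un_le by simp
  also have "\<dots> \<le> content s (E l) + (\<Sum>l\<in>L. content s (E l))" by (intro add_left_mono insert.IH)
  finally show ?case using insert by simp
qed simp

lemma content_le_cube: "E \<subseteq> cube Q \<Longrightarrow> content s E \<le> ennreal (2 powr (- s * real (fst Q)))"
  unfolding total_singleton[symmetric] by (rule content_le) auto

lemma cell_mono:
  assumes "n \<le> m" "cell m x = cell m y"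
  shows "cell n x = cell n y"
  using assms
proof (induction rule: dec_induct)
  case (step m)
  then show ?case using refine[of m x y] by blast
qed

text \<open>By nestedness a cube of no finer level that meets \<open>Q\<close> contains it. Asking
  for a common point instead of inclusion leaves empty cubes without ancestors.\<close>

definition anc :: "nat \<times> 'k \<Rightarrow> nat \<times> 'k \<Rightarrow> bool" where
  "anc R Q \<longleftrightarrow> fst R \<le> fst Q \<and> cube R \<inter> cube Q \<noteq> {}"

lemma anc_subset:
  assumes "anc R Q"
  shows "cube Q \<subseteq> cube R"
proof
  fix x assume x: "x \<in> cube Q"
  obtain z where z: "z \<in> cube R" "z \<in> cube Q" and le: "fst R \<le> fst Q" using assms by (auto simp: anc_def)
  have "cell (fst R) x = cell (fst R) z" by (rule cell_mono[OF le]) (use x z in \<open>simp add: cube_def\<close>)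
  then show "x \<in> cube R" using z by (simp add: cube_def)
qed

lemma anc_same_level: "x \<in> cube R \<Longrightarrow> x \<in> cube Q \<Longrightarrow> fst R = fst Q \<Longrightarrow> R = Q"
  by (auto simp: cube_def prod_eq_iff)

definition maxi :: "(nat \<times> 'k) set \<Rightarrow> (nat \<times> 'k) set" where
  "maxi S = {Q \<in> S. \<forall>R\<in>S. anc R Q \<longrightarrow> R = Q}"

lemma maxi_subset: "maxi S \<subseteq> S"
  by (auto simp: maxi_def)

lemma maxi_cover: "(\<Union>Q\<in>maxi S. cube Q) = (\<Union>Q\<in>S. cube Q)"
proof (intro equalityI subsetI)
  fix x assume "x \<in> (\<Union>Q\<in>S. cube Q)"
  then have ex: "\<exists>n Q. Q \<in> S \<and> x \<in> cube Q \<and> fst Q = n" by blast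
  define n where "n = (LEAST n. \<exists>Q. Q \<in> S \<and> x \<in> cube Q \<and> fst Q = n)"
  obtain Q where Q: "Q \<in> S" "x \<in> cube Q" "fst Q = n" using LeastI_ex[OF ex] n_def by blast
  have "R = Q" if R: "R \<in> S" "anc R Q" for R
  proof -
    have x: "x \<in> cube R" using anc_subset[OF R(2)] Q by blast
    then have "n \<le> fst R" unfolding n_def using R(1) by (intro Least_le) blast
    moreover have "fst R \<le> n" using R Q by (simp add: anc_def)
    ultimately show ?thesis using anc_same_level[OF x Q(2)] Q(3) by simp
  qed
  then have "Q \<in> maxi S" using Q(1) unfolding maxi_def by blast
  then show "x \<in> (\<Union>Q\<in>maxi S. cube Q)" using Q(2) by blast
qed (auto simp: maxi_def)

text \<open>
  Replacing a nearly optimal cover of a smaller set by the maximal cubes of its union with a cover of a larger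
  set only costs the error \<open>f\<close>, since the cubes of \<open>\<U>\<close> lying inside a kept cube could have been exchanged for it.
\<close>

lemma content_incseq_step:
  assumes cov: "E \<subseteq> (\<Union>Q\<in>S. cube Q)" "E \<subseteq> (\<Union>Q\<in>\<U>. cube Q)"
    and le: "total s (maxi S) \<le> content s E + f" and fin: "total s (maxi S) < top"
  shows "total s (maxi (S \<union> \<U>)) \<le> total s \<U> + f"
proof -
  define A where "A = {R \<in> maxi S. \<forall>Q\<in>\<U>. \<not> anc Q R}"
  define U' where "U' = {Q \<in> \<U>. \<exists>R\<in>A. anc R Q}"
  have A: "A \<subseteq> maxi S" and U': "U' \<subseteq> \<U>" by (auto simp: A_def U'_def)
  have "maxi (S \<union> \<U>) \<subseteq> A \<union> (\<U> - U')"
  proof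
    fix Q assume Q: "Q \<in> maxi (S \<union> \<U>)"
    then have max: "\<And>R. R \<in> S \<union> \<U> \<Longrightarrow> anc R Q \<Longrightarrow> R = Q" by (auto simp: maxi_def)
    have AS: "A \<subseteq> S" using A maxi_subset by blast
    show "Q \<in> A \<union> (\<U> - U')"
    proof (cases "Q \<in> \<U>")
      case True
      then show ?thesis using max AS by (auto simp: U'_def)
    next
      case False
      then have "Q \<in> maxi S" using Q by (auto simp: maxi_def)
      then show ?thesis using max False by (auto simp: A_def)
    qed
  qed
  then have 1: "total s (maxi (S \<union> \<U>)) \<le> total s A + total s (\<U> - U')"
    using total_mono total_Un_le order_trans by metis
  have "E \<subseteq> (\<Union>Q\<in>(maxi S - A) \<union> U'. cube Q)"
  proof
    fix x assume x: "x \<in> E"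
    then obtain R where R: "R \<in> maxi S" "x \<in> cube R" using cov(1) maxi_cover by blast
    obtain Q where Q: "Q \<in> \<U>" "x \<in> cube Q" using x cov(2) by blast
    show "x \<in> (\<Union>Q\<in>(maxi S - A) \<union> U'. cube Q)"
    proof (cases "R \<in> A")
      case True
      then have "\<not> anc Q R" using Q by (auto simp: A_def)
      then have "anc R Q" using R Q by (auto simp: anc_def)
      then have "Q \<in> U'" using True Q(1) unfolding U'_def by blast
      then show ?thesis using Q(2) by blast
    qed (use R in blast)
  qed
  then have "content s E \<le> total s (maxi S - A) + total s U'"
    using content_le total_Un_le order_trans by metis
  then have "total s (maxi S - A) + total s A \<le> total s (maxi S - A) + (total s U' + f)"
    using le total_Diff[OF A] by (metis add.assoc add_right_mono order_trans)
  moreover have "total s (maxi S - A) \<noteq> top"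
    using fin total_mono[of "maxi S - A" "maxi S" s] by (auto simp: less_top[symmetric] top_unique)
  ultimately have "total s A \<le> total s U' + f" by (simp add: ennreal_add_left_cancel_le)
  then have "total s A + total s (\<U> - U') \<le> total s U' + f + total s (\<U> - U')"
    by (intro add_right_mono)
  also have "\<dots> = total s \<U> + f" using total_Diff[OF U'] by (simp add: add_ac)
  finally show ?thesis using 1 by simp
qed

text \<open>Nearly optimal covers of the \<open>E n\<close>, with errors \<open>f n\<close> of sum
  at most \<open>e\<close>, are merged one by one. Each merged family costs at most the content of
  the current set plus the errors so far. The maximal cubes of the whole union restrict, at stage
  \<open>N\<close>, to maximal cubes of that stage, so their total is a supremum of quantities
  already bounded.\<close>

lemma content_incseq_le:
  assumes inc: "incseq E" and c: "\<And>n. content s (E n) \<le> c"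
  shows "content s (\<Union>n. E n) \<le> c"
proof (rule ennreal_le_epsilon)
  fix e :: real assume e: "0 < e" and cfin: "c < top"
  define f where "f n = e * (1 / 2) ^ Suc n" for n
  have f: "0 < f n" for n using e by (simp add: f_def)
  have "\<exists>\<U>. E n \<subseteq> (\<Union>Q\<in>\<U>. cube Q) \<and> total s \<U> \<le> content s (E n) + ennreal (f n)" for n
  proof -
    have "content s (E n) < top" using c cfin order_le_less_trans by blast
    then have "content s (E n) < content s (E n) + ennreal (f n)"
      using f[of n] ennreal_add_left_cancel_less[of "content s (E n)" 0 "ennreal (f n)"] by (simp add: less_top)
    then show ?thesis by (metis content_approx less_imp_le)
  qed
  then obtain \<U> where \<U>: "\<And>n. E n \<subseteq> (\<Union>Q\<in>\<U> n. cube Q)" "\<And>n. total s (\<U> n) \<le> content s (E n) + ennreal (f n)"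
    by metis
  define S where "S N = (\<Union>n\<le>N. \<U> n)" for N
  have sumf: "sum f {..N} \<le> e" for N
  proof -
    have "sum f {..N} = e * (1 - (1 / 2) ^ Suc N)"
      unfolding f_def by (induction N) (auto simp: field_simps)
    also have "\<dots> \<le> e * 1" using e by (intro mult_left_mono) auto
    finally show ?thesis by simp
  qed
  have sumf0: "0 \<le> sum f {..N}" for N using f by (intro sum_nonneg) (simp add: less_imp_le)
  have tot: "total s (maxi (S N)) \<le> content s (E N) + ennreal (sum f {..N})" for N
  proof (induction N)
    case 0
    have "total s (maxi (S 0)) \<le> total s (\<U> 0)" by (intro total_mono) (auto simp: S_def maxi_def)
    then show ?case using \<U>(2)[of 0] by simp
  next
    case (Suc N)
    have "S (Suc N) = S N \<union> \<U> (Suc N)" by (auto simp: S_def atMost_Suc)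
    moreover have "E N \<subseteq> E (Suc N)" using inc by (simp add: incseq_SucD)
    moreover have "E N \<subseteq> (\<Union>Q\<in>S N. cube Q)" using \<U>(1)[of N] by (auto simp: S_def)
    moreover have "content s (E N) + ennreal (sum f {..N}) < top"
      using c[of N] cfin by (auto simp: order_le_less_trans)
    then have "total s (maxi (S N)) < top" using Suc.IH by (rule order_le_less_trans[rotated])
    ultimately have "total s (maxi (S (Suc N))) \<le> total s (\<U> (Suc N)) + ennreal (sum f {..N})"
      using content_incseq_step[OF _ _ Suc.IH, of "\<U> (Suc N)"] \<U>(1)[of "Suc N"] by auto
    also have "\<dots> \<le> content s (E (Suc N)) + ennreal (f (Suc N)) + ennreal (sum f {..N})"
      using \<U>(2) by (intro add_right_mono)
    also have "\<dots> = content s (E (Suc N)) + ennreal (sum f {..Suc N})"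
      using f[of "Suc N"] sumf0[of N] by (simp add: add_ac flip: ennreal_plus)
    finally show ?case .
  qed
  define V where "V = maxi (\<Union>N. S N)"
  have "total s V = (SUP N. total s (V \<inter> S N))"
  proof -
    have "incseq S" unfolding S_def by (intro monoI UN_mono) auto
    then have "incseq (\<lambda>N. V \<inter> S N)" by (auto simp: incseq_def)
    then have "(SUP N. total s (V \<inter> S N)) = total s (\<Union>N. V \<inter> S N)"
      unfolding total_def by (intro SUP_emeasure_incseq) auto
    also have "(\<Union>N. V \<inter> S N) = V" unfolding V_def using maxi_subset by blast
    finally show ?thesis by simp
  qed
  also have "\<dots> \<le> c + ennreal e"
  proof (rule SUP_least)
    fix N
    have "V \<inter> S N \<subseteq> maxi (S N)" by (auto simp: V_def maxi_def)
    then have "total s (V \<inter> S N) \<le> total s (maxi (S N))" by (rule total_mono)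
    also have "\<dots> \<le> content s (E N) + ennreal (sum f {..N})" by (rule tot)
    also have "\<dots> \<le> c + ennreal e" using c sumf by (intro add_mono ennreal_leI)
    finally show "total s (V \<inter> S N) \<le> c + ennreal e" .
  qed
  finally have V: "total s V \<le> c + ennreal e" .
  have cov: "(\<Union>n. E n) \<subseteq> (\<Union>Q\<in>V. cube Q)"
    unfolding V_def maxi_cover using \<U>(1) by (fastforce simp: S_def)
  show "content s (\<Union>n. E n) \<le> c + ennreal e" by (rule order_trans[OF content_le[OF cov] V])
qed

end

section \<open>Dyadic cubes in three-space and Hausdorff measure\<close>

definition dyadic_cell :: "nat \<Rightarrow> real^3 \<Rightarrow> int \<times> int \<times> int" where
  "dyadic_cell n z = (\<lfloor>2 ^ n * z $ 1\<rfloor>, \<lfloor>2 ^ n * z $ 2\<rfloor>, \<lfloor>2 ^ n * z $ 3\<rfloor>)"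

definition cell_parent :: "int \<times> int \<times> int \<Rightarrow> int \<times> int \<times> int" where
  "cell_parent = (\<lambda>(i, j, k). (i div 2, j div 2, k div 2))"

lemma floor_double_div: "\<lfloor>2 * x\<rfloor> div 2 = \<lfloor>x :: real\<rfloor>"
  using floor_divide_real_eq_div[of 2 "2 * x"] by simp

lemma cell_parent: "cell_parent (dyadic_cell (Suc n) z) = dyadic_cell n z"
  by (simp add: cell_parent_def dyadic_cell_def mult.assoc floor_double_div)

interpretation dyadic: nested_cells dyadic_cell
  by unfold_locales (metis cell_parent)

lemma same_cell_component:
  assumes "dyadic_cell n x = dyadic_cell n y"
  shows "\<bar>x $ i - y $ i\<bar> \<le> 1 / 2 ^ n"
proof -
  have "\<lfloor>2 ^ n * x $ i\<rfloor> = \<lfloor>2 ^ n * y $ i\<rfloor>"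
    using exhaust_3[of i] assms by (auto simp: dyadic_cell_def)
  then have "\<bar>2 ^ n * x $ i - 2 ^ n * y $ i\<bar> < 1" by linarith
  then have "\<bar>2 ^ n * (x $ i - y $ i)\<bar> < 1" by (simp only: right_diff_distrib)
  then have "2 ^ n * \<bar>x $ i - y $ i\<bar> < 1" unfolding abs_mult by simp
  then show ?thesis by (simp add: le_divide_eq mult.commute)
qed

lemma same_cell_norm: "dyadic_cell n x = dyadic_cell n y \<Longrightarrow> norm (x - y) \<le> 3 / 2 ^ n"
  using norm_le_l1_cart[of "x - y"] same_cell_component[of n x y 1] same_cell_component[of n x y 2]
    same_cell_component[of n x y 3] by (simp add: sum_3)

lemma bounded_cube: "bounded (dyadic.cube Q)"
proof (cases "dyadic.cube Q = {}")
  case False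
  then obtain y where y: "y \<in> dyadic.cube Q" by blast
  have "dyadic.cube Q \<subseteq> cball y (3 / 2 ^ fst Q)"
    using y by (auto simp: dyadic.cube_def dist_norm intro!: same_cell_norm)
  then show ?thesis using bounded_cball bounded_subset by blast
qed simp

lemma diameter_cube: "diameter (dyadic.cube Q) \<le> 3 / 2 ^ fst Q"
  by (rule diameter_le) (auto simp: dyadic.cube_def intro!: same_cell_norm)

lemma content_zero_imp_hausdorff_zero:
  assumes s: "0 < s" and K: "dyadic.content s K = 0"
  shows "hausdorff_measure s K = 0"
proof -
  have small: "hausdorff_content \<delta> s K \<le> ennreal e" if \<delta>: "0 < \<delta>" and e: "0 < e" for \<delta> e
  proof -
    \<comment> \<open>The first entry controls the sum over the cover. The second forces every cube
      to have side below \<open>\<delta> / 3\<close>, because its own weight is already less than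
      \<open>y\<close>.\<close>
    define y where "y = min (e / 3 powr s) ((\<delta> / 3) powr s)"
    have y: "0 < y" using \<delta> e by (simp add: y_def)
    then obtain \<U> where \<U>: "K \<subseteq> (\<Union>Q\<in>\<U>. dyadic.cube Q)" "dyadic.total s \<U> < ennreal y"
      using dyadic.content_approx[of s K "ennreal y"] K by auto
    define T where "T i = {Q \<in> \<U>. to_nat Q = i}" for i
    define U where "U i = (\<Union>Q\<in>T i. dyadic.cube Q)" for i
    have U: "bounded (U i) \<and> diameter (U i) \<le> \<delta> \<and> diam_powr s (U i) \<le> ennreal (3 powr s) * dyadic.total s (T i)" for i
    proof (cases "U i = {}")
      case True
      then show ?thesis using \<delta> by (simp add: diam_powr_def)
    next
      case False
      then obtain Q where Q: "Q \<in> T i" by (auto simp: U_def)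
      then have Ti: "T i = {Q}" by (auto simp: T_def)
      have Ui: "U i = dyadic.cube Q" by (simp add: U_def Ti)
      have "dyadic.total s {Q} \<le> dyadic.total s \<U>" using Q by (intro dyadic.total_mono) (auto simp: T_def)
      then have "ennreal (2 powr (- s * real (fst Q))) \<le> dyadic.total s \<U>"
        by (simp only: dyadic.total_singleton)
      then have "ennreal (2 powr (- s * real (fst Q))) < ennreal y"
        using \<U>(2) by (rule order_le_less_trans)
      then have "2 powr (- s * real (fst Q)) < y" using y by (simp add: ennreal_less_iff)
      then have "2 powr (- s * real (fst Q)) < (\<delta> / 3) powr s" by (simp add: y_def)
      moreover have pw: "2 powr (- s * real (fst Q)) = (1 / 2 ^ fst Q) powr s"
      proof -
        have "(1 / 2 ^ fst Q :: real) = 2 powr (- real (fst Q))"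
          by (simp add: powr_minus powr_realpow divide_inverse)
        then show ?thesis by (simp add: powr_powr mult.commute)
      qed
      ultimately have "1 / 2 ^ fst Q < \<delta> / 3" using s \<delta> by (metis powr_less_mono2 less_le_not_le not_le powr_mono2 divide_nonneg_pos less_imp_le zero_less_numeral zero_le_divide_1_iff zero_le_power zero_le_numeral)
      then have d: "diameter (dyadic.cube Q) \<le> \<delta>" using diameter_cube[of Q] by simp
      have "diameter (dyadic.cube Q) powr s \<le> (3 * (1 / 2 ^ fst Q)) powr s"
        using s diameter_cube[of Q] by (intro powr_mono2) (auto intro: diameter_ge_0 bounded_cube)
      also have "\<dots> = 3 powr s * 2 powr (- s * real (fst Q))" by (simp only: powr_mult pw)
      finally have "diam_powr s (U i) \<le> ennreal (3 powr s) * dyadic.total s (T i)"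
        using False s unfolding Ti dyadic.total_singleton Ui
        by (auto simp: diam_powr_def ennreal_mult[symmetric] intro!: ennreal_leI)
      then show ?thesis using d Ui bounded_cube by simp
    qed
    have "K \<subseteq> (\<Union>i. U i)" using \<U>(1) by (fastforce simp: U_def T_def)
    then have "hausdorff_content \<delta> s K \<le> (\<Sum>i. diam_powr s (U i))"
      unfolding hausdorff_content_def by (intro Inf_lower) (use U in blast)
    also have "\<dots> \<le> (\<Sum>i. ennreal (3 powr s) * dyadic.total s (T i))" using U by (intro suminf_le) auto
    also have "\<dots> = ennreal (3 powr s) * (\<Sum>i. dyadic.total s (T i))" by (rule ennreal_suminf_cmult)
    also have "(\<Sum>i. dyadic.total s (T i)) = dyadic.total s (\<Union>i. T i)"
      unfolding dyadic.total_def by (rule suminf_emeasure) (auto simp: disjoint_family_on_def T_def)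
    also have "(\<Union>i. T i) = \<U>" by (auto simp: T_def)
    also have "ennreal (3 powr s) * dyadic.total s \<U> \<le> ennreal (3 powr s) * ennreal y"
      using \<U>(2) by (intro mult_left_mono) auto
    also have "\<dots> = ennreal (3 powr s * y)" using y by (simp add: ennreal_mult)
    also have "\<dots> \<le> ennreal e"
      by (intro ennreal_leI) (simp add: y_def field_simps min_def)
    finally show ?thesis .
  qed
  have "hausdorff_content \<delta> s K \<le> 0" if "0 < \<delta>" for \<delta>
    by (rule ennreal_le_epsilon) (use that small in simp)
  then have "(SUP \<delta>\<in>{0<..}. hausdorff_content \<delta> s K) \<le> 0" by (intro SUP_least) simp
  then show ?thesis by (simp add: hausdorff_measure_def)
qed

section \<open>Capacitability: compact subsets of analytic sets\<close>

lemma tendsto_coordinatewise_fun: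
  fixes X :: "nat \<Rightarrow> nat \<Rightarrow> 'b::topological_space"
  shows "(X \<longlongrightarrow> l) F \<longleftrightarrow> (\<forall>i. ((\<lambda>k. X k i) \<longlongrightarrow> l i) F)"
  using limitin_componentwise[of "\<lambda>_. euclidean" UNIV X l F]
  by (simp add: euclidean_product_topology)

lemma compact_bounded_sequences: "compact {x :: nat \<Rightarrow> nat. \<forall>i. x i \<le> n i}"
proof -
  have "{x :: nat \<Rightarrow> nat. \<forall>i. x i \<le> n i} = PiE UNIV (\<lambda>i. {..n i})" by (auto simp: PiE_def Pi_def)
  then show ?thesis
    using compactin_PiE[of "\<lambda>_. euclidean" UNIV "\<lambda>i. {..n i}"]
    by (auto simp: euclidean_product_topology finite_imp_compact)
qed

text \<open>Points violating the conclusion, truncated to the compact box, have a convergent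
  subsequence. Truncation leaves the first \<open>k\<close> coordinates of the \<open>k\<close>-th
  point unchanged, so the original points converge to the same limit, whose image lies in
  \<open>V\<close>.\<close>

lemma bounded_prefix_in_open:
  fixes f :: "(nat \<Rightarrow> nat) \<Rightarrow> 'b::topological_space"
  assumes f: "continuous_on UNIV f" and V: "open V" and C: "f ` {x. \<forall>i. x i \<le> n i} \<subseteq> V"
  shows "\<exists>k. f ` {x. \<forall>i<k. x i \<le> n i} \<subseteq> V"
proof (rule ccontr)
  assume "\<not> ?thesis"
  then have "\<forall>k. \<exists>x. (\<forall>i<k. x i \<le> n i) \<and> f x \<notin> V" by blast
  then obtain x where x: "\<And>k i. i < k \<Longrightarrow> x k i \<le> n i" "\<And>k. f (x k) \<notin> V" by metis
  define y where "y k i = min (x k i) (n i)" for k i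
  have "\<forall>k. y k \<in> {x. \<forall>i. x i \<le> n i}" by (simp add: y_def)
  then obtain l r where l: "l \<in> {x. \<forall>i. x i \<le> n i}" and r: "strict_mono (r :: nat \<Rightarrow> nat)"
    and lim: "(y \<circ> r) \<longlonglongrightarrow> l"
    using seq_compactE[OF compact_imp_seq_compact[OF compact_bounded_sequences[of n]]] by blast
  have "(\<lambda>k. x (r k)) \<longlonglongrightarrow> l"
    unfolding tendsto_coordinatewise_fun
  proof
    fix i
    have "(\<lambda>k. y (r k) i) \<longlonglongrightarrow> l i" using lim by (simp add: tendsto_coordinatewise_fun)
    moreover have "\<forall>\<^sub>F k in sequentially. y (r k) i = x (r k) i"
      unfolding eventually_sequentially
    proof (intro exI allI impI)
      fix k assume "Suc i \<le> k"
      then have "i < r k" using seq_suble[OF r, of k] by linarith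
      then show "y (r k) i = x (r k) i" using x(1) by (simp add: y_def min_absorb1)
    qed
    ultimately show "(\<lambda>k. x (r k) i) \<longlonglongrightarrow> l i" by (rule Lim_transform_eventually)
  qed
  then have "(\<lambda>k. f (x (r k))) \<longlonglongrightarrow> f l"
    by (rule continuous_on_tendsto_compose[OF f]) auto
  moreover have "f l \<in> V" using l C by blast
  ultimately have "\<forall>\<^sub>F k in sequentially. f (x (r k)) \<in> V" using V by (blast dest: topological_tendstoD)
  then show False using x(2) by (auto simp: eventually_sequentially)
qed

text \<open>Dyadic cubes are half-open. This open enlargement makes compactness applicable and is
  covered by 27 cubes of the same level.\<close>

definition fat_cube :: "nat \<times> int \<times> int \<times> int \<Rightarrow> (real^3) set" where
  "fat_cube = (\<lambda>(n, i, j, k). {z. i - 1 < 2 ^ n * z $ 1 \<and> 2 ^ n * z $ 1 < i + 2 \<and>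
     j - 1 < 2 ^ n * z $ 2 \<and> 2 ^ n * z $ 2 < j + 2 \<and> k - 1 < 2 ^ n * z $ 3 \<and> 2 ^ n * z $ 3 < k + 2})"

lemma open_fat_cube: "open (fat_cube Q)"
  by (cases Q) (auto simp: fat_cube_def intro!: open_Collect_conj open_Collect_less continuous_intros)

lemma cube_subset_fat_cube: "dyadic.cube Q \<subseteq> fat_cube Q"
proof -
  obtain n i j k where Q: "Q = (n, i, j, k)" by (cases Q)
  show ?thesis
    unfolding Q dyadic.cube_def fat_cube_def dyadic_cell_def prod.case fst_conv snd_conv prod.inject
    by (intro subsetI, unfold mem_Collect_eq) linarith
qed

lemma content_fat_cube: "dyadic.content s (fat_cube Q) \<le> 27 * dyadic.total s {Q}"
proof -
  obtain n i j k where Q: "Q = (n, i, j, k)" by (cases Q)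
  define L where "L = {i - 1, i, i + 1} \<times> {j - 1, j, j + 1} \<times> {k - 1, k, k + 1}"
  have sub: "fat_cube Q \<subseteq> (\<Union>l\<in>L. dyadic.cube (n, l))"
  proof
    fix z assume z: "z \<in> fat_cube Q"
    have *: "\<lfloor>x\<rfloor> \<in> {m - 1, m, m + 1}" if "real_of_int m - 1 < x" "x < real_of_int m + 2" for x m
      using that by (simp, linarith)
    have "dyadic_cell n z \<in> L"
      using z unfolding L_def Q fat_cube_def dyadic_cell_def prod.case mem_Collect_eq mem_Times_iff fst_conv snd_conv
      by (intro conjI *) auto
    then show "z \<in> (\<Union>l\<in>L. dyadic.cube (n, l))" by (auto simp: dyadic.cube_def)
  qed
  have "card L = 27" by (simp add: L_def card_cartesian_product)
  have fin: "finite L" by (simp add: L_def)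
  have "dyadic.content s (fat_cube Q) \<le> dyadic.content s (\<Union>l\<in>L. dyadic.cube (n, l))"
    by (rule dyadic.content_mono[OF sub])
  also have "\<dots> \<le> (\<Sum>l\<in>L. dyadic.content s (dyadic.cube (n, l)))"
    by (rule dyadic.content_UN_le[OF fin])
  also have "\<dots> \<le> (\<Sum>l\<in>L. dyadic.total s {Q})"
  proof (rule sum_mono)
    fix l
    show "dyadic.content s (dyadic.cube (n, l)) \<le> dyadic.total s {Q}"
      using dyadic.content_le_cube[of "dyadic.cube (n, l)" "(n, l)" s] by (simp add: dyadic.total_singleton Q)
  qed
  also have "\<dots> = 27 * dyadic.total s {Q}" using \<open>card L = 27\<close> by simp
  finally show ?thesis .
qed

text \<open>If the limit set had content zero, fattening a cover of total below
  \<open>c / 27\<close> and using compactness would give finitely many open sets containing the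
  image of some prefix set, whose content would then be at most \<open>c\<close>.\<close>

lemma content_pos_of_prefixes:
  fixes f :: "(nat \<Rightarrow> nat) \<Rightarrow> real^3"
  assumes f: "continuous_on UNIV f" and c: "0 < c" "\<And>k. c < dyadic.content s (f ` {x. \<forall>i<k. x i \<le> n i})"
  shows "0 < dyadic.content s (f ` {x. \<forall>i. x i \<le> n i})"
proof (rule ccontr)
  let ?C = "f ` {x. \<forall>i. x i \<le> n i}"
  assume "\<not> ?thesis"
  then have "dyadic.content s ?C = 0" by (simp add: not_less)
  moreover have "0 < c / 27" using c by (simp add: ennreal_zero_less_divide)
  ultimately obtain \<U> where \<U>: "?C \<subseteq> (\<Union>Q\<in>\<U>. dyadic.cube Q)" "dyadic.total s \<U> < c / 27"
    using dyadic.content_approx[of s ?C "c / 27"] by auto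
  have "compact ?C" using f by (intro compact_continuous_image[OF _ compact_bounded_sequences]) (rule continuous_on_subset, auto)
  moreover have "?C \<subseteq> (\<Union>Q\<in>\<U>. fat_cube Q)" using \<U>(1) cube_subset_fat_cube by blast
  ultimately obtain \<F> where \<F>: "\<F> \<subseteq> \<U>" "finite \<F>" "?C \<subseteq> (\<Union>Q\<in>\<F>. fat_cube Q)"
    using compactE_image[of ?C \<U> fat_cube] open_fat_cube by blast
  have "open (\<Union>Q\<in>\<F>. fat_cube Q)" using open_fat_cube by auto
  then obtain k where "f ` {x. \<forall>i<k. x i \<le> n i} \<subseteq> (\<Union>Q\<in>\<F>. fat_cube Q)"
    using bounded_prefix_in_open[OF f _ \<F>(3)] by blast
  then have "c < dyadic.content s (\<Union>Q\<in>\<F>. fat_cube Q)"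
    using c(2)[of k] dyadic.content_mono order_less_le_trans by blast
  also have "\<dots> \<le> (\<Sum>Q\<in>\<F>. dyadic.content s (fat_cube Q))" by (rule dyadic.content_UN_le[OF \<F>(2)])
  also have "\<dots> \<le> (\<Sum>Q\<in>\<F>. 27 * dyadic.total s {Q})" by (intro sum_mono content_fat_cube)
  also have "\<dots> = 27 * (\<Sum>Q\<in>\<F>. dyadic.total s {Q})" by (rule sum_distrib_left[symmetric])
  also have "(\<Sum>Q\<in>\<F>. dyadic.total s {Q}) = dyadic.total s \<F>"
    unfolding dyadic.total_def by (rule emeasure_eq_sum_singleton[symmetric]) (use \<F> in auto)
  also have "27 * dyadic.total s \<F> \<le> 27 * (c / 27)"
    using order_le_less_trans[OF dyadic.total_mono[OF \<F>(1)] \<U>(2)] by (intro mult_left_mono) auto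
  also have "\<dots> = c" by (simp add: ennreal_times_divide ennreal_mult_divide_eq mult.commute)
  finally show False by simp
qed

text \<open>The coordinates of the Baire space are bounded one at a time. As the bound for
  coordinate \<open>k\<close> grows, the images increase to the previous set, so by
  \<open>content_incseq_le\<close> some finite bound keeps the content above \<open>c\<close>. All
  bounds together cut out a compact box.\<close>

lemma analytic_compact_subset:
  assumes A: "analytic_set A" and pos: "0 < dyadic.content s A"
  obtains C where "compact C" "C \<subseteq> A" "0 < dyadic.content s C"
proof -
  have "A \<noteq> {}" using pos by auto
  then obtain f :: "(nat \<Rightarrow> nat) \<Rightarrow> real^3" where f: "continuous_on UNIV f" "A = range f"
    using A by (auto simp: analytic_set_def)
  obtain c where c: "0 < c" "c < dyadic.content s A" using pos dense by blast
  define P where "P k n \<longleftrightarrow> c < dyadic.content s (f ` {x. \<forall>i<k. x i \<le> n i})" for k and n :: "nat \<Rightarrow> nat"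
  have "\<exists>N. \<forall>k. P k (N k) \<and> (\<forall>i. i \<noteq> k \<longrightarrow> N (Suc k) i = N k i)"
  proof (rule dependent_nat_choice)
    show "\<exists>n. P 0 n" using c by (simp add: P_def f)
    fix n k assume n: "P k n"
    have "\<exists>m. P (Suc k) (n(k := m))"
    proof (rule ccontr)
      assume *: "\<not> ?thesis"
      define E where "E m = f ` {x. \<forall>i<Suc k. x i \<le> (n(k := m)) i}" for m
      have "incseq E" unfolding E_def incseq_def by (auto intro!: imageI simp: less_Suc_eq)
      moreover have "dyadic.content s (E m) \<le> c" for m using * by (auto simp: P_def E_def not_less)
      ultimately have "dyadic.content s (\<Union>m. E m) \<le> c" by (rule dyadic.content_incseq_le)
      moreover have "f ` {x. \<forall>i<k. x i \<le> n i} \<subseteq> (\<Union>m. E m)"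
        by (force simp: E_def less_Suc_eq)
      ultimately show False using n dyadic.content_mono unfolding P_def by (meson not_less order_trans)
    qed
    then obtain m where "P (Suc k) (n(k := m))" by blast
    then show "\<exists>n'. P (Suc k) n' \<and> (\<forall>i. i \<noteq> k \<longrightarrow> n' i = n i)" by (intro exI[of _ "n(k := m)"]) auto
  qed
  then obtain N where N: "\<And>k. P k (N k)" "\<And>k i. i \<noteq> k \<Longrightarrow> N (Suc k) i = N k i" by blast
  \<comment> \<open>Step \<open>k\<close> changes only coordinate \<open>k\<close>, so the
    coordinate \<open>i\<close> is final from \<open>N (Suc i)\<close> on.\<close>
  define n where "n i = N (Suc i) i" for i
  have eq: "N k i = n i" if "i < k" for i k
    using that
  proof (induction k)
    case (Suc k)
    then show ?case using N(2)[of i k] by (cases "i = k") (auto simp: n_def)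
  qed simp
  have "c < dyadic.content s (f ` {x. \<forall>i<k. x i \<le> n i})" for k
  proof -
    have "{x. \<forall>i<k. x i \<le> n i} = {x. \<forall>i<k. x i \<le> N k i}" using eq by auto
    then show ?thesis using N(1)[of k] by (simp add: P_def)
  qed
  from content_pos_of_prefixes[OF f(1) c(1) this]
  have "0 < dyadic.content s (f ` {x. \<forall>i. x i \<le> n i})" .
  moreover have "compact (f ` {x. \<forall>i. x i \<le> n i})"
    using f by (intro compact_continuous_image[OF _ compact_bounded_sequences]) (rule continuous_on_subset, auto)
  ultimately show ?thesis using that f(2) by blast
qed

section \<open>Frostman masses on dyadic cubes\<close>

type_synonym cell = "int \<times> int \<times> int"

definition cell_children :: "cell \<Rightarrow> cell set" where
  "cell_children k = {k'. cell_parent k' = k}"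

lemma cell_children_eq:
  "cell_children (i, j, k) = {2 * i, 2 * i + 1} \<times> {2 * j, 2 * j + 1} \<times> {2 * k, 2 * k + 1}"
proof -
  have *: "m div 2 = i \<longleftrightarrow> m = 2 * i \<or> m = 2 * i + 1" for m i :: int by presburger
  show ?thesis
  proof (rule set_eqI)
    fix k' :: cell
    obtain a b c where k': "k' = (a, b, c)" by (cases k')
    show "k' \<in> cell_children (i, j, k) \<longleftrightarrow> k' \<in> {2 * i, 2 * i + 1} \<times> {2 * j, 2 * j + 1} \<times> {2 * k, 2 * k + 1}"
      unfolding k' by (simp only: cell_children_def cell_parent_def prod.case mem_Collect_eq prod.inject
          mem_Times_iff fst_conv snd_conv insert_iff empty_iff simp_thms *)
  qed
qed

lemma finite_cell_children [simp]: "finite (cell_children k)"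
  by (cases k) (simp add: cell_children_eq)

text \<open>All mass lies in a single unit cell \<open>k0\<close>, so the coordinates of charged
  points differ by at most 1; \<open>\<mu>_support\<close> allows a charged cube to be represented
  by a point of \<open>E\<close>.\<close>

locale cell_measure =
  fixes \<mu> :: "nat \<Rightarrow> cell \<Rightarrow> real" and \<sigma> :: real and E :: "(real^3) set" and k0 :: cell
  assumes \<mu>_nonneg: "0 \<le> \<mu> n k"
    and \<mu>_root: "k \<noteq> k0 \<Longrightarrow> \<mu> 0 k = 0" "0 < \<mu> 0 k0"
    and \<mu>_le: "\<mu> n k \<le> 2 powr (- \<sigma> * real n)"
    and \<mu>_children: "\<mu> n k = (\<Sum>k'\<in>cell_children k. \<mu> (Suc n) k')"
    and \<mu>_support: "\<mu> n k \<noteq> 0 \<Longrightarrow> E \<inter> dyadic.cube (n, k) \<noteq> {}"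
    and \<sigma>: "0 < \<sigma>" "\<sigma> < 1"

text \<open>
  The mass of a cube is distributed among its children in proportion to the contents of their intersections with
  \<open>E\<close>. As the content is subadditive, no cube receives more than its content.
\<close>

lemma cell_measure_exists:
  assumes pos: "0 < dyadic.content \<sigma> (E \<inter> dyadic.cube (0, k0))" and \<sigma>: "0 < \<sigma>" "\<sigma> < 1"
  shows "\<exists>\<mu>. cell_measure \<mu> \<sigma> E k0"
proof -
  define M where "M n k = enn2real (dyadic.content \<sigma> (E \<inter> dyadic.cube (n, k)))" for n k
  have le: "dyadic.content \<sigma> (E \<inter> dyadic.cube (n, k)) \<le> ennreal (2 powr (- \<sigma> * real n))" for n k
    using dyadic.content_le_cube[of "E \<inter> dyadic.cube (n, k)" "(n, k)" \<sigma>] by simp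
  then have fin: "dyadic.content \<sigma> (E \<inter> dyadic.cube (n, k)) < top" for n k
    using ennreal_less_top order_le_less_trans by blast
  have M_le: "M n k \<le> 2 powr (- \<sigma> * real n)" for n k
    unfolding M_def using enn2real_mono[OF le] by simp
  have M_nonneg: "0 \<le> M n k" for n k by (simp add: M_def)
  have M_children: "M n k \<le> (\<Sum>k'\<in>cell_children k. M (Suc n) k')" for n k
  proof -
    have "E \<inter> dyadic.cube (n, k) \<subseteq> (\<Union>k'\<in>cell_children k. E \<inter> dyadic.cube (Suc n, k'))"
      by (auto simp: dyadic.cube_def cell_children_def cell_parent)
    then have "dyadic.content \<sigma> (E \<inter> dyadic.cube (n, k)) \<le>
        (\<Sum>k'\<in>cell_children k. dyadic.content \<sigma> (E \<inter> dyadic.cube (Suc n, k')))"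
      by (rule order_trans[OF dyadic.content_mono dyadic.content_UN_le]) simp
    then have "M n k \<le> enn2real (\<Sum>k'\<in>cell_children k. dyadic.content \<sigma> (E \<inter> dyadic.cube (Suc n, k')))"
      unfolding M_def using fin by (intro enn2real_mono) auto
    also have "\<dots> = (\<Sum>k'\<in>cell_children k. M (Suc n) k')"
      unfolding M_def using fin by (subst enn2real_sum) (auto simp: o_def)
    finally show ?thesis .
  qed
  define \<mu> where "\<mu> = rec_nat (\<lambda>k. if k = k0 then M 0 k0 else 0)
    (\<lambda>n m k. m (cell_parent k) * M (Suc n) k / (\<Sum>k'\<in>cell_children (cell_parent k). M (Suc n) k'))"
  have \<mu>0: "\<mu> 0 k = (if k = k0 then M 0 k0 else 0)" for k by (simp add: \<mu>_def)
  have \<mu>S: "\<mu> (Suc n) k = \<mu> n (cell_parent k) * M (Suc n) k / (\<Sum>k'\<in>cell_children (cell_parent k). M (Suc n) k')" for n k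
    by (simp add: \<mu>_def)
  have \<mu>M: "0 \<le> \<mu> n k \<and> \<mu> n k \<le> M n k" for n k
  proof (induction n arbitrary: k)
    case (Suc n)
    let ?S = "\<Sum>k'\<in>cell_children (cell_parent k). M (Suc n) k'"
    have S: "0 \<le> ?S" using M_nonneg by (intro sum_nonneg)
    have "\<mu> n (cell_parent k) \<le> ?S" using Suc[of "cell_parent k"] M_children order_trans by blast
    then have "\<mu> n (cell_parent k) / ?S \<le> 1" using S by (auto simp: divide_le_eq_1)
    then have "\<mu> n (cell_parent k) / ?S * M (Suc n) k \<le> 1 * M (Suc n) k"
      using M_nonneg by (intro mult_right_mono)
    then show ?case unfolding \<mu>S using S Suc[of "cell_parent k"] M_nonneg by simp
  qed (auto simp: \<mu>0 M_nonneg)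
  have "cell_measure \<mu> \<sigma> E k0"
  proof
    fix n k
    show "\<mu> n k \<le> 2 powr (- \<sigma> * real n)" using \<mu>M M_le order_trans by blast
    let ?S = "\<Sum>k'\<in>cell_children k. M (Suc n) k'"
    have "(\<Sum>k'\<in>cell_children k. \<mu> (Suc n) k') = (\<Sum>k'\<in>cell_children k. \<mu> n k / ?S * M (Suc n) k')"
      by (intro sum.cong) (auto simp: \<mu>S cell_children_def)
    also have "\<dots> = \<mu> n k / ?S * ?S" by (simp only: sum_distrib_left)
    also have "\<dots> = \<mu> n k"
    \<comment> \<open>If the children have no content, division by zero returns 0. This is the right
      value, since \<open>\<mu> n k \<le> M n k \<le> ?S\<close>.\<close>
    proof (cases "?S = 0")
      case True
      then show ?thesis using \<mu>M[of n k] M_children[of n k] by simp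
    qed simp
    finally show "\<mu> n k = (\<Sum>k'\<in>cell_children k. \<mu> (Suc n) k')" by simp
    show "E \<inter> dyadic.cube (n, k) \<noteq> {}" if "\<mu> n k \<noteq> 0"
    proof
      assume "E \<inter> dyadic.cube (n, k) = {}"
      then have "M n k = 0" by (simp add: M_def)
      then show False using that \<mu>M[of n k] by simp
    qed
  next
    have "M 0 k0 \<noteq> 0" using pos fin[of 0 k0] by (auto simp: M_def enn2real_eq_0_iff)
    then show "0 < \<mu> 0 k0" using M_nonneg[of 0 k0] by (simp add: \<mu>0)
  qed (use \<mu>M \<mu>0 \<sigma> in auto)
  then show ?thesis by blast
qed

section \<open>Representatives of the charged cubes and the Frostman condition\<close>

context cell_measure
begin

definition descend :: "nat \<Rightarrow> cell \<Rightarrow> cell set" where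
  "descend j l = {k. (cell_parent ^^ j) k = l}"

lemma descend_Suc: "descend (Suc j) l = (\<Union>l'\<in>descend j l. cell_children l')"
  by (auto simp: descend_def cell_children_def funpow_Suc_right simp del: funpow.simps)

lemma finite_descend [simp]: "finite (descend j l)"
proof (induction j)
  case 0
  have "descend 0 l = {l}" by (auto simp: descend_def)
  then show ?case by simp
qed (simp add: descend_Suc)

lemma sum_descend: "(\<Sum>k\<in>descend j l. \<mu> (m + j) k) = \<mu> m l"
proof (induction j)
  case 0
  have "descend 0 l = {l}" by (auto simp: descend_def)
  then show ?case by simp
next
  case (Suc j)
  have "(\<Sum>k\<in>descend (Suc j) l. \<mu> (m + Suc j) k) = (\<Sum>l'\<in>descend j l. \<Sum>k\<in>cell_children l'. \<mu> (m + Suc j) k)"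
    unfolding descend_Suc by (rule sum.UNION_disjoint, simp, simp, auto simp: cell_children_def)
  also have "\<dots> = (\<Sum>l'\<in>descend j l. \<mu> (m + j) l')" using \<mu>_children[of "m + j"] by simp
  finally show ?case using Suc by simp
qed

definition Z :: "nat \<Rightarrow> cell set" where "Z n = {k. \<mu> n k \<noteq> 0}"

lemma Z_subset: "Z n \<subseteq> descend n k0"
proof
  fix k assume k: "k \<in> Z n"
  let ?l = "(cell_parent ^^ n) k"
  have "k \<in> descend n ?l" by (simp add: descend_def)
  then have "\<mu> n k \<le> (\<Sum>k\<in>descend n ?l. \<mu> (0 + n) k)"
    using member_le_sum[of k "descend n ?l" "\<mu> n"] \<mu>_nonneg by simp
  then have "\<mu> 0 ?l \<noteq> 0" using k \<mu>_nonneg[of n k] unfolding sum_descend Z_def by auto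
  then have "?l = k0" using \<mu>_root(1) by metis
  then show "k \<in> descend n k0" by (simp add: descend_def)
qed

lemma finite_Z [simp]: "finite (Z n)"
  using Z_subset finite_descend finite_subset by blast

lemma sum_Z: "(\<Sum>k\<in>Z n. \<mu> n k) = \<mu> 0 k0"
proof -
  have "(\<Sum>k\<in>Z n. \<mu> n k) = (\<Sum>k\<in>descend n k0. \<mu> n k)"
    using Z_subset by (intro sum.mono_neutral_left) (auto simp: Z_def)
  then show ?thesis using sum_descend[where j = n and l = k0 and m = 0] by simp
qed

definition rep :: "nat \<Rightarrow> cell \<Rightarrow> real^3" where
  "rep n k = (SOME z. z \<in> E \<inter> dyadic.cube (n, k))"

lemma rep: "k \<in> Z n \<Longrightarrow> rep n k \<in> E" "k \<in> Z n \<Longrightarrow> dyadic_cell n (rep n k) = k"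
proof -
  have "rep n k \<in> E \<inter> dyadic.cube (n, k)" if "k \<in> Z n" for n k
  proof -
    have "\<exists>z. z \<in> E \<inter> dyadic.cube (n, k)" using \<mu>_support[of n k] that unfolding Z_def by blast
    from someI_ex[OF this] show ?thesis unfolding rep_def .
  qed
  then show "k \<in> Z n \<Longrightarrow> rep n k \<in> E" "k \<in> Z n \<Longrightarrow> dyadic_cell n (rep n k) = k"
    by (auto simp: dyadic.cube_def)
qed

lemma funpow_cell_parent: "(cell_parent ^^ j) (dyadic_cell (m + j) z) = dyadic_cell m z"
  by (induction j) (simp_all add: funpow_Suc_right cell_parent del: funpow.simps(2))

lemma sum_below_le:
  assumes "m \<le> n" "finite S" "\<And>k. k \<in> S \<Longrightarrow> k \<in> Z n \<and> dyadic_cell m (rep n k) = l"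
  shows "(\<Sum>k\<in>S. \<mu> n k) \<le> \<mu> m l"
proof -
  have "S \<subseteq> descend (n - m) l"
  proof
    fix k assume "k \<in> S"
    then have "dyadic_cell n (rep n k) = k" "dyadic_cell m (rep n k) = l" using assms(3) rep by auto
    then show "k \<in> descend (n - m) l"
      using funpow_cell_parent[of "n - m" m "rep n k"] assms(1) by (simp add: descend_def)
  qed
  then have "(\<Sum>k\<in>S. \<mu> n k) \<le> (\<Sum>k\<in>descend (n - m) l. \<mu> n k)"
    using \<mu>_nonneg by (intro sum_mono2) auto
  then show ?thesis using sum_descend[where j = "n - m" and l = l and m = m] assms(1) by simp
qed

lemma ancestor_in_Z:
  assumes "m \<le> n" "k \<in> Z n"
  shows "dyadic_cell m (rep n k) \<in> Z m"
proof -
  have "0 < \<mu> n k" using assms(2) \<mu>_nonneg[of n k] by (simp add: Z_def)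
  also have "\<mu> n k \<le> \<mu> m (dyadic_cell m (rep n k))"
    using sum_below_le[OF assms(1), of "{k}"] assms(2) by simp
  finally show ?thesis by (simp add: Z_def)
qed

lemma rep_root: "k \<in> Z n \<Longrightarrow> dyadic_cell 0 (rep n k) = k0"
  using ancestor_in_Z[of 0 n k] \<mu>_root(1) unfolding Z_def by blast

lemma rep_diff_le_1: "k \<in> Z n \<Longrightarrow> l \<in> Z m \<Longrightarrow> \<bar>rep n k $ i - rep m l $ i\<bar> \<le> 1"
  using same_cell_component[of 0 "rep n k" "rep m l" i] rep_root by simp

text \<open>At the finest level \<open>m \<le> n\<close> whose cells have side at least
  \<open>r\<close>, the ball meets at most 27 cells, and \<open>1 / 2 ^ m \<le> 2 * r\<close> holds
  by maximality or, for \<open>m = n\<close>, by the lower bound on \<open>r\<close>. As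
  \<open>2 powr \<sigma> \<le> 2\<close>, this gives 54.\<close>

lemma frostman_ball:
  assumes k: "k \<in> Z n" and r: "1 / 2 ^ n \<le> r" "r \<le> 1"
  shows "(\<Sum>k' | k' \<in> Z n \<and> \<bar>rep n k $ 1 - rep n k' $ 1\<bar> \<le> r \<and> \<bar>rep n k $ 2 - rep n k' $ 2\<bar> \<le> r
      \<and> \<bar>rep n k $ 3 - rep n k' $ 3\<bar> \<le> r. \<mu> n k') \<le> 54 * r powr \<sigma>"
proof -
  have r0: "0 < r" using r(1) by (meson less_le_trans zero_less_divide_1_iff zero_less_numeral zero_less_power)
  define m where "m = (GREATEST m. m \<le> n \<and> r \<le> 1 / 2 ^ m)"
  have m: "m \<le> n" "r \<le> 1 / 2 ^ m" and max: "\<And>j. j \<le> n \<Longrightarrow> r \<le> 1 / 2 ^ j \<Longrightarrow> j \<le> m"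
  proof -
    have "m \<le> n \<and> r \<le> 1 / 2 ^ m"
      unfolding m_def by (rule GreatestI_nat[of _ 0 n]) (use r in auto)
    then show "m \<le> n" "r \<le> 1 / 2 ^ m" by auto
    show "\<And>j. j \<le> n \<Longrightarrow> r \<le> 1 / 2 ^ j \<Longrightarrow> j \<le> m"
      unfolding m_def by (rule Greatest_le_nat[of _ _ n]) auto
  qed
  have "1 / 2 ^ m \<le> 2 * r"
  proof (cases "m = n")
    case False
    then have "\<not> r \<le> 1 / 2 ^ Suc m" using max[of "Suc m"] m by fastforce
    then show ?thesis by (simp add: field_simps)
  next
    case True
    show ?thesis unfolding True using r(1) r0 by linarith
  qed
  obtain i j l where kl: "dyadic_cell m (rep n k) = (i, j, l)" by (cases "dyadic_cell m (rep n k)")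
  define L where "L = {i - 1..i + 1} \<times> {j - 1..j + 1} \<times> {l - 1..l + 1}"
  have L: "finite L" "card L = 27" by (simp_all add: L_def card_cartesian_product)
  let ?S = "{k'. k' \<in> Z n \<and> \<bar>rep n k $ 1 - rep n k' $ 1\<bar> \<le> r \<and> \<bar>rep n k $ 2 - rep n k' $ 2\<bar> \<le> r
      \<and> \<bar>rep n k $ 3 - rep n k' $ 3\<bar> \<le> r}"
  have fl: "\<lfloor>2 ^ m * y\<rfloor> \<in> {\<lfloor>2 ^ m * x\<rfloor> - 1..\<lfloor>2 ^ m * x\<rfloor> + 1}" if "\<bar>x - y\<bar> \<le> r" for x y :: real
  proof -
    have "\<bar>2 ^ m * x - 2 ^ m * y\<bar> = 2 ^ m * \<bar>x - y\<bar>" by (simp add: abs_mult flip: right_diff_distrib)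
    also have "\<dots> \<le> 2 ^ m * (1 / 2 ^ m)" using that m(2) by (intro mult_left_mono) auto
    finally have "\<bar>2 ^ m * x - 2 ^ m * y\<bar> \<le> 1" by simp
    then show ?thesis unfolding atLeastAtMost_iff by linarith
  qed
  have "(\<Sum>k'\<in>?S. \<mu> n k') = (\<Sum>q\<in>L. \<Sum>k' | k' \<in> ?S \<and> dyadic_cell m (rep n k') = q. \<mu> n k')"
  proof (rule sum.group[symmetric])
    show "(\<lambda>k'. dyadic_cell m (rep n k')) ` ?S \<subseteq> L"
    proof (rule image_subsetI)
      fix k' assume "k' \<in> ?S"
      then have "\<bar>rep n k $ 1 - rep n k' $ 1\<bar> \<le> r" "\<bar>rep n k $ 2 - rep n k' $ 2\<bar> \<le> r"
        "\<bar>rep n k $ 3 - rep n k' $ 3\<bar> \<le> r" by auto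
      then show "dyadic_cell m (rep n k') \<in> L"
        using fl[of "rep n k $ 1" "rep n k' $ 1"] fl[of "rep n k $ 2" "rep n k' $ 2"] fl[of "rep n k $ 3" "rep n k' $ 3"] kl
        by (simp add: L_def dyadic_cell_def)
    qed
  qed (use L in auto)
  also have "\<dots> \<le> (\<Sum>q\<in>L. \<mu> m q)"
    by (intro sum_mono sum_below_le m) auto
  also have "\<dots> \<le> (\<Sum>q\<in>L. 2 powr (- \<sigma> * real m))" by (intro sum_mono \<mu>_le)
  also have "\<dots> = 27 * (1 / 2 ^ m) powr \<sigma>"
  proof -
    have "(1 / 2 ^ m :: real) = 2 powr (- real m)"
      by (simp add: powr_minus powr_realpow divide_inverse)
    then show ?thesis using L by (simp add: powr_powr mult.commute)
  qed
  also have "\<dots> \<le> 27 * (2 * r) powr \<sigma>"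
    using \<open>1 / 2 ^ m \<le> 2 * r\<close> \<sigma> by (intro mult_left_mono powr_mono2) auto
  also have "\<dots> = 27 * (2 powr \<sigma> * r powr \<sigma>)" by (simp add: powr_mult)
  also have "\<dots> \<le> 27 * (2 powr 1 * r powr \<sigma>)" using \<sigma> by (intro mult_left_mono mult_right_mono powr_mono) auto
  finally show ?thesis by simp
qed

end

section \<open>Dimension of the images under the parabola maps\<close>

definition parab :: "real^3 \<Rightarrow> real \<Rightarrow> real" where
  "parab z u = z $ 1 + z $ 2 * u + z $ 3 * u\<^sup>2"

text \<open>Diameters at most 1 let a small sum with some exponent \<open>s' < s\<close> pass to
  \<open>s\<close>. The summable radii \<open>\<eta> i\<close> turn the covering sets, which may be
  single points, into open balls, and compactness leaves finitely many.\<close>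

lemma compact_cover_of_hausdorff_dim_less:
  fixes S :: "real set"
  assumes dim: "hausdorff_dim S < ennreal s" and s: "0 < s" "s < 1" and S: "compact S" and \<epsilon>: "0 < \<epsilon>"
  obtains F :: "nat set" and y r :: "nat \<Rightarrow> real" where "finite F" "\<And>i. 0 < r i \<and> r i \<le> \<epsilon>"
    "S \<subseteq> (\<Union>i\<in>F. ball (y i) (r i))" "(\<Sum>i\<in>F. r i powr s) \<le> 1"
proof -
  obtain s' where s': "0 \<le> s'" "hausdorff_measure s' S = 0" "ennreal s' < ennreal s"
    using dim unfolding hausdorff_dim_def Inf_less_iff by auto
  then have s's: "s' \<le> s" using ennreal_less_iff by fastforce
  define \<delta> where "\<delta> = min 1 (\<epsilon> / 2)"
  have \<delta>: "0 < \<delta>" "\<delta> \<le> 1" "2 * \<delta> \<le> \<epsilon>" using \<epsilon> by (auto simp: \<delta>_def)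
  have "hausdorff_content \<delta> s' S \<le> hausdorff_measure s' S"
    unfolding hausdorff_measure_def by (rule SUP_upper) (use \<delta> in simp)
  then have "hausdorff_content \<delta> s' S < ennreal (1 / 8)" using s' by simp
  then obtain U where U: "S \<subseteq> (\<Union>i. U i)" "\<And>i. bounded (U i)" "\<And>i. diameter (U i) \<le> \<delta>"
    and sum: "(\<Sum>i::nat. diam_powr s' (U i)) < ennreal (1 / 8)"
    unfolding hausdorff_content_def Inf_less_iff by auto
  define \<eta> where "\<eta> i = min \<delta> ((1 / 16 * (1 / 2) ^ i) powr (1 / s))" for i :: nat
  have \<eta>: "0 < \<eta> i" "\<eta> i \<le> \<delta>" "\<eta> i powr s \<le> 1 / 16 * (1 / 2) ^ i" for i
  proof -
    show "0 < \<eta> i" "\<eta> i \<le> \<delta>" using \<delta> by (auto simp: \<eta>_def)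
    have "\<eta> i powr s \<le> ((1 / 16 * (1 / 2) ^ i) powr (1 / s)) powr s"
      using s \<open>0 < \<eta> i\<close> by (intro powr_mono2) (auto simp: \<eta>_def)
    also have "\<dots> = 1 / 16 * (1 / 2) ^ i" using s by (simp add: powr_powr)
    finally show "\<eta> i powr s \<le> 1 / 16 * (1 / 2) ^ i" .
  qed
  define y where "y i = (SOME x. x \<in> U i)" for i
  define r where "r i = 2 * max (diameter (U i)) (\<eta> i)" for i
  have diam0: "0 \<le> diameter (U i)" for i using U(2) by (rule diameter_ge_0)
  have r: "0 < r i \<and> r i \<le> \<epsilon>" for i
    using \<eta>(1,2)[of i] U(3)[of i] \<delta> by (auto simp: r_def max_def)
  have Usub: "U i \<subseteq> ball (y i) (r i)" for i
  proof
    fix x assume x: "x \<in> U i"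
    then have "y i \<in> U i" unfolding y_def by (rule someI)
    then have "dist (y i) x \<le> diameter (U i)" using x U(2) by (intro diameter_bounded_bound)
    also have "\<dots> < r i" using \<eta>(1)[of i] diam0[of i] by (auto simp: r_def max_def)
    finally show "x \<in> ball (y i) (r i)" by simp
  qed
  have cov: "S \<subseteq> (\<Union>i\<in>UNIV. ball (y i) (r i))"
  proof
    fix x assume "x \<in> S"
    then obtain i where "x \<in> U i" using U(1) by blast
    then have "x \<in> ball (y i) (r i)" using Usub[of i] by (rule rev_subsetD)
    then show "x \<in> (\<Union>i\<in>UNIV. ball (y i) (r i))" by (rule UN_I[OF UNIV_I])
  qed
  obtain F where F: "finite F" "S \<subseteq> (\<Union>i\<in>F. ball (y i) (r i))"
    by (rule compactE_image[OF S _ cov]) (rule open_ball)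
  have dp: "ennreal (diameter (U i) powr s) \<le> diam_powr s' (U i)" for i
  proof (cases "U i = {}")
    case True
    then show ?thesis using s by (simp add: diam_powr_def diameter_def)
  next
    case False
    have le1: "diameter (U i) \<le> 1" using U(3)[of i] \<delta> by simp
    show ?thesis
    proof (cases "s' = 0")
      case True
      have "diameter (U i) powr s \<le> 1 powr s" using le1 diam0 s by (intro powr_mono2) auto
      then show ?thesis using True False by (simp add: diam_powr_def)
    next
      case s0: False
      have "diameter (U i) powr s \<le> diameter (U i) powr s'" using le1 diam0 s's by (intro powr_mono') auto
      then show ?thesis using s0 False by (simp add: diam_powr_def ennreal_leI)
    qed
  qed
  have "ennreal (\<Sum>i\<in>F. diameter (U i) powr s) = (\<Sum>i\<in>F. ennreal (diameter (U i) powr s))"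
    by (rule sum_ennreal[symmetric]) simp
  also have "\<dots> \<le> (\<Sum>i\<in>F. diam_powr s' (U i))" by (intro sum_mono dp)
  also have "\<dots> \<le> (\<Sum>i. diam_powr s' (U i))" by (rule sum_le_suminf[OF summableI]) (use F in auto)
  also note sum
  finally have 1: "(\<Sum>i\<in>F. diameter (U i) powr s) \<le> 1 / 8" by (simp add: ennreal_less_iff sum_nonneg)
  have "(\<Sum>i\<in>F. \<eta> i powr s) \<le> (\<Sum>i\<in>F. 1 / 16 * (1 / 2) ^ i)" by (intro sum_mono \<eta>)
  also have "\<dots> = 1 / 16 * (\<Sum>i\<in>F. (1 / 2) ^ i)" by (simp only: sum_distrib_left)
  also have "\<dots> \<le> 1 / 16 * 2"
  proof (rule mult_left_mono)
    have "(\<Sum>i\<in>F. (1 / 2 :: real) ^ i) \<le> (\<Sum>i. (1 / 2) ^ i)"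
      by (rule sum_le_suminf) (use F in \<open>auto intro: summable_geometric\<close>)
    also have "\<dots> = 2" by (simp add: suminf_geometric)
    finally show "(\<Sum>i\<in>F. (1 / 2 :: real) ^ i) \<le> 2" .
  qed simp
  finally have 2: "(\<Sum>i\<in>F. \<eta> i powr s) \<le> 1 / 8" by simp
  have "r i powr s \<le> 2 * (diameter (U i) powr s + \<eta> i powr s)" for i
  proof -
    have "r i powr s = 2 powr s * max (diameter (U i)) (\<eta> i) powr s" by (simp add: r_def powr_mult)
    also have "\<dots> \<le> 2 powr 1 * max (diameter (U i)) (\<eta> i) powr s"
      using s by (intro mult_right_mono powr_mono) auto
    also have "max (diameter (U i)) (\<eta> i) powr s \<le> diameter (U i) powr s + \<eta> i powr s" by (auto simp: max_def)
    finally show ?thesis by simp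
  qed
  then have "(\<Sum>i\<in>F. r i powr s) \<le> (\<Sum>i\<in>F. 2 * (diameter (U i) powr s + \<eta> i powr s))" by (intro sum_mono)
  also have "\<dots> = 2 * ((\<Sum>i\<in>F. diameter (U i) powr s) + (\<Sum>i\<in>F. \<eta> i powr s))"
    by (simp add: sum.distrib sum_distrib_left)
  also have "\<dots> \<le> 1" using 1 2 by simp
  finally have "(\<Sum>i\<in>F. r i powr s) \<le> 1" .
  then show ?thesis using that F r by blast
qed

context cell_measure
begin

text \<open>The factor 16 is room for the errors made by replacing points by representatives and the
  parameter by a grid point.\<close>

definition strip :: "nat \<Rightarrow> cell \<Rightarrow> real \<Rightarrow> real" where
  "strip n k u = (\<Sum>k' | k' \<in> Z n \<and> \<bar>parab (rep n k) u - parab (rep n k') u\<bar> \<le> 16 / 2 ^ n. \<mu> n k')"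

text \<open>The \<open>level\<close> for \<open>\<kappa> = (16 / 2 ^ n) powr (1 / I)\<close>: then
  \<open>\<kappa> ^ I\<close> is the width of the strip, and \<open>I\<close> induction steps lead
  to it from radius 1.\<close>

definition strip_bound :: "nat \<Rightarrow> nat \<Rightarrow> nat \<Rightarrow> real" where
  "strip_bound I B n = (real I + 1) * (16 / 2 ^ n) powr \<sigma> / ((16 / 2 ^ n) powr (1 / I)) ^ (B + 71)"

definition bad_weight :: "nat \<Rightarrow> nat \<Rightarrow> nat \<Rightarrow> real \<Rightarrow> real" where
  "bad_weight I B n u = (\<Sum>k\<in>Z n. \<mu> n k * of_bool (strip_bound I B n < strip n k u))"

lemma sum_bad_weight:
  assumes I: "0 < I" and B: "4 \<le> B * (1 - \<sigma>)"
    and small: "(16 / 2 ^ n) powr (1 / I) * (2985984 * 54 * (real I + 2) ^ 3 * 2 ^ I) \<le> 1"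
  shows "(\<Sum>u\<in>grid (2 ^ n). bad_weight I B n u) \<le> bad_mass_const I * (16 / 2 ^ n) powr (1 / I) * 2 ^ n"
proof -
  define \<kappa> where "\<kappa> = (16 / 2 ^ n :: real) powr (1 / I)"
  interpret f: frostman_quads "Z n" "\<mu> n" "\<lambda>k. rep n k $ 1" "\<lambda>k. rep n k $ 2" "\<lambda>k. rep n k $ 3"
    "1 / 2 ^ n" 54 \<sigma> \<kappa> "2 ^ n" I B
  proof (unfold_locales, goal_cases)
    case 3
    have "\<mu> 0 k0 \<le> 1" using \<mu>_le[of 0 k0] by simp
    then show ?case by (simp add: sum_Z)
  next
    case (4 z r)
    then show ?case by (rule frostman_ball)
  qed (use small \<mu>_nonneg \<sigma> B in \<open>auto simp: \<kappa>_def\<close>)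
  have \<kappa>I: "\<kappa> ^ I = 16 / 2 ^ n"
    using I by (simp add: \<kappa>_def powr_powr flip: powr_realpow)
  \<comment> \<open>Radius 1 is no restriction, because all representatives lie in one unit
    cell.\<close>
  have slab: "f.slab (16 / 2 ^ n) 1 k u = strip n k u" if "k \<in> Z n" for k u
    unfolding f.slab_def strip_def
    using rep_diff_le_1[OF that] by (intro sum.cong) (auto simp: f.near_def quad_def parab_def)
  have level: "f.level I (16 / 2 ^ n) = strip_bound I B n"
    by (simp only: f.level_def) (simp only: strip_bound_def \<kappa>_def)
  have "f.bad_mass (\<lambda>k u. f.level I (16 / 2 ^ n) < f.slab (16 / 2 ^ n) 1 k u) \<le> bad_mass_const I * \<kappa> * (2 ^ n)"
    using f.bad_mass_slab_le[of I "16 / 2 ^ n" 1] by (simp add: \<kappa>I divide_right_mono)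
  moreover have "f.bad_mass (\<lambda>k u. f.level I (16 / 2 ^ n) < f.slab (16 / 2 ^ n) 1 k u)
      = (\<Sum>u\<in>grid (2 ^ n). bad_weight I B n u)"
    unfolding f.bad_mass_def bad_weight_def
    by (subst sum.swap) (auto intro!: sum.cong simp: slab level)
  ultimately show ?thesis by (simp add: \<kappa>_def)
qed

end

section \<open>From strip bounds to a lower bound for the dimension\<close>

lemma parab_diff_le:
  assumes "\<And>i. \<bar>z $ i - z' $ i\<bar> \<le> d" "u \<in> {0..1}"
  shows "\<bar>parab z u - parab z' u\<bar> \<le> 3 * d"
proof -
  have d: "0 \<le> d" using assms(1)[of 1] by linarith
  have "parab z u - parab z' u = (z $ 1 - z' $ 1) + (z $ 2 - z' $ 2) * u + (z $ 3 - z' $ 3) * u\<^sup>2"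
    by (simp add: parab_def algebra_simps)
  moreover have "\<bar>(z $ 2 - z' $ 2) * u\<bar> \<le> d * 1"
    unfolding abs_mult using assms d by (intro mult_mono) auto
  moreover have "\<bar>(z $ 3 - z' $ 3) * u\<^sup>2\<bar> \<le> d * 1"
    unfolding abs_mult using assms d by (intro mult_mono) (auto simp: power_le_one)
  ultimately show ?thesis using assms(1)[of 1] by linarith
qed

lemma parab_diff_move:
  assumes "\<And>i. \<bar>z $ i - z' $ i\<bar> \<le> 1" "u \<in> {0..1}" "v \<in> {0..1}"
  shows "\<bar>(parab z u - parab z' u) - (parab z v - parab z' v)\<bar> \<le> 3 * \<bar>u - v\<bar>"
proof -
  have "(parab z u - parab z' u) - (parab z v - parab z' v)
     = (z $ 2 - z' $ 2) * (u - v) + (z $ 3 - z' $ 3) * ((u + v) * (u - v))"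
    by (simp add: parab_def power2_eq_square algebra_simps)
  moreover have "\<bar>(z $ 2 - z' $ 2) * (u - v)\<bar> \<le> 1 * \<bar>u - v\<bar>"
    unfolding abs_mult using assms by (intro mult_right_mono) auto
  moreover have "\<bar>(z $ 3 - z' $ 3) * ((u + v) * (u - v))\<bar> \<le> 1 * (2 * \<bar>u - v\<bar>)"
    unfolding abs_mult using assms by (intro mult_mono) auto
  ultimately show ?thesis by linarith
qed

lemma floor_grid:
  fixes u :: real and n :: nat
  assumes "u \<in> {0..<1}"
  defines "v \<equiv> real_of_int \<lfloor>u * 2 ^ n\<rfloor> / 2 ^ n"
  shows "v \<in> grid (2 ^ n)" "v \<le> u" "u < v + 1 / 2 ^ n"
proof -
  have u: "0 \<le> u * 2 ^ n" "u * 2 ^ n < 2 ^ n" using assms by auto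
  then have "nat \<lfloor>u * 2 ^ n\<rfloor> < 2 ^ n" by (simp add: nat_less_iff floor_less_iff)
  moreover have "v = real (nat \<lfloor>u * 2 ^ n\<rfloor>) / real (2 ^ n)" using u by (simp add: v_def)
  ultimately show "v \<in> grid (2 ^ n)" unfolding grid_def by blast
  have "real_of_int \<lfloor>u * 2 ^ n\<rfloor> \<le> u * 2 ^ n" "u * 2 ^ n < real_of_int \<lfloor>u * 2 ^ n\<rfloor> + 1" by linarith+
  then show "v \<le> u" "u < v + 1 / 2 ^ n" by (simp_all add: v_def field_simps)
qed

lemma dyadic_level_exists:
  fixes r :: real
  assumes r: "0 < r" "r \<le> 1 / 2 ^ n1"
  shows "\<exists>n\<ge>n1. 1 / 2 ^ Suc n < r \<and> r \<le> 1 / 2 ^ n"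
proof -
  obtain m where m: "(1 / 2) ^ m < r" using real_arch_pow_inv[of r "1/2"] r by auto
  define P where "P n \<longleftrightarrow> n1 \<le> n \<and> 1 / 2 ^ Suc n < r" for n
  have "(1 / 2 :: real) ^ Suc (max m n1) \<le> (1 / 2) ^ m" by (intro power_decreasing) auto
  then have "P (max m n1)" using m by (simp add: P_def power_one_over)
  then have L: "P (Least P)" "\<And>n. P n \<Longrightarrow> Least P \<le> n" by (auto intro: LeastI Least_le)
  have "r \<le> 1 / 2 ^ (Least P)"
  proof (cases "Least P = n1")
    case False
    then obtain j where j: "Least P = Suc j" "n1 \<le> j" using L(1) by (cases "Least P") (auto simp: P_def)
    then have "\<not> P j" using L(2)[of j] by auto
    then show ?thesis using j by (simp add: P_def)
  qed (use r in simp)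
  then show ?thesis using L(1) by (auto simp: P_def)
qed

context cell_measure
begin

lemma strip_bound_nonneg: "0 \<le> strip_bound I B n"
  by (simp add: strip_bound_def)

lemma mass_le_by_cells:
  assumes n: "n \<le> J" and S: "S \<subseteq> Z J" and T: "(\<lambda>k. dyadic_cell n (rep J k)) ` S \<subseteq> T" "finite T"
  shows "(\<Sum>k\<in>S. \<mu> J k) \<le> (\<Sum>q\<in>T. \<mu> n q)"
proof -
  have fS: "finite S" by (rule finite_subset[OF S finite_Z])
  have "(\<Sum>k\<in>S. \<mu> J k) = (\<Sum>q\<in>T. \<Sum>k | k \<in> S \<and> dyadic_cell n (rep J k) = q. \<mu> J k)"
    by (rule sum.group[symmetric, OF fS T(2,1)])
  also have "\<dots> \<le> (\<Sum>q\<in>T. \<mu> n q)"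
    by (intro sum_mono sum_below_le n) (use S fS in auto)
  finally show ?thesis .
qed

text \<open>
  If the dimension were smaller, a cover by intervals of dyadic lengths would, by the pigeonhole principle, catch mass
  \<open>2 powr (- \<gamma> n)\<close> at one scale \<open>n\<close>. Half of it is bad, or one of the few intervals lies in a heavy strip.
\<close>

lemma dim_ge_of_good_parameter:
  fixes n1 I B :: nat and u s \<gamma> :: real
  assumes E: "compact E" and s: "0 < s" "s < 1" and u: "u \<in> {0..<1}"
    and good: "\<And>n. n1 \<le> n \<Longrightarrow> bad_weight I B n (real_of_int \<lfloor>u * 2 ^ n\<rfloor> / 2 ^ n) < 2 powr (- \<gamma> * n) / 2"
    and num: "\<And>n. n1 \<le> n \<Longrightarrow> 2 powr (real (Suc n) * s) * strip_bound I B n < 2 powr (- \<gamma> * n) / 2"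
    and tail: "\<And>J. (\<Sum>n\<in>{n1..J}. 2 powr (- \<gamma> * n)) < \<mu> 0 k0"
  shows "ennreal s \<le> hausdorff_dim ((\<lambda>z. parab z u) ` E)"
proof (rule ccontr)
  assume "\<not> ?thesis"
  then have dim: "hausdorff_dim ((\<lambda>z. parab z u) ` E) < ennreal s" by simp
  have cpt: "compact ((\<lambda>z. parab z u) ` E)"
    using E by (intro compact_continuous_image) (auto simp: parab_def intro!: continuous_intros)
  have "0 < 1 / (2 :: real) ^ n1" by simp
  note cover = compact_cover_of_hausdorff_dim_less[OF dim s cpt this]
  obtain F :: "nat set" and y r where F: "finite F" and r: "\<And>i. 0 < r i \<and> r i \<le> 1 / 2 ^ n1"
    and cov: "(\<lambda>z. parab z u) ` E \<subseteq> (\<Union>i\<in>F. ball (y i) (r i))" and sum_r: "(\<Sum>i\<in>F. r i powr s) \<le> 1"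
  proof (rule cover, goal_cases)
    case (1 F y r)
    show ?case by (rule 1(1)[OF 1(2-5)])
  qed
  have "\<forall>i. \<exists>n\<ge>n1. 1 / 2 ^ Suc n < r i \<and> r i \<le> 1 / 2 ^ n" using dyadic_level_exists r by blast
  from choice[OF this] obtain lev where lev: "\<And>i. n1 \<le> lev i" "\<And>i. 1 / 2 ^ Suc (lev i) < r i" "\<And>i. r i \<le> 1 / 2 ^ lev i"
    by auto
  \<comment> \<open>Any level at least as fine as all those of the finite cover would do.\<close>
  define J where "J = (\<Sum>i\<in>F. lev i)"
  have J: "lev i \<le> J" if "i \<in> F" for i unfolding J_def using that F by (intro member_le_sum) auto
  have "\<forall>k\<in>Z J. \<exists>i. i \<in> F \<and> parab (rep J k) u \<in> ball (y i) (r i)" using rep(1) cov by blast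
  from bchoice[OF this] obtain \<iota> where \<iota>: "\<And>k. k \<in> Z J \<Longrightarrow> \<iota> k \<in> F"
    "\<And>k. k \<in> Z J \<Longrightarrow> parab (rep J k) u \<in> ball (y (\<iota> k)) (r (\<iota> k))"
    by blast
  define T where "T n = {k \<in> Z J. lev (\<iota> k) = n}" for n
  \<comment> \<open>By \<open>tail\<close> the thresholds sum to less than the total mass, so they
    cannot all fail.\<close>
  have "\<exists>n\<in>{n1..J}. 2 powr (- \<gamma> * n) \<le> (\<Sum>k\<in>T n. \<mu> J k)"
  proof (rule ccontr)
    assume "\<not> ?thesis"
    then have "(\<Sum>n\<in>{n1..J}. \<Sum>k\<in>T n. \<mu> J k) \<le> (\<Sum>n\<in>{n1..J}. 2 powr (- \<gamma> * n))"
      by (intro sum_mono) (auto simp: not_le less_imp_le)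
    also have "(\<Sum>n\<in>{n1..J}. \<Sum>k\<in>T n. \<mu> J k) = (\<Sum>k\<in>Z J. \<mu> J k)"
      unfolding T_def by (rule sum.group) (use \<iota>(1) J lev(1) in auto)
    finally show False using tail[of J] by (simp add: sum_Z)
  qed
  then obtain n where n: "n1 \<le> n" "n \<le> J" "2 powr (- \<gamma> * n) \<le> (\<Sum>k\<in>T n. \<mu> J k)" by auto
  define v where "v = real_of_int \<lfloor>u * 2 ^ n\<rfloor> / 2 ^ n"
  have v: "v \<in> {0..1}" "\<bar>u - v\<bar> \<le> 1 / 2 ^ n"
    using floor_grid[OF u, of n] grid_subset unfolding v_def by (blast, simp)
  define l where "l k = dyadic_cell n (rep J k)" for k
  have l: "l k \<in> Z n" if "k \<in> T n" for k using ancestor_in_Z[OF n(2)] that by (simp add: l_def T_def)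
  define T1 where "T1 = {k \<in> T n. strip_bound I B n < strip n (l k) v}"
  define T2 where "T2 = {k \<in> T n. strip n (l k) v \<le> strip_bound I B n}"
  have TZ: "T n \<subseteq> Z J" by (auto simp: T_def)
  then have fT: "finite (T n)" by (rule finite_subset[OF _ finite_Z])
  have "T n = T1 \<union> T2" by (auto simp: T1_def T2_def)
  then have split: "(\<Sum>k\<in>T n. \<mu> J k) = (\<Sum>k\<in>T1. \<mu> J k) + (\<Sum>k\<in>T2. \<mu> J k)"
    by (simp only:) (rule sum.union_disjoint, use fT in \<open>auto simp: T1_def T2_def\<close>)
  have "(\<Sum>k\<in>T1. \<mu> J k) \<le> (\<Sum>q | q \<in> Z n \<and> strip_bound I B n < strip n q v. \<mu> n q)"
    by (rule mass_le_by_cells[OF n(2)]) (use TZ l in \<open>auto simp: T1_def l_def\<close>)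
  also have "\<dots> = (\<Sum>q\<in>Z n. if strip_bound I B n < strip n q v then \<mu> n q else 0)"
    by (rule sum.inter_filter) simp
  also have "\<dots> = bad_weight I B n v" unfolding bad_weight_def by (intro sum.cong) auto
  also have "\<dots> < 2 powr (- \<gamma> * n) / 2" unfolding v_def by (rule good[OF n(1)])
  finally have 1: "(\<Sum>k\<in>T1. \<mu> J k) < 2 powr (- \<gamma> * n) / 2" .
  define Fn where "Fn = {i \<in> F. lev i = n}"
  have fFn: "finite Fn" using F by (simp add: Fn_def)
  have close: "\<bar>parab (rep n (l k)) v - parab (rep n (l k')) v\<bar> \<le> 16 / 2 ^ n"
    if k: "k \<in> T n" "k' \<in> T n" "\<iota> k = i" "\<iota> k' = i" for k k' i
  proof -
    have *: "\<bar>parab (rep n (l k)) u - y i\<bar> \<le> 4 / 2 ^ n" if k: "k \<in> T n" "\<iota> k = i" for k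
    proof -
      have "dyadic_cell n (rep n (l k)) = dyadic_cell n (rep J k)" using rep(2)[OF l[OF k(1)]] by (simp add: l_def)
      then have "\<bar>parab (rep n (l k)) u - parab (rep J k) u\<bar> \<le> 3 * (1 / 2 ^ n)"
        using u by (intro parab_diff_le same_cell_component) auto
      moreover have "\<bar>parab (rep J k) u - y i\<bar> < r i" using \<iota>(2)[of k] k TZ by (auto simp: dist_real_def abs_minus_commute)
      moreover have "r i \<le> 1 / 2 ^ n" using lev(3)[of i] k by (auto simp: T_def)
      ultimately show ?thesis by linarith
    qed
    have "\<bar>(parab (rep n (l k)) u - parab (rep n (l k')) u) - (parab (rep n (l k)) v - parab (rep n (l k')) v)\<bar> \<le> 3 * \<bar>u - v\<bar>"
      using u v l k by (intro parab_diff_move rep_diff_le_1) auto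
    moreover have "\<bar>parab (rep n (l k)) u - parab (rep n (l k')) u\<bar> \<le> 4 / 2 ^ n + 4 / 2 ^ n"
      using *[OF k(1,3)] *[OF k(2,4)] by linarith
    moreover have "3 * \<bar>u - v\<bar> \<le> 3 / 2 ^ n" using v(2) by simp
    ultimately have "\<bar>parab (rep n (l k)) v - parab (rep n (l k')) v\<bar> \<le> 4 / 2 ^ n + 4 / 2 ^ n + 3 / 2 ^ n"
      by linarith
    also have "\<dots> \<le> 16 / 2 ^ n" by (simp flip: add_divide_distrib add: divide_right_mono)
    finally show ?thesis .
  qed
  have "(\<Sum>k\<in>T2. \<mu> J k) = (\<Sum>i\<in>Fn. \<Sum>k | k \<in> T2 \<and> \<iota> k = i. \<mu> J k)"
  proof (rule sum.group[symmetric])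
    show "\<iota> ` T2 \<subseteq> Fn" using \<iota>(1) by (auto simp: T2_def T_def Fn_def)
  qed (use fT fFn in \<open>auto simp: T2_def\<close>)
  also have "\<dots> \<le> (\<Sum>i\<in>Fn. strip_bound I B n)"
  proof (rule sum_mono)
    fix i
    let ?S = "{k. k \<in> T2 \<and> \<iota> k = i}"
    show "(\<Sum>k\<in>?S. \<mu> J k) \<le> strip_bound I B n"
    proof (cases "?S = {}")
      case True
      then show ?thesis using strip_bound_nonneg by (simp only: True) simp
    next
      case False
      then obtain k1 where k1: "k1 \<in> T2" "\<iota> k1 = i" by blast
      have k1T: "k1 \<in> T n" using k1 by (simp add: T2_def)
      have "(\<Sum>k\<in>?S. \<mu> J k) \<le> strip n (l k1) v"
        unfolding strip_def
      proof (rule mass_le_by_cells[OF n(2)])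
        show "?S \<subseteq> Z J" using TZ by (auto simp: T2_def)
        show "(\<lambda>k. dyadic_cell n (rep J k)) ` ?S \<subseteq> {k'. k' \<in> Z n \<and> \<bar>parab (rep n (l k1)) v - parab (rep n k') v\<bar> \<le> 16 / 2 ^ n}"
        proof (rule image_subsetI)
          fix k assume "k \<in> ?S"
          then have k: "k \<in> T n" "\<iota> k = i" by (auto simp: T2_def)
          show "dyadic_cell n (rep J k) \<in> {k'. k' \<in> Z n \<and> \<bar>parab (rep n (l k1)) v - parab (rep n k') v\<bar> \<le> 16 / 2 ^ n}"
            using close[OF k1T k(1) k1(2) k(2)] l[OF k(1)] by (simp add: l_def)
        qed
      qed simp
      also have "\<dots> \<le> strip_bound I B n" using k1 by (simp add: T2_def)
      finally show ?thesis .
    qed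
  qed
  also have "\<dots> = real (card Fn) * strip_bound I B n" by simp
  also have "\<dots> \<le> 2 powr (real (Suc n) * s) * strip_bound I B n"
  proof (rule mult_right_mono[OF _ strip_bound_nonneg])
    have "real (card Fn) * (1 / 2 ^ Suc n) powr s = (\<Sum>i\<in>Fn. (1 / 2 ^ Suc n) powr s)" by simp
    also have "\<dots> \<le> (\<Sum>i\<in>Fn. r i powr s)"
    proof (intro sum_mono powr_mono2)
      fix i assume "i \<in> Fn"
      then show "1 / 2 ^ Suc n \<le> r i" using lev(2)[of i] by (auto simp: Fn_def)
    qed (use s in auto)
    also have "\<dots> \<le> (\<Sum>i\<in>F. r i powr s)" using F by (intro sum_mono2) (auto simp: Fn_def)
    also note sum_r
    finally have *: "real (card Fn) * (1 / 2 ^ Suc n) powr s \<le> 1" .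
    have pw: "(1 / 2 ^ Suc n :: real) powr s = 1 / 2 powr (real (Suc n) * s)"
      by (simp only: powr_divide powr_one_eq_one powr_powr[symmetric] powr_realpow[of 2, simplified])
    show "real (card Fn) \<le> 2 powr (real (Suc n) * s)" using * unfolding pw by simp
  qed
  also have "\<dots> < 2 powr (- \<gamma> * n) / 2" by (rule num[OF n(1)])
  finally have 2: "(\<Sum>k\<in>T2. \<mu> J k) < 2 powr (- \<gamma> * n) / 2" .
  show False using 1 2 n(3) split by simp
qed

end

text \<open>\<open>I\<close> is so large that the exponent loss \<open>(B + 71) / I\<close> together
  with \<gamma> stays below \<open>\<sigma> - s\<close>. With
  \<open>q = 2 powr (- \<gamma>)\<close>, the average bad weight at level \<open>n\<close> is of
  order \<open>q ^ (2 * n)\<close>; the threshold \<open>q ^ n / 2\<close> then leaves a set of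
  parameters of measure of order \<open>q ^ n\<close>. This is summable, and Borel-Cantelli
  applies.\<close>

lemma (in cell_measure) AE_dim_ge:
  assumes E: "compact E" and s: "0 < s" "s < \<sigma>"
  shows "AE u in lborel. u \<in> {0..<1} \<longrightarrow> ennreal s \<le> hausdorff_dim ((\<lambda>z. parab z u) ` E)"
proof -
  obtain B :: nat where "4 / (1 - \<sigma>) \<le> B" using real_arch_simple by blast
  then have B: "4 \<le> B * (1 - \<sigma>)" using \<sigma> by (simp add: field_simps)
  define d where "d = (\<sigma> - s) / 2"
  have d: "0 < d" using s by (simp add: d_def)
  obtain I :: nat where "(B + 72) / d + 1 \<le> I" using real_arch_simple by blast
  moreover have "0 \<le> (B + 72) / d" using d by simp
  ultimately have I: "0 < I" "(B + 72) / d \<le> I" by linarith+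
  then have I': "(B + 72) / I \<le> d" using d by (simp add: field_simps)
  define \<gamma> where "\<gamma> = 1 / (2 * real I)"
  have \<gamma>: "0 < \<gamma>" "1 / real I = 2 * \<gamma>" using I by (simp_all add: \<gamma>_def)
  define q where "q = 2 powr (- \<gamma>)"
  have q: "0 < q" "q < 1" using \<gamma> by (simp_all add: q_def powr_less_one)
  have q_pow: "2 powr (- \<gamma> * real n) = q ^ n" for n
    by (simp add: q_def powr_powr flip: powr_realpow)
  have summ: "summable (\<lambda>n. q ^ n)" using q by (intro summable_geometric) auto
  have split16: "(16 / 2 ^ n) powr x = 16 powr x * 2 powr (- x * real n)" for n :: nat and x :: real
  proof -
    have "(1 / 2 ^ n :: real) = 2 powr (- real n)" by (simp add: powr_minus powr_realpow divide_inverse)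
    then have "(16 / 2 ^ n :: real) = 16 * 2 powr (- real n)" by simp
    then show ?thesis by (simp add: powr_mult powr_powr mult.commute)
  qed
  define \<kappa> where "\<kappa> n = (16 / 2 ^ n :: real) powr (1 / I)" for n
  have \<kappa>: "\<kappa> n = 16 powr (1 / I) * (q ^ n)\<^sup>2" for n
  proof -
    have "2 powr (- (1 / I) * real n) = (2 powr (- \<gamma> * real n))\<^sup>2"
      by (simp add: \<gamma>(2) power2_eq_square mult.assoc flip: powr_add)
    then show ?thesis by (simp only: \<kappa>_def split16 q_pow)
  qed
  have q0: "(\<lambda>n. q ^ n) \<longlonglongrightarrow> 0" using q by (intro LIMSEQ_power_zero) auto
  define C where "C = 2985984 * 54 * (real I + 2) ^ 3 * 2 ^ I"
  have "(\<lambda>n. \<kappa> n * C) \<longlonglongrightarrow> 16 powr (1 / I) * 0\<^sup>2 * C"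
    unfolding \<kappa> by (intro tendsto_intros q0)
  then have "\<forall>\<^sub>F n in sequentially. \<kappa> n * C < 1" by (rule order_tendstoD) simp
  then obtain na where na: "\<And>n. na \<le> n \<Longrightarrow> \<kappa> n * C \<le> 1"
    unfolding eventually_sequentially by (meson less_imp_le)
  define e where "e = \<sigma> - (B + 71) / I"
  have ed: "\<gamma> < e - s"
  proof -
    have "(B + 71) / I + \<gamma> < (B + 72) / I" using I by (simp add: \<gamma>_def field_simps)
    also note I'
    finally have "(B + 71) / I + \<gamma> < d" .
    moreover have "\<sigma> - s = 2 * d" by (simp add: d_def)
    ultimately show ?thesis unfolding e_def using d by linarith
  qed
  define K where "K = 2 powr s * ((real I + 1) * 16 powr e)"
  have bound: "2 powr (real (Suc n) * s) * strip_bound I B n = K * 2 powr (- (e - s) * real n)" for n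
  proof -
    have "((16 / 2 ^ n :: real) powr (1 / I)) ^ (B + 71) = (16 / 2 ^ n) powr ((B + 71) / I)"
      by (subst powr_realpow[symmetric]) (simp_all add: powr_powr)
    then have "strip_bound I B n = (real I + 1) * (16 / 2 ^ n) powr e"
      by (simp add: strip_bound_def e_def powr_diff)
    also have "\<dots> = (real I + 1) * (16 powr e * 2 powr (- e * real n))" by (simp only: split16)
    finally have sb: "strip_bound I B n = (real I + 1) * (16 powr e * 2 powr (- e * real n))" .
    have "2 powr (real (Suc n) * s) = 2 powr s * 2 powr (real n * s)"
      by (simp add: algebra_simps flip: powr_add)
    then have "2 powr (real (Suc n) * s) * strip_bound I B n
       = K * (2 powr (real n * s) * 2 powr (- e * real n))"
      by (simp only: sb K_def mult_ac)
    also have "2 powr (real n * s) * 2 powr (- e * real n) = 2 powr (- (e - s) * real n)"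
      by (simp add: algebra_simps flip: powr_add)
    finally show ?thesis .
  qed
  define q' where "q' = 2 powr (- (e - s - \<gamma>))"
  have q': "0 < q'" "q' < 1" using ed by (simp_all add: q'_def powr_less_one)
  have "(\<lambda>n. K * q' ^ n) \<longlonglongrightarrow> K * 0"
    using q' by (intro tendsto_intros LIMSEQ_power_zero) auto
  then have "\<forall>\<^sub>F n in sequentially. K * q' ^ n < 1 / 2" by (rule order_tendstoD) simp
  then obtain nb where nb: "\<And>n. nb \<le> n \<Longrightarrow> K * q' ^ n < 1 / 2"
    unfolding eventually_sequentially by blast
  have num: "2 powr (real (Suc n) * s) * strip_bound I B n < 2 powr (- \<gamma> * real n) / 2" if "nb \<le> n" for n
  proof -
    have "2 powr (- (e - s) * real n) = q' ^ n * q ^ n"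
      by (simp add: q'_def q_def powr_powr algebra_simps flip: powr_realpow powr_add)
    then have "2 powr (real (Suc n) * s) * strip_bound I B n = (K * q' ^ n) * q ^ n"
      by (simp only: bound mult.assoc)
    also have "\<dots> < (1 / 2) * q ^ n" using nb[OF that] q by (intro mult_strict_right_mono) auto
    finally show ?thesis by (simp only: q_pow)
  qed
  define G where "G n = {v \<in> grid (2 ^ n). q ^ n / 2 \<le> bad_weight I B n v}" for n
  define S where "S n = (if na \<le> n then \<Union>v\<in>G n. {v..<v + 1 / 2 ^ n} else {})" for n
  have fG: "finite (G n)" for n by (simp add: G_def)
  have bw: "0 \<le> bad_weight I B n v" for n v
    unfolding bad_weight_def using \<mu>_nonneg by (intro sum_nonneg) auto
  have cardG: "real (card (G n)) / 2 ^ n \<le> 2 * bad_mass_const I * 16 powr (1 / I) * q ^ n" if "na \<le> n" for n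
  proof -
    have "real (card (G n)) * (q ^ n / 2) \<le> (\<Sum>v\<in>G n. bad_weight I B n v)"
      by (rule sum_bounded_below) (simp add: G_def)
    also have "\<dots> \<le> (\<Sum>v\<in>grid (2 ^ n). bad_weight I B n v)"
      using bw by (intro sum_mono2) (auto simp: G_def)
    also have "\<dots> \<le> bad_mass_const I * \<kappa> n * 2 ^ n"
      unfolding \<kappa>_def using na[OF that] by (intro sum_bad_weight I B) (simp add: \<kappa>_def C_def)
    also have "\<dots> = bad_mass_const I * 16 powr (1 / I) * (q ^ n)\<^sup>2 * 2 ^ n" by (simp only: \<kappa> mult.assoc)
    finally have "real (card (G n)) * (q ^ n / 2) \<le> bad_mass_const I * 16 powr (1 / I) * (q ^ n)\<^sup>2 * 2 ^ n" .
    then have "(real (card (G n)) / 2 ^ n) * (q ^ n / 2) \<le> (2 * bad_mass_const I * 16 powr (1 / I) * q ^ n) * (q ^ n / 2)"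
      by (simp add: field_simps power2_eq_square)
    then show ?thesis by (rule mult_right_le_imp_le) (use q in simp)
  qed
  have meas: "measure lborel (S n) \<le> 2 * bad_mass_const I * 16 powr (1 / I) * q ^ n" for n
  proof (cases "na \<le> n")
    case True
    have "S n = (\<Union>v\<in>G n. {v..<v + 1 / 2 ^ n})" using True by (simp add: S_def)
    then have "measure lborel (S n) \<le> (\<Sum>v\<in>G n. measure lborel {v..<v + 1 / 2 ^ n})"
      by (simp only:) (rule measure_UNION_le[OF fG], simp)
    also have "\<dots> = real (card (G n)) / 2 ^ n" by simp
    finally show ?thesis using cardG[OF True] by simp
  next
    case False
    then show ?thesis using bad_mass_const_nonneg[of I] q by (simp add: S_def)
  qed
  have "AE u in lborel. \<forall>\<^sub>F n in sequentially. u \<in> space lborel - S n"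
  proof (rule borel_cantelli_AE1)
    show "S n \<in> sets lborel" for n unfolding S_def using fG by (auto intro!: sets.finite_UN)
    show "emeasure lborel (S n) < \<infinity>" for n
    proof -
      have "emeasure lborel (S n) \<le> emeasure lborel {0..2 :: real}"
      proof (rule emeasure_mono)
        show "S n \<subseteq> {0..2}"
        proof
          fix x assume "x \<in> S n"
          then obtain v where v: "v \<in> grid (2 ^ n)" "x \<in> {v..<v + 1 / 2 ^ n}"
            by (auto simp: S_def G_def split: if_splits)
          have "v \<in> {0..1}" using v(1) grid_subset by blast
          moreover have "1 / 2 ^ n \<le> (1 :: real)" by simp
          ultimately show "x \<in> {0..2}" using v(2) unfolding atLeastAtMost_iff atLeastLessThan_iff by linarith
        qed
      qed simp
      then show ?thesis by (rule order_le_less_trans) simp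
    qed
    show "summable (\<lambda>n. measure lborel (S n))"
      by (rule summable_comparison_test'[OF summable_mult[OF summ], of 0]) (use meas in auto)
  qed
  then show ?thesis
  proof (rule AE_mp[OF _ AE_I2], intro impI)
    fix u :: real
    assume "\<forall>\<^sub>F n in sequentially. u \<in> space lborel - S n" and u: "u \<in> {0..<1}"
    then obtain nc where nc: "\<And>n. nc \<le> n \<Longrightarrow> u \<notin> S n" unfolding eventually_sequentially by auto
    obtain nd where nd: "\<And>n. nd \<le> n \<Longrightarrow> norm (\<Sum>i. q ^ (i + n)) < \<mu> 0 k0"
      using suminf_exist_split[OF \<mu>_root(2) summ] by blast
    define n1 where "n1 = max (max na nb) (max nc nd)"
    show "ennreal s \<le> hausdorff_dim ((\<lambda>z. parab z u) ` E)"
    proof (rule dim_ge_of_good_parameter[OF E s(1) _ u])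
      show "s < 1" using s \<sigma> by simp
      show "2 powr (real (Suc n) * s) * strip_bound I B n < 2 powr (- \<gamma> * real n) / 2" if "n1 \<le> n" for n
        using that by (intro num) (simp add: n1_def)
      show "(\<Sum>n\<in>{n1..J}. 2 powr (- \<gamma> * real n)) < \<mu> 0 k0" for J
      proof -
        have sm: "summable (\<lambda>i. q ^ (i + n1))" using summ by (simp add: summable_iff_shift)
        have "(\<Sum>n\<in>{n1..J}. 2 powr (- \<gamma> * real n)) = (\<Sum>n\<in>{n1..J}. q ^ n)" by (simp only: q_pow)
        also have "\<dots> \<le> (\<Sum>n\<in>{0 + n1..J + n1}. q ^ n)" using q by (intro sum_mono2) auto
        also have "\<dots> = (\<Sum>i\<in>{0..J}. q ^ (i + n1))" by (rule sum.shift_bounds_cl_nat_ivl)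
        also have "\<dots> \<le> (\<Sum>i. q ^ (i + n1))" by (rule sum_le_suminf[OF sm]) (use q in auto)
        also have "\<dots> < \<mu> 0 k0"
        proof -
          have "nd \<le> n1" by (simp add: n1_def)
          from nd[OF this] show ?thesis unfolding real_norm_def by linarith
        qed
        finally show ?thesis .
      qed
      show "bad_weight I B n (real_of_int \<lfloor>u * 2 ^ n\<rfloor> / 2 ^ n) < 2 powr (- \<gamma> * real n) / 2" if "n1 \<le> n" for n
      proof (rule ccontr)
        assume "\<not> ?thesis"
        then have "real_of_int \<lfloor>u * 2 ^ n\<rfloor> / 2 ^ n \<in> G n"
          using floor_grid(1)[OF u, of n] by (simp add: G_def q_pow[symmetric])
        moreover have "u \<in> {real_of_int \<lfloor>u * 2 ^ n\<rfloor> / 2 ^ n..<real_of_int \<lfloor>u * 2 ^ n\<rfloor> / 2 ^ n + 1 / 2 ^ n}"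
          using floor_grid(2,3)[OF u, of n] by simp
        ultimately have "u \<in> S n" using that unfolding S_def n1_def by auto
        then show False using nc[of n] that by (simp add: n1_def)
      qed
    qed
  qed
qed

section \<open>Hausdorff dimension under Lipschitz maps\<close>

lemma hausdorff_content_le_measure: "0 < \<delta> \<Longrightarrow> hausdorff_content \<delta> s E \<le> hausdorff_measure s E"
  unfolding hausdorff_measure_def by (rule SUP_upper) simp

lemma hausdorff_measure_zeroI:
  assumes "\<And>\<delta> e. 0 < \<delta> \<Longrightarrow> 0 < e \<Longrightarrow> hausdorff_content \<delta> s E \<le> ennreal e"
  shows "hausdorff_measure s E = 0"
proof -
  have "hausdorff_content \<delta> s E \<le> 0" if "0 < \<delta>" for \<delta>
    by (rule ennreal_le_epsilon) (use that assms in simp)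
  then have "(SUP \<delta>\<in>{0<..}. hausdorff_content \<delta> s E) \<le> 0" by (intro SUP_least) simp
  then show ?thesis by (simp add: hausdorff_measure_def)
qed

lemma hausdorff_measure_lipschitz_image:
  fixes f :: "'a::metric_space \<Rightarrow> 'b::real_normed_vector"
  assumes s: "0 \<le> s" and E: "hausdorff_measure s E = 0" and C: "0 < C"
    and f: "\<And>x y. x \<in> E \<Longrightarrow> y \<in> E \<Longrightarrow> dist (f x) (f y) \<le> C * dist x y"
  shows "hausdorff_measure s (f ` E) = 0"
proof (rule hausdorff_measure_zeroI)
  fix \<delta> e :: real assume \<delta>: "0 < \<delta>" and e: "0 < e"
  have Cs: "0 < C powr s" using C by simp
  have "hausdorff_content (\<delta> / C) s E \<le> 0"
    using hausdorff_content_le_measure[of "\<delta> / C" s E] \<delta> C E by simp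
  then have "hausdorff_content (\<delta> / C) s E < ennreal (e / C powr s)" using e Cs by simp
  then obtain U where U: "E \<subseteq> (\<Union>i. U i)" "\<And>i. bounded (U i)" "\<And>i. diameter (U i) \<le> \<delta> / C"
    and sum: "(\<Sum>i::nat. diam_powr s (U i)) < ennreal (e / C powr s)"
    unfolding hausdorff_content_def Inf_less_iff by auto
  \<comment> \<open>Intersecting with \<open>E\<close> is necessary since the Lipschitz bound holds
    only there.\<close>
  define V where "V i = f ` (U i \<inter> E)" for i
  have Vd: "dist a b \<le> C * diameter (U i)" if ab: "a \<in> V i" "b \<in> V i" for a b i
  proof -
    obtain x y where xy: "x \<in> U i \<inter> E" "y \<in> U i \<inter> E" "a = f x" "b = f y" using ab by (auto simp: V_def)
    then have "dist a b \<le> C * dist x y" using f by auto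
    also have "\<dots> \<le> C * diameter (U i)" using xy C U(2) by (intro mult_left_mono diameter_bounded_bound) auto
    finally show ?thesis .
  qed
  have diam0: "0 \<le> diameter (U i)" for i using U(2) by (rule diameter_ge_0)
  have dV: "diameter (V i) \<le> C * diameter (U i)" for i
    using Vd[of _ i] C diam0 by (intro diameter_le) (auto simp: dist_norm)
  have V: "bounded (V i)" "diameter (V i) \<le> \<delta>" for i
  proof -
    show "bounded (V i)"
      unfolding bounded_two_points using Vd[of _ i] by blast
    show "diameter (V i) \<le> \<delta>" using dV[of i] U(3)[of i] C by (simp add: field_simps)
  qed
  have "diam_powr s (V i) \<le> ennreal (C powr s) * diam_powr s (U i)" for i
  proof (cases "V i = {}")
    case False
    then have Ui: "U i \<noteq> {}" by (auto simp: V_def)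
    have "diameter (V i) powr s \<le> (C * diameter (U i)) powr s"
      using dV s V(1)[of i] by (intro powr_mono2) (auto intro: diameter_ge_0)
    also have "\<dots> = C powr s * diameter (U i) powr s" by (simp add: powr_mult)
    finally show ?thesis using False Ui C by (auto simp: diam_powr_def ennreal_leI simp flip: ennreal_mult)
  qed (simp add: diam_powr_def)
  then have "(\<Sum>i. diam_powr s (V i)) \<le> (\<Sum>i. ennreal (C powr s) * diam_powr s (U i))"
    by (intro suminf_le) auto
  also have "\<dots> = ennreal (C powr s) * (\<Sum>i. diam_powr s (U i))" by (rule ennreal_suminf_cmult)
  also have "\<dots> \<le> ennreal (C powr s) * ennreal (e / C powr s)" using sum by (intro mult_left_mono) auto
  also have "\<dots> = ennreal e" using Cs C e by (simp flip: ennreal_mult)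
  finally have "(\<Sum>i. diam_powr s (V i)) \<le> ennreal e" .
  moreover have "f ` E \<subseteq> (\<Union>i. V i)" using U(1) by (fastforce simp: V_def)
  then have "hausdorff_content \<delta> s (f ` E) \<le> (\<Sum>i. diam_powr s (V i))"
    unfolding hausdorff_content_def using V by (intro Inf_lower) blast
  ultimately show "hausdorff_content \<delta> s (f ` E) \<le> ennreal e" by (rule order_trans[rotated])
qed

lemma hausdorff_dim_lipschitz_image:
  fixes f :: "'a::metric_space \<Rightarrow> 'b::real_normed_vector"
  assumes "0 < C" "\<And>x y. x \<in> E \<Longrightarrow> y \<in> E \<Longrightarrow> dist (f x) (f y) \<le> C * dist x y"
  shows "hausdorff_dim (f ` E) \<le> hausdorff_dim E"
  unfolding hausdorff_dim_def
  by (rule Inf_superset_mono) (use hausdorff_measure_lipschitz_image[OF _ _ assms] in blast)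

lemma hausdorff_content_mono: "E \<subseteq> E' \<Longrightarrow> hausdorff_content \<delta> s E \<le> hausdorff_content \<delta> s E'"
  unfolding hausdorff_content_def by (rule Inf_superset_mono) blast

lemma hausdorff_measure_mono: "E \<subseteq> E' \<Longrightarrow> hausdorff_measure s E \<le> hausdorff_measure s E'"
  unfolding hausdorff_measure_def by (intro SUP_mono) (use hausdorff_content_mono in blast)

lemma hausdorff_dim_mono:
  assumes "E \<subseteq> E'"
  shows "hausdorff_dim E \<le> hausdorff_dim E'"
proof -
  have "hausdorff_measure s E = 0" if "hausdorff_measure s E' = 0" for s
    using hausdorff_measure_mono[OF assms, of s] that by simp
  then show ?thesis unfolding hausdorff_dim_def by (intro Inf_superset_mono) blast
qed

lemma hausdorff_dim_leI: "0 \<le> s \<Longrightarrow> hausdorff_measure s E = 0 \<Longrightarrow> hausdorff_dim E \<le> ennreal s"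
  unfolding hausdorff_dim_def by (rule Inf_lower) blast

text \<open>The line is covered by intervals of lengths \<open>c / (m + 1)\<close>, whose \<open>s\<close>-th powers have a small sum.\<close>

lemma hausdorff_measure_real_zero:
  assumes s: "1 < s"
  shows "hausdorff_measure s (UNIV :: real set) = 0"
proof (rule hausdorff_measure_zeroI)
  fix \<delta> e :: real assume \<delta>: "0 < \<delta>" and e: "0 < e"
  have sm: "summable (\<lambda>n. real (Suc n) powr (- s))"
    using s by (subst summable_Suc_iff) (simp add: summable_real_powr_iff)
  define \<zeta> where "\<zeta> = (\<Sum>n. real (Suc n) powr (- s))"
  have \<zeta>: "0 \<le> \<zeta>" unfolding \<zeta>_def by (intro suminf_nonneg sm) simp
  define c where "c = min \<delta> ((e / (\<zeta> + 1)) powr (1 / s)) / 2"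
  have ez: "0 < e / (\<zeta> + 1)" using e \<zeta> by simp
  have "0 < (e / (\<zeta> + 1)) powr (1 / s)" using e \<zeta> by simp
  then have c: "0 < c" "2 * c \<le> \<delta>" using \<delta> by (simp_all add: c_def del: powr_gt_zero)
  have cs: "(2 * c) powr s \<le> e / (\<zeta> + 1)"
  proof -
    have "(2 * c) powr s \<le> ((e / (\<zeta> + 1)) powr (1 / s)) powr s"
      using c s by (intro powr_mono2) (auto simp: c_def)
    also have "\<dots> = e / (\<zeta> + 1)" using s e \<zeta> by (simp add: powr_powr)
    finally show ?thesis .
  qed
  define h where "h m = c * harm m" for m
  have h_Suc: "h (Suc m) = h m + c / real (Suc m)" for m by (simp add: h_def harm_Suc field_simps)
  \<comment> \<open>Even indices tile the positive and odd indices the negative half-line; harmonic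
    sums diverge, so every point is reached.\<close>
  define U where "U n = (if even n then {h (n div 2)..h (Suc (n div 2))} else {- h (Suc (n div 2))..- h (n div 2)})" for n
  have diam: "diameter (U n) = c / real (Suc (n div 2))" for n
    using c by (auto simp: U_def h_Suc diameter_closed_interval divide_less_0_iff)
  have diam_le: "diameter (U n) \<le> 2 * c / real (Suc n)" for n
  proof -
    have "real (Suc n) \<le> real (2 * Suc (n div 2))" by (rule of_nat_mono) presburger
    then have "real (Suc n) \<le> 2 * real (Suc (n div 2))" by simp
    then have "c * real (Suc n) \<le> c * (2 * real (Suc (n div 2)))" using c by (intro mult_left_mono) auto
    then show ?thesis unfolding diam by (simp add: divide_simps mult_ac)
  qed
  have pos: "\<exists>m. h m \<le> x \<and> x \<le> h (Suc m)" if x: "0 \<le> x" for x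
  proof -
    have "filterlim h at_top sequentially"
      unfolding h_def using c by (intro filterlim_tendsto_pos_mult_at_top[OF tendsto_const] harm_at_top) 
    then obtain m where m: "x \<le> h m" by (metis eventually_sequentially filterlim_at_top order_refl)
    define k where "k = (LEAST m. x \<le> h m)"
    have k: "x \<le> h k" unfolding k_def using m by (rule LeastI)
    show ?thesis
    proof (cases k)
      case 0
      then have "x = 0" using k x by (simp add: h_def harm_def)
      moreover have "h 0 \<le> h (Suc 0)" unfolding h_Suc[of 0] using c by simp
      ultimately show ?thesis by (intro exI[of _ 0]) (simp add: h_def harm_def)
    next
      case (Suc j)
      then have "j < k" by simp
      then have "\<not> x \<le> h j" unfolding k_def by (rule not_less_Least)
      then show ?thesis using k Suc by (intro exI[of _ j]) simp
    qed
  qed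
  have cover: "(UNIV :: real set) \<subseteq> (\<Union>n. U n)"
  proof
    fix x :: real
    show "x \<in> (\<Union>n. U n)"
    proof (cases "0 \<le> x")
      case True
      then obtain m where "h m \<le> x \<and> x \<le> h (Suc m)" using pos by blast
      then have "x \<in> U (2 * m)" by (simp add: U_def)
      then show ?thesis by blast
    next
      case False
      then obtain m where "h m \<le> - x \<and> - x \<le> h (Suc m)" using pos[of "- x"] by auto
      then have "x \<in> U (2 * m + 1)" by (simp add: U_def)
      then show ?thesis by blast
    qed
  qed
  have le: "diam_powr s (U n) \<le> ennreal ((2 * c) powr s * real (Suc n) powr (- s))" for n
  proof -
    have "diameter (U n) powr s \<le> (2 * c / real (Suc n)) powr s"
      using diam_le[of n] s c unfolding diam by (intro powr_mono2) auto
    also have "\<dots> = (2 * c) powr s * real (Suc n) powr (- s)"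
      using c by (subst powr_divide) (simp_all add: powr_minus divide_inverse)
    finally show ?thesis using s by (simp add: diam_powr_def ennreal_leI)
  qed
  have "2 * c / real (Suc n) \<le> \<delta>" for n
  proof -
    have "2 * c / real (Suc n) \<le> 2 * c / 1" using c by (intro divide_left_mono) auto
    then show ?thesis using c by simp
  qed
  then have dd: "diameter (U n) \<le> \<delta>" for n using diam_le order_trans by blast
  have bd: "bounded (U n)" for n by (simp add: U_def)
  have "hausdorff_content \<delta> s (UNIV :: real set) \<le> (\<Sum>n. diam_powr s (U n))"
    unfolding hausdorff_content_def using cover dd bd by (intro Inf_lower) blast
  also have "\<dots> \<le> (\<Sum>n. ennreal ((2 * c) powr s * real (Suc n) powr (- s)))"
    by (intro suminf_le le) auto
  also have "\<dots> = ennreal (\<Sum>n. (2 * c) powr s * real (Suc n) powr (- s))"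
    using sm by (intro suminf_ennreal2 summable_mult) auto
  also have "(\<Sum>n. (2 * c) powr s * real (Suc n) powr (- s)) = (2 * c) powr s * \<zeta>"
    unfolding \<zeta>_def by (rule suminf_mult[OF sm])
  also have "(2 * c) powr s * \<zeta> \<le> e / (\<zeta> + 1) * (\<zeta> + 1)"
    using cs \<zeta> ez by (intro mult_mono) auto
  also have "\<dots> = e" using \<zeta> by simp
  finally show "hausdorff_content \<delta> s (UNIV :: real set) \<le> ennreal e" by (simp add: ennreal_leI)
qed

lemma hausdorff_dim_real_le_1: "hausdorff_dim (S :: real set) \<le> 1"
proof (rule ennreal_le_epsilon)
  fix e :: real assume e: "0 < e"
  have "hausdorff_dim S \<le> hausdorff_dim (UNIV :: real set)" by (rule hausdorff_dim_mono) simp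
  also have "\<dots> \<le> ennreal (1 + e)" using e by (intro hausdorff_dim_leI hausdorff_measure_real_zero) auto
  finally show "hausdorff_dim S \<le> 1 + ennreal e" using e by (simp add: ennreal_plus)
qed

section \<open>From parabolas back to the cone\<close>

text \<open>
  In the basis rotated by \<open>\<alpha>\<close>, with coordinates \<open>X\<close>, \<open>Y\<close>, \<open>T\<close>, this is
  \<open>(T + X, 2 Y, T - X)\<close>: the coefficients of \<open>T (1 + u\<^sup>2) + X (1 - u\<^sup>2) + 2 Y u\<close>.
\<close>

definition cone_coords :: "real \<Rightarrow> real^3 \<Rightarrow> real^3" where
  "cone_coords \<alpha> z = vector
     [z $ 3 + (z $ 1 * cos \<alpha> + z $ 2 * sin \<alpha>), 2 * (z $ 2 * cos \<alpha> - z $ 1 * sin \<alpha>),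
      z $ 3 - (z $ 1 * cos \<alpha> + z $ 2 * sin \<alpha>)]"

lemma linear_cone_coords: "linear (cone_coords \<alpha>)"
  by (rule linearI) (simp_all add: cone_coords_def vec_eq_iff forall_3 algebra_simps)

lemma inj_cone_coords: "inj (cone_coords \<alpha>)"
  unfolding linear_injective_0[OF linear_cone_coords]
proof (intro allI impI)
  fix z :: "real^3" assume "cone_coords \<alpha> z = 0"
  then have 0: "z $ 3 = 0" "z $ 1 * cos \<alpha> + z $ 2 * sin \<alpha> = 0" "z $ 2 * cos \<alpha> - z $ 1 * sin \<alpha> = 0"
    by (simp_all add: cone_coords_def vec_eq_iff forall_3)
  have "(z $ 1)\<^sup>2 + (z $ 2)\<^sup>2 = ((z $ 1)\<^sup>2 + (z $ 2)\<^sup>2) * ((sin \<alpha>)\<^sup>2 + (cos \<alpha>)\<^sup>2)" by simp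
  also have "\<dots> = (z $ 1 * cos \<alpha> + z $ 2 * sin \<alpha>)\<^sup>2 + (z $ 2 * cos \<alpha> - z $ 1 * sin \<alpha>)\<^sup>2"
    by algebra
  finally have "(z $ 1)\<^sup>2 + (z $ 2)\<^sup>2 = 0" by (simp add: 0)
  then show "z = 0" using 0 by (simp add: vec_eq_iff forall_3)
qed

lemma parab_cone_coords:
  "parab (cone_coords \<alpha> z) u = (1 + u\<^sup>2) * sqrt 2 * proj_line (\<alpha> + 2 * arctan u) z"
proof -
  have 1: "0 < 1 + u\<^sup>2" by (simp add: add_pos_nonneg)
  have c: "(1 + u\<^sup>2) * cos (2 * arctan u) = 1 - u\<^sup>2"
    using 1 unfolding cos_double cos_arctan sin_arctan by (simp add: power_divide field_simps)
  have s: "(1 + u\<^sup>2) * sin (2 * arctan u) = 2 * u"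
    using 1 unfolding sin_double cos_arctan sin_arctan by (simp add: field_simps)
  have "(1 + u\<^sup>2) * sqrt 2 * proj_line (\<alpha> + 2 * arctan u) z
    = (1 + u\<^sup>2) * (z $ 1 * cos (\<alpha> + 2 * arctan u) + z $ 2 * sin (\<alpha> + 2 * arctan u) + z $ 3)"
    by (simp add: proj_line_def cone_curve_def inner_vec_def sum_3 field_simps)
  also have "\<dots> = (z $ 1 * cos \<alpha> + z $ 2 * sin \<alpha>) * ((1 + u\<^sup>2) * cos (2 * arctan u))
      + (z $ 2 * cos \<alpha> - z $ 1 * sin \<alpha>) * ((1 + u\<^sup>2) * sin (2 * arctan u)) + z $ 3 * (1 + u\<^sup>2)"
    unfolding cos_add sin_add by algebra
  also have "\<dots> = parab (cone_coords \<alpha> z) u"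
    unfolding c s by (simp add: parab_def cone_coords_def algebra_simps)
  finally show ?thesis by simp
qed

lemma analytic_set_image:
  assumes g: "continuous_on UNIV g" and A: "analytic_set A"
  shows "analytic_set (g ` A)"
proof (cases "A = {}")
  case False
  then obtain f :: "(nat \<Rightarrow> nat) \<Rightarrow> _" where f: "continuous_on UNIV f" "A = range f"
    using A by (auto simp: analytic_set_def)
  have "continuous_on UNIV (g \<circ> f)"
    using f(1) g by (intro continuous_on_compose continuous_on_subset[OF g]) auto
  moreover have "g ` A = range (g \<circ> f)" by (simp add: f(2) image_comp)
  ultimately show ?thesis unfolding analytic_set_def by blast
qed (simp add: analytic_set_def)

lemma unit_cell_content_pos:
  assumes C: "bounded C" and pos: "0 < dyadic.content s C"
  obtains k where "0 < dyadic.content s (C \<inter> dyadic.cube (0, k))"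
proof -
  obtain b where b: "\<And>x. x \<in> C \<Longrightarrow> norm x \<le> b" using C unfolding bounded_iff by blast
  define L where "L = {\<lfloor>- b\<rfloor>..\<lfloor>b\<rfloor>} \<times> {\<lfloor>- b\<rfloor>..\<lfloor>b\<rfloor>} \<times> {\<lfloor>- b\<rfloor>..\<lfloor>b\<rfloor>}"
  have L: "dyadic_cell 0 x \<in> L" if "x \<in> C" for x
  proof -
    have "- b \<le> x $ i \<and> x $ i \<le> b" for i
      using b[OF that] component_le_norm_cart[of x i] by linarith
    then show ?thesis by (simp add: L_def dyadic_cell_def floor_mono)
  qed
  have "C = (\<Union>k\<in>L. C \<inter> dyadic.cube (0, k))"
    using L by (auto simp: dyadic.cube_def)
  then have "dyadic.content s C \<le> (\<Sum>k\<in>L. dyadic.content s (C \<inter> dyadic.cube (0, k)))"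
    using dyadic.content_UN_le[of L s "\<lambda>k. C \<inter> dyadic.cube (0, k)"] by (simp add: L_def)
  then have "(\<Sum>k\<in>L. dyadic.content s (C \<inter> dyadic.cube (0, k))) \<noteq> 0" using pos by auto
  then obtain k where "dyadic.content s (C \<inter> dyadic.cube (0, k)) \<noteq> 0" by (rule sum.not_neutral_contains_not_neutral)
  then show ?thesis using that[of k] by (simp add: zero_less_iff_neq_zero)
qed

text \<open>For fixed \<open>u\<close> the two images differ only by the positive factor
  \<open>(1 + u\<^sup>2) * sqrt 2\<close>.\<close>

lemma hausdorff_dim_parab_le:
  "hausdorff_dim ((\<lambda>z. parab z u) ` cone_coords \<alpha> ` K) \<le> hausdorff_dim (proj_line (\<alpha> + 2 * arctan u) ` K)"
proof -
  have c: "0 < (1 + u\<^sup>2) * sqrt 2" by (simp add: add_pos_nonneg)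
  have "(\<lambda>z. parab z u) ` cone_coords \<alpha> ` K
    = (\<lambda>x. ((1 + u\<^sup>2) * sqrt 2) * x) ` proj_line (\<alpha> + 2 * arctan u) ` K"
    by (simp add: image_image parab_cone_coords)
  then show ?thesis
    using hausdorff_dim_lipschitz_image[OF c, of "proj_line (\<alpha> + 2 * arctan u) ` K" "\<lambda>x. ((1 + u\<^sup>2) * sqrt 2) * x"] c
    by (simp add: dist_real_def abs_mult flip: right_diff_distrib)
qed

lemma hausdorff_measure_cone_coords:
  assumes s: "0 \<le> s" and K: "hausdorff_measure s K \<noteq> 0"
  shows "hausdorff_measure s (cone_coords \<alpha> ` K) \<noteq> 0"
proof
  assume 0: "hausdorff_measure s (cone_coords \<alpha> ` K) = 0"
  obtain B where B: "0 < B" "\<And>x. B * norm x \<le> norm (cone_coords \<alpha> x)"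
    using linear_inj_bounded_below_pos[OF linear_cone_coords inj_cone_coords] by blast
  have inv: "inv (cone_coords \<alpha>) (cone_coords \<alpha> x) = x" for x by (rule inv_f_f[OF inj_cone_coords])
  have "dist (inv (cone_coords \<alpha>) v) (inv (cone_coords \<alpha>) w) \<le> 1 / B * dist v w"
    if vw: "v \<in> cone_coords \<alpha> ` K" "w \<in> cone_coords \<alpha> ` K" for v w
  proof -
    obtain x y where xy: "v = cone_coords \<alpha> x" "w = cone_coords \<alpha> y" using vw by blast
    have "B * norm (x - y) \<le> norm (v - w)"
      using B(2)[of "x - y"] unfolding xy linear_diff[OF linear_cone_coords] .
    then show ?thesis using B(1) by (simp add: xy inv dist_norm pos_le_divide_eq mult.commute)
  qed
  then have "hausdorff_measure s (inv (cone_coords \<alpha>) ` cone_coords \<alpha> ` K) = 0"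
    using B(1) by (intro hausdorff_measure_lipschitz_image[OF s 0, of "1 / B"]) auto
  then show False using K by (simp add: image_image inv)
qed

section \<open>Null sets of exceptional angles\<close>

lemma AE_lborel_imp_negligible:
  fixes P :: "'a::euclidean_space \<Rightarrow> bool"
  assumes "AE x in lborel. P x"
  shows "negligible {x. \<not> P x}"
proof -
  obtain N where "{x. \<not> P x} \<subseteq> N" "N \<in> null_sets lborel"
    using assms by (auto elim!: AE_E simp: null_sets_def)
  then show ?thesis
    by (metis negligible_iff_null_sets negligible_subset null_sets_completionI)
qed

text \<open>On an arc of length \<open>pi / 2\<close> the half-angle from \<alpha> stays below
  \<open>pi / 4\<close>, so its tangent lies in the unit interval. The substitution is
  differentiable and hence carries null sets of \<open>u\<close> to null sets of \<theta>.\<close>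

lemma negligible_exceptional_arc:
  assumes K: "analytic_set K" and s: "0 < s" "s < \<sigma>" "\<sigma> < 1" and \<sigma>: "hausdorff_measure \<sigma> K \<noteq> 0"
  shows "negligible {\<theta> \<in> {\<alpha>..<\<alpha> + pi / 2}. \<not> ennreal s \<le> hausdorff_dim (proj_line \<theta> ` K)}"
proof -
  have \<sigma>0: "0 < \<sigma>" using s by simp
  have lin: "continuous_on UNIV (cone_coords \<alpha>)"
    by (rule linear_continuous_on_compose[OF continuous_on_id linear_cone_coords, simplified])
  have "0 < dyadic.content \<sigma> (cone_coords \<alpha> ` K)"
    using content_zero_imp_hausdorff_zero[OF \<sigma>0] hausdorff_measure_cone_coords[OF _ \<sigma>] \<sigma>0
    by (metis less_imp_le zero_less_iff_neq_zero)
  then obtain C where C: "compact C" "C \<subseteq> cone_coords \<alpha> ` K" "0 < dyadic.content \<sigma> C"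
    by (rule analytic_compact_subset[OF analytic_set_image[OF lin K]])
  obtain k where k: "0 < dyadic.content \<sigma> (C \<inter> dyadic.cube (0, k))"
    using unit_cell_content_pos[OF compact_imp_bounded[OF C(1)] C(3)] .
  obtain \<mu> where "cell_measure \<mu> \<sigma> C k" using cell_measure_exists[OF k \<sigma>0 s(3)] by blast
  then have "AE u in lborel. u \<in> {0..<1} \<longrightarrow> ennreal s \<le> hausdorff_dim ((\<lambda>z. parab z u) ` C)"
    by (rule cell_measure.AE_dim_ge[OF _ C(1) s(1,2)])
  from AE_lborel_imp_negligible[OF this]
  have N: "negligible {u. \<not> (u \<in> {0..<1} \<longrightarrow> ennreal s \<le> hausdorff_dim ((\<lambda>z. parab z u) ` C))}"
    (is "negligible ?N") .
  have "((\<lambda>u. \<alpha> + 2 * arctan u) has_real_derivative 2 * inverse (1 + u\<^sup>2)) (at u within ?N)" for u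
    by (auto intro!: derivative_eq_intros)
  then have "(\<lambda>u. \<alpha> + 2 * arctan u) differentiable_on ?N"
    unfolding differentiable_on_def has_field_derivative_def by (blast intro: differentiableI)
  then have "negligible ((\<lambda>u. \<alpha> + 2 * arctan u) ` ?N)"
    using N by (intro negligible_differentiable_image_negligible) auto
  moreover have "\<theta> \<in> (\<lambda>u. \<alpha> + 2 * arctan u) ` ?N"
    if \<theta>: "\<theta> \<in> {\<alpha>..<\<alpha> + pi / 2}" "\<not> ennreal s \<le> hausdorff_dim (proj_line \<theta> ` K)" for \<theta>
  proof -
    define x where "x = (\<theta> - \<alpha>) / 2"
    have x: "0 \<le> x" "x < pi / 4" using \<theta>(1) by (auto simp: x_def)
    have "tan 0 \<le> tan x" using x by (intro tan_mono_le) auto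
    moreover have "tan x < tan (pi / 4)" using x by (intro tan_monotone) auto
    ultimately have u: "tan x \<in> {0..<1}" by (simp add: tan_45)
    have "arctan (tan x) = x" using x by (intro arctan_tan) auto
    then have \<theta>u: "\<theta> = \<alpha> + 2 * arctan (tan x)" by (simp add: x_def)
    have "hausdorff_dim ((\<lambda>z. parab z (tan x)) ` C) \<le> hausdorff_dim (proj_line \<theta> ` K)"
      unfolding \<theta>u using C(2) by (intro order_trans[OF hausdorff_dim_mono hausdorff_dim_parab_le]) auto
    then have "\<not> ennreal s \<le> hausdorff_dim ((\<lambda>z. parab z (tan x)) ` C)"
      using \<theta>(2) order_trans by blast
    then show ?thesis using u \<theta>u by blast
  qed
  ultimately show ?thesis by (blast intro: negligible_subset)
qed

lemma negligible_exceptional: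
  assumes K: "analytic_set K" and s: "0 < s" "ennreal s < min (hausdorff_dim K) 1"
  shows "negligible {\<theta> \<in> {0..<2 * pi}. \<not> ennreal s \<le> hausdorff_dim (proj_line \<theta> ` K)}"
proof -
  obtain t where t: "ennreal s < t" "t < min (hausdorff_dim K) 1" using dense[OF s(2)] by blast
  then obtain \<sigma> where \<sigma>: "0 \<le> \<sigma>" "t = ennreal \<sigma>" by (cases t) auto
  have \<sigma>1: "s < \<sigma>" "\<sigma> < 1" using t s(1) \<sigma> by (auto simp: ennreal_less_iff simp flip: ennreal_1)
  have "hausdorff_measure \<sigma> K \<noteq> 0" using hausdorff_dim_leI[OF \<sigma>(1), of K] t \<sigma>(2) by auto
  note arc = negligible_exceptional_arc[OF K s(1) \<sigma>1 this]
  let ?B = "\<lambda>\<alpha>. {\<theta> \<in> {\<alpha>..<\<alpha> + pi / 2}. \<not> ennreal s \<le> hausdorff_dim (proj_line \<theta> ` K)}"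
  \<comment> \<open>Four arcs, each with its own rotation \<alpha>, cover all angles.\<close>
  have "negligible (?B 0 \<union> ?B (pi / 2) \<union> ?B pi \<union> ?B (3 / 2 * pi))"
    by (intro negligible_Un arc)
  then show ?thesis by (rule negligible_subset) (auto simp: not_le)
qed

lemma hausdorff_dim_proj_line_le: "hausdorff_dim (proj_line \<theta> ` K) \<le> min (hausdorff_dim K) 1"
proof -
  have "dist (proj_line \<theta> x) (proj_line \<theta> y) \<le> 1 * dist x y" for x y
    using Cauchy_Schwarz_ineq2[of "cone_curve \<theta>" "x - y"] cone_curve_in_sphere[of \<theta>]
    by (simp add: proj_line_def dist_norm inner_diff_right)
  then have "hausdorff_dim (proj_line \<theta> ` K) \<le> hausdorff_dim K"
    by (intro hausdorff_dim_lipschitz_image[of 1]) auto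
  then show ?thesis using hausdorff_dim_real_le_1 by simp
qed

theorem theorem1p2:
  fixes K :: "(real^3) set"
  assumes "analytic_set K"
  shows "AE \<theta> in lebesgue_on {0..<2 * pi}.
           hausdorff_dim (proj_line \<theta> ` K) = min (hausdorff_dim K) 1"
proof -
  \<comment> \<open>The upper bound holds for every \<theta>. If equality fails, a positive rational
    lies strictly between the two sides, so countably many null sets contain all exceptions.\<close>
  define R where "R = {r :: rat. 0 < r \<and> ennreal (real_of_rat r) < min (hausdorff_dim K) 1}"
  define N where "N r = {\<theta> \<in> {0..<2 * pi}. \<not> ennreal (real_of_rat r) \<le> hausdorff_dim (proj_line \<theta> ` K)}" for r
  have "negligible (\<Union>r\<in>R. N r)"
  proof (rule negligible_countable_Union)
    show "countable (N ` R)" by simp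
  next
    fix S assume "S \<in> N ` R"
    then obtain r where r: "S = N r" "r \<in> R" by blast
    show "negligible S"
      unfolding r(1) N_def using r(2) by (intro negligible_exceptional assms) (auto simp: R_def)
  qed
  then have null: "(\<Union>r\<in>R. N r) \<in> null_sets lebesgue" by (simp add: negligible_iff_null_sets)
  have "hausdorff_dim (proj_line \<theta> ` K) = min (hausdorff_dim K) 1"
    if \<theta>: "\<theta> \<in> {0..<2 * pi}" "\<theta> \<notin> (\<Union>r\<in>R. N r)" for \<theta>
  proof (rule ccontr)
    assume "hausdorff_dim (proj_line \<theta> ` K) \<noteq> min (hausdorff_dim K) 1"
    then have "hausdorff_dim (proj_line \<theta> ` K) < min (hausdorff_dim K) 1"
      using hausdorff_dim_proj_line_le[of \<theta> K] by (rule le_neq_trans[rotated])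
    then obtain r where r: "hausdorff_dim (proj_line \<theta> ` K) < ennreal (real_of_rat r)"
      "ennreal (real_of_rat r) < min (hausdorff_dim K) 1"
      using ennreal_rat_dense by blast
    have "0 < ennreal (real_of_rat r)" using r(1) by (rule le_less_trans[rotated]) simp
    then have "r \<in> R" using r(2) by (simp add: R_def)
    moreover have "\<theta> \<in> N r" using \<theta>(1) r(1) by (simp add: N_def not_le)
    ultimately show False using \<theta>(2) by blast
  qed
  then have "AE \<theta> in lebesgue. \<theta> \<in> {0..<2 * pi} \<longrightarrow> hausdorff_dim (proj_line \<theta> ` K) = min (hausdorff_dim K) 1"
    by (intro AE_I'[OF null]) blast
  then show ?thesis by (subst AE_restrict_space_iff) auto
qed

end
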